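(* Let $n\ge 1$, $0<\alpha<2$, and let $u\in L_\alpha$ be $\alpha$-harmonic in $\mathbb{R}^n$. Then $u$ is affine (that is, there are $a\in\mathbb{R}^n$ and $b\in\mathbb{R}$ with $u(x)=a\cdot x+b$). In particular, if $\alpha\le 1$, then $u$ is constant.
   Context: $L_\alpha$ denotes the space of (measurable) functions $u:\mathbb{R}^n\to\mathbb{R}$ such that $\int_{\mathbb{R}^n}\frac{|u(x)|}{1+|x|^{n+\alpha}}\,dx<\infty$; functions in $L_\alpha$ that agree almost everywhere are identified. For $\phi$ in the Schwartz space $\mathcal{S}(\mathbb{R}^n)$ the fractional Laplacian is $$(-\Delta)^{\alpha/2}\phi(x)=C_{n,\alpha}\lim_{\epsilon\to0}\int_{\mathbb{R}^n\setminus B_\epsilon(x)}\frac{\phi(x)-\phi(z)}{|x-z|^{n+\alpha}}\,dz,$$ where $C_{n,\alpha}>0$ is the normalizing constant for which, equivalently, $\mathcal{F}((-\Delta)^{\alpha/2}\phi)(\xi)=|\xi|^\alpha\mathcal{F}\phi(\xi)$, with $\mathcal{F}$ the Fourier transform. A function $u$ is called $\alpha$-harmonic (in $\mathbb{R}^n$) if $u\in L_\alpha$ and $(-\Delta)^{\alpha/2}u=0$ in the sense of distributions, i.e. $\int_{\mathbb{R}^n}u(x)\,(-\Delta)^{\alpha/2}\phi(x)\,dx=0$ for all $\phi\in C_0^\infty(\mathbb{R}^n)$ (smooth functions with compact support). *)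

theory Defs
  imports "HOL-Analysis.Analysis"
begin

text \<open>
  Iterated partial derivatives, a list of basis vectors playing the role of a multi-index.
  The Frechet derivative in direction \<open>b\<close> is the partial derivative wherever the function is
  differentiable, which \<open>smooth\<close> demands at every order.
\<close>

primrec iter_partial :: "'a list \<Rightarrow> ('a::euclidean_space \<Rightarrow> real) \<Rightarrow> 'a \<Rightarrow> real" where
  "iter_partial [] f = f"
| "iter_partial (b # bs) f = (\<lambda>x. frechet_derivative (iter_partial bs f) (at x) b)"

definition smooth :: "('a::euclidean_space \<Rightarrow> real) \<Rightarrow> bool" where
  "smooth f \<longleftrightarrow> (\<forall>bs\<in>lists Basis. \<forall>x. iter_partial bs f differentiable (at x))"

definition test_functions :: "('a::euclidean_space \<Rightarrow> real) set" where
  "test_functions = {\<phi>. smooth \<phi> \<and> compact (closure {x. \<phi> x \<noteq> 0})}"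

definition schwartz :: "('a::euclidean_space \<Rightarrow> real) set" where
  "schwartz = {\<phi>. smooth \<phi> \<and>
     (\<forall>bs\<in>lists Basis. \<forall>k::nat. bounded (range (\<lambda>x. norm x ^ k * iter_partial bs \<phi> x)))}"

definition fourier :: "('a::euclidean_space \<Rightarrow> real) \<Rightarrow> 'a \<Rightarrow> complex" where
  "fourier f \<xi> = (LINT x|lebesgue. cis (- (x \<bullet> \<xi>)) * complex_of_real (f x))"

text \<open>The principal value integral, without its normalizing constant.\<close>

definition frac_laplacian_pv ::
    "real \<Rightarrow> ('a::euclidean_space \<Rightarrow> real) \<Rightarrow> 'a \<Rightarrow> real" where
  "frac_laplacian_pv \<alpha> \<phi> x =
     Lim (at_right 0) (\<lambda>\<epsilon>. LINT z:(- ball x \<epsilon>)|lebesgue.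
       (\<phi> x - \<phi> z) / norm (x - z) powr (real DIM('a) + \<alpha>))"

text \<open>
  The normalizing constant \<open>C\<^sub>n\<^sub>,\<^sub>\<alpha>\<close>: the positive number that makes the operator the Fourier
  multiplier with symbol \<open>|\<xi>|\<^sup>\<alpha>\<close> (for the Fourier transform with kernel \<open>e\<^sup>-\<^sup>i\<^sup>x\<^sup>\<xi>\<close>; a constant
  factor in front of the transform would not matter).
\<close>

definition frac_laplacian_const :: "'a::euclidean_space itself \<Rightarrow> real \<Rightarrow> real" where
  "frac_laplacian_const TYPE('a) \<alpha> =
     (THE c. c > 0 \<and> (\<forall>\<phi>\<in>schwartz. \<forall>\<xi>::'a.
        fourier (\<lambda>x. c * frac_laplacian_pv \<alpha> \<phi> x) \<xi>
          = complex_of_real (norm \<xi> powr \<alpha>) * fourier \<phi> \<xi>))"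

definition frac_laplacian ::
    "real \<Rightarrow> ('a::euclidean_space \<Rightarrow> real) \<Rightarrow> 'a \<Rightarrow> real" where
  "frac_laplacian \<alpha> \<phi> x = frac_laplacian_const TYPE('a) \<alpha> * frac_laplacian_pv \<alpha> \<phi> x"

text \<open>
  Elements of \<open>L\<^sub>\<alpha>\<close> are represented by functions; that they are identified when they agree almost
  everywhere means that statements about their values hold almost everywhere.
\<close>

definition L_weighted :: "real \<Rightarrow> ('a::euclidean_space \<Rightarrow> real) set" where
  "L_weighted \<alpha> = {u. u \<in> borel_measurable lebesgue \<and>
     integrable lebesgue (\<lambda>x. \<bar>u x\<bar> / (1 + norm x powr (real DIM('a) + \<alpha>)))}"

definition frac_harmonic :: "real \<Rightarrow> ('a::euclidean_space \<Rightarrow> real) \<Rightarrow> bool" where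
  "frac_harmonic \<alpha> u \<longleftrightarrow> u \<in> L_weighted \<alpha> \<and>
     (\<forall>\<phi>\<in>test_functions. (LINT x|lebesgue. u x * frac_laplacian \<alpha> \<phi> x) = 0)"

end

theory Submission
  imports Defs "HOL-Probability.Characteristic_Functions"
begin

text \<open>
  The function \<open>u\<close> is tested against heat kernels. Write \<open>\<Lambda>\<close> for the unnormalized singular integral operator,
  \<open>w(x) = (1 + |x|)^(-n-\<alpha>)\<close> for the weight dual to \<open>L\<^sub>\<alpha>\<close>, and \<open>h\<^sub>t\<close> for the heat kernel, and put
  \<open>U(x) = \<integral> u(z) h\<^sub>t(z - x) dz\<close>.

  \<^emph>\<open>\<open>U\<close> does not depend on \<open>t\<close>.\<close> On the Fourier side \<open>\<Lambda>\<close> multiplies by a constant times \<open>|\<xi>|\<^sup>\<alpha>\<close>, and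
  the Gamma integral of \<open>\<rho>^(\<alpha>/2-1) exp(-\<rho> |\<xi>|\<^sup>2)\<close> over \<open>\<rho> > 0\<close> is a constant times \<open>|\<xi>|^(-\<alpha>)\<close>. Hence \<open>\<partial>\<^sub>t h\<^sub>t\<close> is, up
  to a nonzero factor, the superposition \<open>\<integral> \<rho>^(\<alpha>/2-1) \<Lambda>(\<partial>\<^sub>t h_(t+\<rho>)) d\<rho>\<close> (\<open>Lam_heat_dt_superposition\<close>). Scaling
  shows \<open>|\<Lambda>(\<partial>\<^sub>t h\<^sub>r)| \<le> C w / r\<close> (\<open>Lam_heat_dt_le\<close>); the factor \<open>1 / r\<close>, gained by differentiating in time,
  makes the superposition converge absolutely against \<open>u\<close> because \<open>\<alpha> / 2 < 1\<close>. Since \<open>u\<close> annihilates every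
  \<open>\<Lambda>(\<partial>\<^sub>t h\<^sub>r)\<close>, it annihilates \<open>\<partial>\<^sub>t h\<^sub>t\<close> (\<open>pairing_heat_dt\<close>), so \<open>U\<close> is the same for all \<open>t\<close>.

  \<^emph>\<open>Letting \<open>t\<close> tend to infinity, \<open>U\<close> is affine\<close> (\<open>pairing_heat_affine\<close>). In
  \<open>U(x) - U(0) - \<Sum>\<^sub>b x\<^sub>b (U(b) - U(0))\<close>, the sum being over the standard basis, the first-order Taylor terms of
  \<open>h\<^sub>t\<close> cancel, and the second-order remainders are at most a constant times \<open>t^(\<alpha>/2-1) w\<close>, which tends to \<open>0\<close>
  because \<open>\<alpha> < 2\<close>.

  \<^emph>\<open>Letting \<open>t\<close> tend to zero, \<open>u = U\<close> almost everywhere\<close> (\<open>AE_eq_pairing_heat\<close>), as \<open>h\<^sub>t\<close> is an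
  approximate identity. If \<open>\<alpha> \<le> 1\<close>, comparing \<open>x\<close> with \<open>2x\<close> shows that no nonzero linear function lies in \<open>L\<^sub>\<alpha>\<close>
  (\<open>weighted_linear_integrable_imp_zero\<close>), so the affine function is constant.

  Two points need care. Harmonicity is only given for test functions, so it has to be extended to \<open>\<partial>\<^sub>t h\<^sub>r\<close>: all
  estimates on \<open>\<Lambda> f\<close> come from one notion, \<open>tame\<close>, which says that \<open>f\<close>, its gradient and its second-order Taylor
  remainder are \<open>O(w)\<close>; truncations of a tame function by dilated bumps are tame with a uniform constant, and
  dominated convergence applies (\<open>pairing_elementary_zero\<close>). And the normalizing constant is only described as the
  unique one with a certain Fourier property; that it is not zero means proving that property for all Schwartz
  functions (\<open>frac_laplacian_const_eq\<close>).

  The singular kernel is handled throughout as a superposition of Gaussians,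
  \<open>\<Gamma>(p) |y|^(-2p) = \<integral> \<lambda>^(p-1) exp(-\<lambda> |y|\<^sup>2) d\<lambda>\<close> with \<open>2p = n + \<alpha>\<close>. This reduces its integrability and its Fourier
  symbol to Gaussian integrals, in which scaling and rotational symmetry are visible.
\<close>

section \<open>Gaussian integrals\<close>

text \<open>
  Lebesgue measure is the image of the product measure over the coordinates.
\<close>

lemma lborel_prod_integral:
  fixes f :: "'a::euclidean_space \<Rightarrow> real \<Rightarrow> complex"
  assumes "\<And>b. b \<in> Basis \<Longrightarrow> integrable lborel (f b)"
  shows "integrable lborel (\<lambda>x::'a. \<Prod>b\<in>Basis. f b (x \<bullet> b))"
    and "(LBINT x::'a. \<Prod>b\<in>Basis. f b (x \<bullet> b)) = (\<Prod>b\<in>Basis. LBINT t. f b t)"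
proof -
  interpret P: product_sigma_finite "\<lambda>_::'a. lborel :: real measure"
    by standard
  have lb: "(lborel :: 'a measure) = distr (\<Pi>\<^sub>M b\<in>Basis. lborel) borel (\<lambda>g. \<Sum>b\<in>Basis. g b *\<^sub>R b)"
    unfolding lborel_eq_real by (simp add: lborel_def)
  have meas: "(\<lambda>g. \<Sum>b\<in>Basis. g b *\<^sub>R b) \<in> measurable (\<Pi>\<^sub>M b\<in>(Basis::'a set). (lborel::real measure)) borel"
    by measurable
  have [measurable]: "f b \<in> borel_measurable borel" if "b \<in> Basis" for b
    using borel_measurable_integrable[OF assms[OF that]] by simp
  have fm: "(\<lambda>x::'a. \<Prod>b\<in>Basis. f b (x \<bullet> b)) \<in> borel_measurable borel"
    by measurable
  have eq: "(\<Prod>b\<in>Basis. f b ((\<Sum>c\<in>Basis. g c *\<^sub>R c) \<bullet> b)) = (\<Prod>b\<in>Basis. f b (g b))" for g :: "'a \<Rightarrow> real"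
    by (intro prod.cong refl) (simp add: inner_sum_left_Basis)
  have int: "integrable (\<Pi>\<^sub>M b\<in>(Basis::'a set). lborel) (\<lambda>g. \<Prod>b\<in>Basis. f b (g b))"
    by (intro P.product_integrable_prod assms) auto
  show "integrable lborel (\<lambda>x::'a. \<Prod>b\<in>Basis. f b (x \<bullet> b))"
    unfolding lb by (subst integrable_distr_eq[OF meas fm]) (simp only: eq int)
  show "(LBINT x::'a. \<Prod>b\<in>Basis. f b (x \<bullet> b)) = (\<Prod>b\<in>Basis. LBINT t. f b t)"
    unfolding lb by (subst integral_distr[OF meas fm]) (simp only: eq P.product_integral_prod[OF finite_Basis assms])
qed

lemma borel_measurable_cis [measurable]: "cis \<in> borel_measurable borel"
  by (intro borel_measurable_continuous_onI continuous_on_cis continuous_on_id)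

text \<open>
  The characteristic function of the standard normal distribution, rescaled.
\<close>

lemma gauss_cis_integral_1D:
  assumes "l > 0"
  shows "has_bochner_integral lborel (\<lambda>t::real. complex_of_real (exp (- l * t\<^sup>2)) * cis (a * t))
     (complex_of_real (sqrt (pi / l) * exp (- a\<^sup>2 / (4 * l))))"
proof -
  have ch: "(CLINT x|density lborel std_normal_density. cis (s * x)) = complex_of_real (exp (- (s\<^sup>2) / 2))" for s
    using fun_cong[OF char_std_normal_distribution, of s] by (simp add: char_def cis_conv_exp mult_ac)
  have eq: "(CLINT x|density lborel std_normal_density. cis (s * x))
      = (CLBINT x. std_normal_density x *\<^sub>R cis (s * x))" for s
    by (rule integral_density) auto
  have int: "integrable lborel (\<lambda>x. std_normal_density x *\<^sub>R cis (s * x))" for s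
    by (rule Bochner_Integration.integrable_bound[OF integrable_std_normal_moment[of 0]])
      (auto)
  define s where "s = a / sqrt (2 * l)"
  have h: "has_bochner_integral lborel (\<lambda>x. std_normal_density x *\<^sub>R cis (s * x)) (complex_of_real (exp (- (s\<^sup>2) / 2)))"
    using ch[of s] eq[of s] int[of s] by (simp add: has_bochner_integral_iff)
  define c where "c = sqrt (2 * l)"
  have c: "c > 0" "c\<^sup>2 = 2 * l" using assms by (auto simp: c_def)
  have "has_bochner_integral lborel (\<lambda>x. std_normal_density (0 + c * x) *\<^sub>R cis (s * (0 + c * x)))
        (complex_of_real (exp (- (s\<^sup>2) / 2)) /\<^sub>R \<bar>c\<bar>)"
    using iffD1[OF lborel_has_bochner_integral_real_affine_iff[of c _ _ 0] h] c by simp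
  then have "has_bochner_integral lborel (\<lambda>x. sqrt (2*pi) *\<^sub>R (std_normal_density (0 + c * x) *\<^sub>R cis (s * (0 + c * x))))
        (sqrt (2*pi) *\<^sub>R (complex_of_real (exp (- (s\<^sup>2) / 2)) /\<^sub>R \<bar>c\<bar>))"
    by (rule has_bochner_integral_scaleR_right)
  moreover have "sqrt (2*pi) *\<^sub>R (std_normal_density (0 + c * x) *\<^sub>R cis (s * (0 + c * x))) = complex_of_real (exp (- l * x\<^sup>2)) * cis (a * x)" for x
  proof -
    have e: "s * (c * x) = a * x" using c by (simp add: s_def c_def)
    show ?thesis using c unfolding add_0 e by (simp add: std_normal_density_def power_mult_distrib scaleR_conv_of_real)
  qed
  moreover have "sqrt (2*pi) *\<^sub>R (complex_of_real (exp (- (s\<^sup>2) / 2)) /\<^sub>R \<bar>c\<bar>) = complex_of_real (sqrt (pi / l) * exp (- a\<^sup>2 / (4 * l)))"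
  proof -
    have "s\<^sup>2 / 2 = a\<^sup>2 / (4 * l)" using assms by (simp add: s_def power_divide)
    moreover have "sqrt (2 * pi) / c = sqrt (pi / l)" by (simp add: c_def real_sqrt_divide[symmetric])
    ultimately show ?thesis using c by (simp add: scaleR_conv_of_real field_simps flip: of_real_mult)
  qed
  ultimately show ?thesis by simp
qed

text \<open>
  Both factors of the integrand split over the coordinates, so this is a product of one-dimensional integrals.
\<close>

lemma gauss_cis_integral:
  fixes x :: "'a::euclidean_space"
  assumes "l > 0"
  shows "has_bochner_integral lborel (\<lambda>\<xi>::'a. complex_of_real (exp (- l * (norm \<xi>)\<^sup>2)) * cis (x \<bullet> \<xi>))
     (complex_of_real ((pi / l) powr (DIM('a) / 2) * exp (- (norm x)\<^sup>2 / (4 * l))))"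
proof -
  define f where "f b t = complex_of_real (exp (- l * t\<^sup>2)) * cis ((x \<bullet> b) * t)" for b t
  have i: "integrable lborel (f b)" and v: "(LBINT t. f b t) = complex_of_real (sqrt (pi / l) * exp (- (x \<bullet> b)\<^sup>2 / (4 * l)))" for b
    using gauss_cis_integral_1D[OF assms, of "x \<bullet> b"] by (simp_all add: has_bochner_integral_iff f_def[abs_def])
  have ns: "(norm (\<xi>::'a))\<^sup>2 = (\<Sum>b\<in>Basis. (\<xi> \<bullet> b)\<^sup>2)" for \<xi>
    unfolding power2_norm_eq_inner euclidean_inner[of \<xi> \<xi>] by (simp add: power2_eq_square)
  have cs: "cis (\<Sum>b\<in>A. g b) = (\<Prod>b\<in>A. cis (g b))" if "finite A" for A :: "'a set" and g
    using that by induction (auto simp: cis_mult[symmetric])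
  have prod: "(\<Prod>b\<in>Basis. f b (\<xi> \<bullet> b)) = complex_of_real (exp (- l * (norm \<xi>)\<^sup>2)) * cis (x \<bullet> \<xi>)" for \<xi> :: 'a
    unfolding f_def ns euclidean_inner[of x \<xi>]
    by (simp add: prod.distrib cs sum_distrib_left sum_negf[symmetric] exp_sum)
  have vp: "(\<Prod>b\<in>(Basis::'a set). sqrt (pi / l) * exp (- (x \<bullet> b)\<^sup>2 / (4 * l))) =
     (pi / l) powr (DIM('a) / 2) * exp (- (norm x)\<^sup>2 / (4 * l))"
  proof -
    have "(\<Prod>b\<in>(Basis::'a set). exp (- (x \<bullet> b)\<^sup>2 / (4 * l))) = exp (- (norm x)\<^sup>2 / (4 * l))"
      unfolding ns by (simp add: exp_sum[symmetric] sum_divide_distrib sum_negf[symmetric])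
    moreover have "sqrt (pi / l) ^ DIM('a) = (pi / l) powr (DIM('a) / 2)"
      using assms by (simp add: powr_half_sqrt[symmetric] powr_powr flip: powr_realpow)
    ultimately show ?thesis by (simp add: prod.distrib)
  qed
  show ?thesis
    using lborel_prod_integral[of f, OF i] unfolding prod v of_real_prod[symmetric] vp by (simp only: has_bochner_integral_iff simp_thms)
qed

section \<open>The singular kernel and its Fourier symbol\<close>

definition rker :: "real \<Rightarrow> 'a::euclidean_space \<Rightarrow> real" where
  "rker \<alpha> y = 1 / norm y powr (real DIM('a) + \<alpha>)"

definition wt :: "real \<Rightarrow> 'a::euclidean_space \<Rightarrow> real" where
  "wt \<alpha> x = 1 / (1 + norm x) powr (real DIM('a) + \<alpha>)"

text \<open>
  This bounds, up to a constant, each of the integrands in a scale parameter that occur below: the powers in front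
  come from superpositions of Gaussians, the cutoff at large parameters from cancellation.
\<close>

definition time_majorant :: "real \<Rightarrow> real \<Rightarrow> real" where
  "time_majorant \<beta> \<rho> = indicator {0<..} \<rho> * (\<rho> powr (\<beta> - 1) * min 1 (1 / \<rho>))"

text \<open>
  The number \<open>K\<close> with \<open>\<integral> (1 - cos(y \<bullet> \<xi>)) |y|^(-n-\<alpha>) dy = K |\<xi>|\<^sup>\<alpha>\<close>, in the form in which the superposition of
  Gaussians produces it.
\<close>

definition symbol_const :: "'a::euclidean_space itself \<Rightarrow> real \<Rightarrow> real" where
  "symbol_const TYPE('a) \<alpha> = pi powr (DIM('a) / 2) / Gamma ((real DIM('a) + \<alpha>) / 2) *
     (LBINT \<mu>. indicator {0<..} \<mu> * (\<mu> powr (\<alpha> / 2 - 1) * (1 - exp (- 1 / (4 * \<mu>)))))"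

lemma rker_measurable [measurable]: "rker \<alpha> \<in> borel_measurable borel"
  unfolding rker_def[abs_def] by measurable

lemma wt_measurable [measurable]: "wt \<alpha> \<in> borel_measurable borel"
  unfolding wt_def[abs_def] by measurable

lemma rker_nonneg [simp]: "0 \<le> rker \<alpha> y"
  by (simp add: rker_def)

lemma rker_minus [simp]: "rker \<alpha> (- y) = rker \<alpha> y"
  by (simp add: rker_def)

lemma time_majorant_integrable:
  assumes "0 < \<beta>" "\<beta> < 1"
  shows "integrable lborel (time_majorant \<beta>)"
proof -
  have a: "set_integrable lborel {0..1} (\<lambda>\<rho>::real. \<rho> powr (\<beta> - 1))"
  proof -
    have "(\<lambda>\<rho>::real. \<rho> powr (\<beta> - 1)) absolutely_integrable_on {0..1}"
      using has_integral_powr_from_0[of "\<beta> - 1" 1] assms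
      by (intro nonnegative_absolutely_integrable_1) (auto simp: integrable_on_def)
    then show ?thesis
      by (simp add: set_integrable_def integrable_completion)
  qed
  have b: "set_integrable lborel {1..} (\<lambda>\<rho>::real. \<rho> powr (\<beta> - 2))"
  proof -
    have "(\<lambda>\<rho>::real. \<rho> powr (\<beta> - 2)) absolutely_integrable_on {1..}"
      using has_integral_powr_to_inf[of "\<beta> - 2" 1] assms
      by (intro nonnegative_absolutely_integrable_1) (auto simp: integrable_on_def)
    then show ?thesis
      by (simp add: set_integrable_def integrable_completion)
  qed
  have "integrable lborel (\<lambda>\<rho>. indicator {0..1} \<rho> *\<^sub>R \<rho> powr (\<beta> - 1) + indicator {1..} \<rho> *\<^sub>R \<rho> powr (\<beta> - 2))"
    using a b unfolding set_integrable_def by (rule Bochner_Integration.integrable_add)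
  then show ?thesis
  proof (rule Bochner_Integration.integrable_bound)
    show "AE \<rho> in lborel. norm (time_majorant \<beta> \<rho>) \<le> norm (indicator {0..1} \<rho> *\<^sub>R \<rho> powr (\<beta> - 1) + indicator {1..} \<rho> *\<^sub>R \<rho> powr (\<beta> - 2))"
    proof (rule AE_I2)
      fix \<rho> :: real
      have "\<rho> powr (\<beta> - 1) * (1 / \<rho>) = \<rho> powr (\<beta> - 2)" if "\<rho> \<ge> 1"
      proof -
        have "\<rho> powr (\<beta> - 1) * \<rho> powr (-1) = \<rho> powr (\<beta> - 2)" by (subst powr_add[symmetric]) simp
        then show ?thesis using that by (simp add: powr_minus_divide)
      qed
      then show "norm (time_majorant \<beta> \<rho>) \<le> norm (indicator {0..1} \<rho> *\<^sub>R \<rho> powr (\<beta> - 1) + indicator {1..} \<rho> *\<^sub>R \<rho> powr (\<beta> - 2))"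
        by (cases "\<rho> \<le> 1"; cases "\<rho> > 0"; cases "\<rho> = 1") (auto simp: time_majorant_def indicator_def)
    qed
  qed (simp add: time_majorant_def[abs_def])
qed

lemma time_majorant_nonneg [simp]: "0 \<le> time_majorant \<beta> \<rho>"
  by (auto simp: time_majorant_def indicator_def)

lemma time_majorant_measurable [measurable]: "time_majorant \<beta> \<in> borel_measurable borel"
  unfolding time_majorant_def[abs_def] by measurable

text \<open>
  Substituting \<open>t = A l\<close> in the Gamma integral.
\<close>

lemma Gamma_subordination:
  assumes "q > 0" "A > 0"
  shows "(\<integral>\<^sup>+l. ennreal (indicator {0<..} l * (l powr (q - 1) * exp (- l * A))) \<partial>lborel) = ennreal (Gamma q * A powr (- q))"
proof -
  let ?g = "\<lambda>t::real. indicator {0<..} t * (t powr (q - 1) * exp (- t))"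
  have "(\<integral>\<^sup>+t. ennreal (indicator {0..} t * (t powr (q - 1) / exp t)) \<partial>lborel) = ennreal (Gamma q)"
    by (rule nn_integral_has_integral_lebesgue) (use Gamma_integral_real[OF assms(1)] in auto)
  also have "(\<integral>\<^sup>+t. ennreal (indicator {0..} t * (t powr (q - 1) / exp t)) \<partial>lborel) = (\<integral>\<^sup>+t. ennreal (?g t) \<partial>lborel)"
    by (intro nn_integral_cong) (auto simp: indicator_def exp_minus divide_inverse)
  also have "\<dots> = ennreal \<bar>A\<bar> * (\<integral>\<^sup>+t. ennreal (?g (0 + A * t)) \<partial>lborel)"
    using assms by (intro nn_integral_real_affine) auto
  also have "\<dots> = ennreal (A powr q) * (\<integral>\<^sup>+l. ennreal (indicator {0<..} l * (l powr (q - 1) * exp (- l * A))) \<partial>lborel)"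
  proof -
    have "ennreal \<bar>A\<bar> * ennreal (?g (0 + A * t)) = ennreal (A powr q) * ennreal (indicator {0<..} t * (t powr (q - 1) * exp (- t * A)))" for t
    proof (cases "t > 0")
      case True
      then have "A * (A * t) powr (q - 1) = A powr q * t powr (q - 1)"
        using assms by (simp add: powr_mult powr_mult_base mult.assoc[symmetric])
      then have h: "A * ((A * t) powr (q - 1) * E) = A powr q * (t powr (q - 1) * E)" for E
        by (metis mult.assoc)
      show ?thesis using h[of "exp (- (A * t))"] assms True
        by (simp add: ennreal_mult[symmetric] mult.commute[of t A])
    next
      case False
      then have "\<not> 0 < A * t" using assms by (simp add: zero_less_mult_iff)
      then show ?thesis using False by simp
    qed
    then show ?thesis by (subst (1 2) nn_integral_cmult[symmetric]) auto
  qed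
  finally have "ennreal (A powr q) * (\<integral>\<^sup>+l. ennreal (indicator {0<..} l * (l powr (q - 1) * exp (- l * A))) \<partial>lborel) = ennreal (Gamma q)" .
  then have a: "ennreal (A powr (-q)) * (ennreal (A powr q) * (\<integral>\<^sup>+l. ennreal (indicator {0<..} l * (l powr (q - 1) * exp (- l * A))) \<partial>lborel)) = ennreal (A powr (-q)) * ennreal (Gamma q)"
    by (rule arg_cong)
  have b: "ennreal (A powr (-q)) * ennreal (A powr q) = 1"
    using assms by (simp add: ennreal_mult[symmetric] powr_add[symmetric])
  have "(\<integral>\<^sup>+l. ennreal (indicator {0<..} l * (l powr (q - 1) * exp (- l * A))) \<partial>lborel) = ennreal (A powr (-q)) * ennreal (Gamma q)"
    using a unfolding mult.assoc[symmetric] b mult_1 .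
  also have "\<dots> = ennreal (Gamma q * A powr (- q))"
    using Gamma_real_pos[OF assms(1)] by (simp add: ennreal_mult[symmetric] mult.commute)
  finally show ?thesis .
qed

text \<open>
  Integrals against the kernel reduce to Gaussian integrals: insert the superposition of Gaussians for
  \<open>|y|^(-n-\<alpha>)\<close> and interchange the order of integration, which is allowed for nonnegative \<open>g\<close>.
\<close>

lemma nn_integral_rker:
  fixes g :: "'a::euclidean_space \<Rightarrow> real"
  assumes "0 < \<alpha>" and [measurable]: "g \<in> borel_measurable borel" and nonneg: "\<And>y. 0 \<le> g y"
    and I: "\<And>l. l > 0 \<Longrightarrow> (\<integral>\<^sup>+y. ennreal (g y * exp (- l * (norm y)\<^sup>2)) \<partial>lborel) = ennreal (I l)"
      "\<And>l. l > 0 \<Longrightarrow> 0 \<le> I l"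
  shows "ennreal (Gamma ((real DIM('a) + \<alpha>) / 2)) * (\<integral>\<^sup>+y. ennreal (g y * rker \<alpha> y) \<partial>lborel) =
    (\<integral>\<^sup>+l. ennreal (indicator {0<..} l * (l powr ((real DIM('a) + \<alpha>) / 2 - 1) * I l)) \<partial>lborel)"
proof -
  define p where "p = (real DIM('a) + \<alpha>) / 2"
  have p: "p > 0" using assms by (simp add: p_def add_nonneg_pos)
  let ?h = "\<lambda>l::real. indicator {0<..} l * (l powr (p - 1)) :: real"
  have "ennreal (Gamma p) * (\<integral>\<^sup>+y. ennreal (g y * rker \<alpha> y) \<partial>lborel) = (\<integral>\<^sup>+y. ennreal (g y) * ennreal (Gamma p * rker \<alpha> y) \<partial>lborel)"
    using p by (subst nn_integral_cmult[symmetric]) (auto simp: ennreal_mult[symmetric] nonneg Gamma_real_pos less_imp_le mult_ac intro!: nn_integral_cong)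
  also have "\<dots> = (\<integral>\<^sup>+y. (\<integral>\<^sup>+l. ennreal (?h l) * ennreal (g y * exp (- l * (norm y)\<^sup>2)) \<partial>lborel) \<partial>lborel)"
  proof (rule nn_integral_cong_AE)
    have "AE y in lborel. y \<noteq> (0::'a)" by (rule AE_lborel_singleton)
    then show "AE y in lborel. ennreal (g y) * ennreal (Gamma p * rker \<alpha> y) = (\<integral>\<^sup>+l. ennreal (?h l) * ennreal (g y * exp (- l * (norm y)\<^sup>2)) \<partial>lborel)"
    proof eventually_elim
      case (elim y)
      have "((norm y)\<^sup>2) powr (- p) = norm y powr (- (2 * p))"
        using elim by (simp add: powr_powr flip: powr_numeral)
      moreover have "2 * p = real DIM('a) + \<alpha>" by (simp add: p_def)
      ultimately have "Gamma p * rker \<alpha> y = Gamma p * ((norm y)\<^sup>2) powr (- p)"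
        by (metis rker_def powr_minus_divide)
      then have "ennreal (Gamma p * rker \<alpha> y) = (\<integral>\<^sup>+l. ennreal (indicator {0<..} l * (l powr (p - 1) * exp (- l * (norm y)\<^sup>2))) \<partial>lborel)"
        using elim by (subst Gamma_subordination[OF p]) auto
      then have "ennreal (g y) * ennreal (Gamma p * rker \<alpha> y) = (\<integral>\<^sup>+l. ennreal (g y) * ennreal (indicator {0<..} l * (l powr (p - 1) * exp (- l * (norm y)\<^sup>2))) \<partial>lborel)"
        by (simp add: nn_integral_cmult)
      then show ?case
        by (simp add: ennreal_mult[symmetric] nonneg mult_ac)
    qed
  qed
  also have "\<dots> = (\<integral>\<^sup>+l. (\<integral>\<^sup>+y. ennreal (?h l) * ennreal (g y * exp (- l * (norm y)\<^sup>2)) \<partial>lborel) \<partial>lborel)"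
    by (rule lborel_pair.Fubini'[symmetric]) measurable
  also have "\<dots> = (\<integral>\<^sup>+l. ennreal (indicator {0<..} l * (l powr (p - 1) * I l)) \<partial>lborel)"
  proof (rule nn_integral_cong)
    fix l :: real
    have "(\<integral>\<^sup>+y. ennreal (?h l) * ennreal (g y * exp (- l * (norm y)\<^sup>2)) \<partial>lborel) = ennreal (?h l) * (\<integral>\<^sup>+y. ennreal (g y * exp (- l * (norm y)\<^sup>2)) \<partial>lborel)"
      by (simp add: nn_integral_cmult)
    then show "(\<integral>\<^sup>+y. ennreal (?h l) * ennreal (g y * exp (- l * (norm y)\<^sup>2)) \<partial>lborel) = ennreal (indicator {0<..} l * (l powr (p - 1) * I l))"
      using I by (cases "l > 0") (auto simp: ennreal_mult[symmetric])
  qed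
  finally show ?thesis by (simp add: p_def)
qed

lemma gauss_cos_integral:
  fixes x :: "'a::euclidean_space"
  assumes "l > 0"
  shows "has_bochner_integral lborel (\<lambda>\<xi>::'a. exp (- l * (norm \<xi>)\<^sup>2) * cos (x \<bullet> \<xi>))
     ((pi / l) powr (DIM('a) / 2) * exp (- (norm x)\<^sup>2 / (4 * l)))"
  using has_bochner_integral_Re[OF gauss_cis_integral[OF assms, of x]] by simp

lemma gauss_integral:
  assumes "l > 0"
  shows "has_bochner_integral lborel (\<lambda>\<xi>::'a::euclidean_space. exp (- l * (norm \<xi>)\<^sup>2)) ((pi / l) powr (DIM('a) / 2))"
  using gauss_cos_integral[OF assms, of "0::'a"] by simp

lemma symbol_integrand_le:
  fixes \<mu> :: real
  assumes "\<mu> > 0" shows "1 - exp (- 1 / (4 * \<mu>)) \<le> min 1 (1 / \<mu>)"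
proof -
  have "1 + (- 1 / (4 * \<mu>)) \<le> exp (- 1 / (4 * \<mu>))" by (rule exp_ge_add_one_self)
  then have "1 - exp (- 1 / (4 * \<mu>)) \<le> 1 / (4 * \<mu>)" by simp
  also have "\<dots> \<le> 1 / \<mu>" using assms by (simp add: field_simps)
  finally show ?thesis by simp
qed

context fixes \<alpha> :: real assumes \<alpha>: "0 < \<alpha>" "\<alpha> < 2" begin

lemma symbol_integrable:
  "integrable lborel (\<lambda>\<mu>::real. indicator {0<..} \<mu> * (\<mu> powr (\<alpha> / 2 - 1) * (1 - exp (- 1 / (4 * \<mu>)))))"
proof (rule Bochner_Integration.integrable_bound[OF time_majorant_integrable[of "\<alpha> / 2"]])
  show "AE \<mu> in lborel. norm (indicator {0<..} \<mu> * (\<mu> powr (\<alpha> / 2 - 1) * (1 - exp (- 1 / (4 * \<mu>))))) \<le> norm (time_majorant (\<alpha>/2) \<mu>)"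
  proof (rule AE_I2)
    fix \<mu> :: real
    show "norm (indicator {0<..} \<mu> * (\<mu> powr (\<alpha> / 2 - 1) * (1 - exp (- 1 / (4 * \<mu>))))) \<le> norm (time_majorant (\<alpha>/2) \<mu>)"
      using symbol_integrand_le[of \<mu>]
      by (cases "\<mu> > 0") (auto simp: time_majorant_def abs_mult intro!: mult_left_mono)
  qed
qed (use \<alpha> in auto)

lemma symbol_const_pos: "symbol_const TYPE('a::euclidean_space) \<alpha> > 0"
proof -
  let ?f = "\<lambda>\<mu>::real. indicator {0<..} \<mu> * (\<mu> powr (\<alpha> / 2 - 1) * (1 - exp (- 1 / (4 * \<mu>)))) :: real"
  have nn: "0 \<le> ?f \<mu>" for \<mu> by (auto simp: indicator_def)
  have "integral\<^sup>L lborel ?f \<noteq> 0"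
  proof
    assume "integral\<^sup>L lborel ?f = 0"
    then have "AE \<mu> in lborel. ?f \<mu> = 0"
      using integral_nonneg_eq_0_iff_AE[OF symbol_integrable] nn by simp
    then have "AE \<mu> in lborel. \<mu> \<notin> {0..1::real}"
      using AE_lborel_singleton[of "0::real"] by eventually_elim (auto simp: indicator_def)
    then have "{0..1::real} \<in> null_sets lborel"
      by (subst AE_iff_null_sets) auto
    then have "emeasure lborel {0..1::real} = 0" by (rule null_setsD1)
    then show False by (subst (asm) emeasure_lborel_Icc) auto
  qed
  moreover have "integral\<^sup>L lborel ?f \<ge> 0" by (intro integral_nonneg_AE AE_I2 nn)
  ultimately have "integral\<^sup>L lborel ?f > 0" by linarith
  moreover have "Gamma ((real DIM('a) + \<alpha>) / 2) > 0" using \<alpha> by (intro Gamma_real_pos) (auto intro: add_nonneg_pos)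
  ultimately show ?thesis unfolding symbol_const_def by (intro mult_pos_pos divide_pos_pos) auto
qed

lemma powr_dimension_split:
  fixes l :: real
  assumes "l > 0"
  shows "l powr ((real n + \<alpha>) / 2 - 1) * (pi / l) powr (n / 2) = pi powr (n / 2) * l powr (\<alpha> / 2 - 1)"
proof -
  have "l powr ((real n + \<alpha>) / 2 - 1) = l powr (n / 2) * l powr (\<alpha> / 2 - 1)"
  proof -
    have e: "(real n + \<alpha>) / 2 - 1 = n / 2 + (\<alpha> / 2 - 1)" by (simp add: field_simps)
    show ?thesis unfolding e by (rule powr_add)
  qed
  then show ?thesis using assms by (simp add: powr_divide)
qed

text \<open>
  The Gaussian integral of \<open>1 - cos(y \<bullet> \<xi>)\<close> depends on \<open>|\<xi>|\<close> only, and substituting \<open>l = |\<xi>|\<^sup>2 \<mu>\<close> extracts the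
  power \<open>|\<xi>|\<^sup>\<alpha>\<close>.
\<close>

lemma rker_symbol_nn:
  fixes \<xi> :: "'a::euclidean_space"
  assumes "\<xi> \<noteq> 0"
  shows "(\<integral>\<^sup>+y. ennreal ((1 - cos (y \<bullet> \<xi>)) * rker \<alpha> y) \<partial>lborel) = ennreal (symbol_const TYPE('a) \<alpha> * norm \<xi> powr \<alpha>)"
proof -
  let ?n = "real DIM('a)"
  define I where "I l = (pi / l) powr (?n / 2) * (1 - exp (- (norm \<xi>)\<^sup>2 / (4 * l)))" for l
  have I: "(\<integral>\<^sup>+y. ennreal ((1 - cos (y \<bullet> \<xi>)) * exp (- l * (norm y)\<^sup>2)) \<partial>lborel) = ennreal (I l)" if "l > 0" for l
  proof -
    have "has_bochner_integral lborel (\<lambda>y. exp (- l * (norm y)\<^sup>2) - exp (- l * (norm y)\<^sup>2) * cos (\<xi> \<bullet> y)) ((pi / l) powr (?n / 2) - (pi / l) powr (?n / 2) * exp (- (norm \<xi>)\<^sup>2 / (4 * l)))"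
      by (intro has_bochner_integral_diff gauss_integral gauss_cos_integral that)
    then have "has_bochner_integral lborel (\<lambda>y. (1 - cos (y \<bullet> \<xi>)) * exp (- l * (norm y)\<^sup>2)) (I l)"
      by (simp add: I_def algebra_simps inner_commute)
    then show ?thesis
      by (auto simp: has_bochner_integral_iff nn_integral_eq_integral)
  qed
  have I0: "0 \<le> I l" if "l > 0" for l using that by (auto simp: I_def)
  define s where "s = (norm \<xi>)\<^sup>2"
  have s: "s > 0" using assms by (simp add: s_def)
  let ?f = "\<lambda>\<mu>::real. indicator {0<..} \<mu> * (\<mu> powr (\<alpha> / 2 - 1) * (1 - exp (- 1 / (4 * \<mu>)))) :: real"
  let ?F = "\<lambda>l::real. indicator {0<..} l * (l powr (\<alpha> / 2 - 1) * (1 - exp (- s / (4 * l)))) :: real"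
  have nn: "0 \<le> ?f \<mu>" for \<mu> by (auto simp: indicator_def)
  have sF: "s * ?F (s * \<mu>) = s powr (\<alpha> / 2) * ?f \<mu>" for \<mu>
  proof (cases "\<mu> > 0")
    case True
    then have "s * (s * \<mu>) powr (\<alpha> / 2 - 1) = s powr (\<alpha> / 2) * \<mu> powr (\<alpha> / 2 - 1)"
      using s by (simp add: powr_mult powr_mult_base mult.assoc[symmetric])
    then show ?thesis using s True by (simp flip: mult.assoc)
  next
    case False
    then have "\<not> 0 < s * \<mu>" using s by (simp add: zero_less_mult_iff)
    then show ?thesis using False by simp
  qed
  have "(\<integral>\<^sup>+l. ennreal (?F l) \<partial>lborel) = ennreal \<bar>s\<bar> * (\<integral>\<^sup>+\<mu>. ennreal (?F (0 + s * \<mu>)) \<partial>lborel)"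
    using s by (intro nn_integral_real_affine) auto
  also have "\<dots> = (\<integral>\<^sup>+\<mu>. ennreal (s * ?F (s * \<mu>)) \<partial>lborel)"
    using s by (subst nn_integral_cmult[symmetric]) (auto simp: ennreal_mult'[symmetric])
  also have "\<dots> = (\<integral>\<^sup>+\<mu>. ennreal (s powr (\<alpha> / 2)) * ennreal (?f \<mu>) \<partial>lborel)"
    unfolding sF using nn by (simp add: ennreal_mult)
  also have "\<dots> = ennreal (s powr (\<alpha> / 2)) * ennreal (integral\<^sup>L lborel ?f)"
  proof -
    have Ff: "(\<integral>\<^sup>+\<mu>. ennreal (?f \<mu>) \<partial>lborel) = ennreal (integral\<^sup>L lborel ?f)"
      by (rule nn_integral_eq_integral[OF symbol_integrable]) (use nn in auto)
    show ?thesis unfolding Ff[symmetric] by (rule nn_integral_cmult) auto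
  qed
  finally have F: "(\<integral>\<^sup>+l. ennreal (?F l) \<partial>lborel) = ennreal (s powr (\<alpha> / 2) * integral\<^sup>L lborel ?f)"
    by (simp add: ennreal_mult')
  have "(\<integral>\<^sup>+l. ennreal (indicator {0<..} l * (l powr ((?n + \<alpha>) / 2 - 1) * I l)) \<partial>lborel)
     = (\<integral>\<^sup>+l. ennreal (pi powr (?n / 2)) * ennreal (?F l) \<partial>lborel)"
  proof (rule nn_integral_cong)
    fix l :: real
    show "ennreal (indicator {0<..} l * (l powr ((?n + \<alpha>) / 2 - 1) * I l)) = ennreal (pi powr (?n / 2)) * ennreal (?F l)"
      using powr_dimension_split[of l "DIM('a)"]
      by (cases "l > 0") (auto simp: I_def s_def ennreal_mult'[symmetric] simp flip: mult.assoc)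
  qed
  also have "\<dots> = ennreal (pi powr (?n / 2)) * ennreal (s powr (\<alpha> / 2) * integral\<^sup>L lborel ?f)"
    unfolding F[symmetric] by (rule nn_integral_cmult) auto
  finally have e: "ennreal (Gamma ((?n + \<alpha>) / 2)) * (\<integral>\<^sup>+y. ennreal ((1 - cos (y \<bullet> \<xi>)) * rker \<alpha> y) \<partial>lborel) =
     ennreal (pi powr (?n / 2) * (s powr (\<alpha> / 2) * integral\<^sup>L lborel ?f))"
    using nn_integral_rker[OF \<alpha>(1), of "\<lambda>y. 1 - cos (y \<bullet> \<xi>)" I, OF _ _ I I0] by (simp add: ennreal_mult')
  have G: "Gamma ((?n + \<alpha>) / 2) > 0" using \<alpha> by (intro Gamma_real_pos) (auto intro: add_nonneg_pos)
  have "s powr (\<alpha> / 2) = norm \<xi> powr \<alpha>" using assms by (simp add: s_def powr_powr flip: powr_numeral)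
  then have "ennreal (Gamma ((?n + \<alpha>) / 2)) * ennreal (symbol_const TYPE('a) \<alpha> * norm \<xi> powr \<alpha>) = ennreal (pi powr (?n / 2) * (s powr (\<alpha> / 2) * integral\<^sup>L lborel ?f))"
    using G by (simp add: symbol_const_def ennreal_mult'[symmetric] field_simps)
  with e have "ennreal (Gamma ((?n + \<alpha>) / 2)) * (\<integral>\<^sup>+y. ennreal ((1 - cos (y \<bullet> \<xi>)) * rker \<alpha> y) \<partial>lborel) =
     ennreal (Gamma ((?n + \<alpha>) / 2)) * ennreal (symbol_const TYPE('a) \<alpha> * norm \<xi> powr \<alpha>)" by (simp only:)
  moreover have "ennreal (Gamma ((?n + \<alpha>) / 2)) \<noteq> 0" "ennreal (Gamma ((?n + \<alpha>) / 2)) \<noteq> top"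
    using G by auto
  ultimately show ?thesis by (simp only: ennreal_mult_cancel_left) blast
qed

lemma rker_symbol:
  fixes \<xi> :: "'a::euclidean_space"
  shows "has_bochner_integral lborel (\<lambda>y. (1 - cos (y \<bullet> \<xi>)) * rker \<alpha> y) (symbol_const TYPE('a) \<alpha> * norm \<xi> powr \<alpha>)"
proof (cases "\<xi> = 0")
  case True
  then show ?thesis using \<alpha> by (simp add: has_bochner_integral_zero)
next
  case False
  show ?thesis
    by (rule has_bochner_integral_nn_integral[OF _ _ _ rker_symbol_nn[OF False]])
      (use symbol_const_pos[where 'a='a] in \<open>auto simp: less_imp_le\<close>)
qed

text \<open>
  The function \<open>min 1 |y|\<^sup>2\<close> is comparable to \<open>1 - exp(-|y|\<^sup>2)\<close>, whose Gaussian integrals are explicit.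
\<close>

lemma rker_min_integrable: "integrable lborel (\<lambda>y::'a::euclidean_space. min 1 ((norm y)\<^sup>2) * rker \<alpha> y)"
proof -
  let ?n = "real DIM('a)"
  define I where "I l = (pi / l) powr (?n / 2) - (pi / (l + 1)) powr (?n / 2)" for l
  have I: "(\<integral>\<^sup>+y. ennreal ((1 - exp (- (norm (y::'a))\<^sup>2)) * exp (- l * (norm y)\<^sup>2)) \<partial>lborel) = ennreal (I l)" if "l > 0" for l
  proof -
    have "has_bochner_integral lborel (\<lambda>y::'a. exp (- l * (norm y)\<^sup>2) - exp (- (l + 1) * (norm y)\<^sup>2)) (I l)"
      unfolding I_def using that by (intro has_bochner_integral_diff gauss_integral) auto
    moreover have "(1 - exp (- (norm y)\<^sup>2)) * exp (- l * (norm y)\<^sup>2) = exp (- l * (norm y)\<^sup>2) - exp (- (l + 1) * (norm y)\<^sup>2)" for y :: 'a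
      by (simp add: algebra_simps flip: exp_add)
    ultimately have "has_bochner_integral lborel (\<lambda>y::'a. (1 - exp (- (norm y)\<^sup>2)) * exp (- l * (norm y)\<^sup>2)) (I l)"
      by simp
    then show ?thesis
      by (auto simp: has_bochner_integral_iff nn_integral_eq_integral)
  qed
  have I0: "0 \<le> I l" if "l > 0" for l
    using that by (auto simp: I_def intro!: powr_mono2 divide_left_mono)
  have Ile: "l powr ((?n + \<alpha>) / 2 - 1) * I l \<le> pi powr (?n / 2) * ?n * (l powr (\<alpha> / 2 - 1) * min 1 (1 / l))" if "l > 0" for l
  proof -
    have "(pi / (l + 1)) powr (?n / 2) = (pi / l) powr (?n / 2) * (l / (l + 1)) powr (?n / 2)"
      using that by (simp add: powr_mult[symmetric])
    then have Il: "I l = (pi / l) powr (?n / 2) * (1 - (l / (l + 1)) powr (?n / 2))"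
      by (simp add: I_def algebra_simps)
    \<comment> \<open>The cancellation between the two Gaussian integrals is \<open>O(1 / l)\<close>, by Bernoulli's inequality.\<close>
    have "1 + ?n * (- 1 / (l + 1)) \<le> (1 + (- 1 / (l + 1))) ^ DIM('a)"
      using that by (intro Bernoulli_inequality) (simp add: field_simps)
    also have "1 + (- 1 / (l + 1)) = l / (l + 1)" using that by (simp add: field_simps)
    also have "(l / (l + 1)) ^ DIM('a) = (l / (l + 1)) powr ?n" using that by (simp add: powr_realpow)
    also have "\<dots> \<le> (l / (l + 1)) powr (?n / 2)" using that by (intro powr_mono') (auto simp: field_simps)
    finally have "1 - (l / (l + 1)) powr (?n / 2) \<le> ?n * (1 / (l + 1))" by simp
    also have "\<dots> \<le> ?n * (min 1 (1 / l))" using that by (intro mult_left_mono) (auto simp: field_simps min_def)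
    finally have "(l powr ((?n + \<alpha>) / 2 - 1) * (pi / l) powr (?n / 2)) * (1 - (l / (l + 1)) powr (?n / 2)) \<le> (l powr ((?n + \<alpha>) / 2 - 1) * (pi / l) powr (?n / 2)) * (?n * min 1 (1 / l))"
      by (intro mult_left_mono) auto
    then show ?thesis unfolding Il mult.assoc[symmetric] powr_dimension_split[OF that] by (simp add: mult_ac)
  qed
  have "(\<integral>\<^sup>+l. ennreal (indicator {0<..} l * (l powr ((?n + \<alpha>) / 2 - 1) * I l)) \<partial>lborel) \<le> (\<integral>\<^sup>+l. ennreal (pi powr (?n / 2) * ?n * time_majorant (\<alpha> / 2) l) \<partial>lborel)"
    using Ile by (intro nn_integral_mono ennreal_leI) (auto simp: time_majorant_def indicator_def)
  also have "\<dots> < \<infinity>"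
    using time_majorant_integrable[of "\<alpha> / 2"] \<alpha>
    by (subst nn_integral_eq_integral) auto
  finally have fin: "ennreal (Gamma ((?n + \<alpha>) / 2)) * (\<integral>\<^sup>+y. ennreal ((1 - exp (- (norm (y::'a))\<^sup>2)) * rker \<alpha> y) \<partial>lborel) < \<infinity>"
    using nn_integral_rker[OF \<alpha>(1), of "\<lambda>y::'a. 1 - exp (- (norm y)\<^sup>2)" I, OF _ _ I I0] by simp
  have G: "Gamma ((?n + \<alpha>) / 2) > 0" using \<alpha> by (intro Gamma_real_pos) (auto intro: add_nonneg_pos)
  have int: "integrable lborel (\<lambda>y::'a. 2 * ((1 - exp (- (norm y)\<^sup>2)) * rker \<alpha> y))"
    using fin G by (intro integrable_mult_right integrableI_bounded) (auto simp: ennreal_mult_less_top)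
  have le: "min 1 a \<le> 2 * (1 - exp (- a))" if "a \<ge> 0" for a :: real
  proof -
    have "1 + a \<le> exp a" by (rule exp_ge_add_one_self)
    then have "exp (- a) \<le> 1 / (1 + a)" using that by (simp add: exp_minus field_simps)
    then have "2 * (1 - exp (- a)) \<ge> 2 * (1 - 1 / (1 + a))" by simp
    also have "2 * (1 - 1 / (1 + a)) \<ge> min 1 a" using that by (cases "a \<le> 1") (auto simp: field_simps mult_left_le)
    finally show ?thesis .
  qed
  show ?thesis
  proof (rule Bochner_Integration.integrable_bound[OF int])
    show "AE y::'a in lborel. norm (min 1 ((norm y)\<^sup>2) * rker \<alpha> y) \<le> norm (2 * ((1 - exp (- (norm y)\<^sup>2)) * rker \<alpha> y))"
    proof (rule AE_I2)
      fix y :: 'a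
      have "min 1 ((norm y)\<^sup>2) * rker \<alpha> y \<le> 2 * (1 - exp (- (norm y)\<^sup>2)) * rker \<alpha> y"
        by (intro mult_right_mono le) auto
      moreover have "0 \<le> min 1 ((norm y)\<^sup>2) * rker \<alpha> y" by simp
      ultimately have "\<bar>min 1 ((norm y)\<^sup>2) * rker \<alpha> y\<bar> \<le> 2 * ((1 - exp (- (norm y)\<^sup>2)) * rker \<alpha> y)"
        by (simp only: mult.assoc abs_of_nonneg)
      then show "norm (min 1 ((norm y)\<^sup>2) * rker \<alpha> y) \<le> norm (2 * ((1 - exp (- (norm y)\<^sup>2)) * rker \<alpha> y))"
        unfolding real_norm_def by (rule order_trans[OF _ abs_ge_self])
    qed
  qed auto
qed
end

section \<open>Tame functions and the symmetric form of the operator\<close>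

text \<open>
  A quantitative \<open>C\<^sup>2\<close> bound with weight \<open>w\<close>, stated through the Taylor remainder because this is the form in which second
  differences use it and in which products and dilations are easy. The weight \<open>1\<close> is used for cutoffs, the weight \<open>wt \<alpha>\<close> for
  the functions to which the operator is applied.
\<close>

definition tame :: "('a::euclidean_space \<Rightarrow> real) \<Rightarrow> real \<Rightarrow> ('a \<Rightarrow> real) \<Rightarrow> bool" where
  "tame w M f \<longleftrightarrow> (\<exists>D. \<forall>x. \<bar>f x\<bar> \<le> M * w x \<and> norm (D x) \<le> M * w x \<and>
     (\<forall>y. norm y \<le> 1 \<longrightarrow> \<bar>f (x + y) - f x - D x \<bullet> y\<bar> \<le> M * (norm y)\<^sup>2 * w x))"

abbreviation sdiff :: "('a::real_vector \<Rightarrow> real) \<Rightarrow> 'a \<Rightarrow> 'a \<Rightarrow> real" where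
  "sdiff f x y \<equiv> 2 * f x - f (x + y) - f (x - y)"

text \<open>
  The singular integral after averaging over \<open>y\<close> and \<open>-y\<close>. The second difference is \<open>O(|y|\<^sup>2)\<close>, so the integral
  converges absolutely and no principal value is left.
\<close>

definition Lam :: "real \<Rightarrow> ('a::euclidean_space \<Rightarrow> real) \<Rightarrow> 'a \<Rightarrow> real" where
  "Lam \<alpha> f x = (LBINT y. sdiff f x y * rker \<alpha> y) / 2"

text \<open>
  The constant in the estimate \<open>Lam_le\<close>.
\<close>

definition Lam_bound :: "'a::euclidean_space itself \<Rightarrow> real \<Rightarrow> real" where
  "Lam_bound TYPE('a) \<alpha> =
     (1 + 2 powr (real DIM('a) + \<alpha>)) * (LBINT y::'a. min 1 ((norm y)\<^sup>2) * rker \<alpha> y)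
     + 2 powr (real DIM('a) + \<alpha>) * (LBINT y::'a. wt \<alpha> y)"

lemma tame_bound: "tame w M f \<Longrightarrow> \<bar>f x\<bar> \<le> M * w x"
  by (auto simp: tame_def)

lemma tame_nonneg: "tame w M f \<Longrightarrow> 0 \<le> M * w x"
  using tame_bound[of w M f x] by linarith

lemma tame_first_difference:
  assumes "tame w M f" "norm y \<le> 1"
  shows "\<bar>f (x + y) - f x\<bar> \<le> 2 * (M * w x) * norm y"
proof -
  obtain D where D: "norm (D x) \<le> M * w x" "\<bar>f (x + y) - f x - D x \<bullet> y\<bar> \<le> M * (norm y)\<^sup>2 * w x"
    using assms by (auto simp: tame_def)
  have "M * w x * (norm y)\<^sup>2 \<le> M * w x * norm y"
    using tame_nonneg[OF assms(1)] assms(2) by (intro mult_left_mono) (auto simp: power2_eq_square mult_left_le)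
  moreover have "\<bar>D x \<bullet> y\<bar> \<le> M * w x * norm y"
    using Cauchy_Schwarz_ineq2[of "D x" y] D(1) by (meson mult_right_mono norm_ge_zero order_trans)
  ultimately show ?thesis using D(2) by (simp add: mult_ac)
qed

lemma tame_second_difference:
  assumes "tame w M f" "norm y \<le> 1"
  shows "\<bar>sdiff f x y\<bar> \<le> 2 * (M * w x) * (norm y)\<^sup>2"
proof -
  obtain D where D: "\<And>y. norm y \<le> 1 \<Longrightarrow> \<bar>f (x + y) - f x - D x \<bullet> y\<bar> \<le> M * (norm y)\<^sup>2 * w x"
    using assms by (auto simp: tame_def)
  have "f (x + y) + f (x - y) - 2 * f x = (f (x + y) - f x - D x \<bullet> y) + (f (x + - y) - f x - D x \<bullet> (- y))"
    by (simp add: inner_minus_right)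
  then show ?thesis using D[of y] D[of "- y"] assms(2) by (simp add: mult_ac)
qed

lemma tame_continuous:
  assumes "tame w M f"
  shows "continuous_on UNIV f"
proof (rule continuous_at_imp_continuous_on, rule ballI)
  fix x
  have "((\<lambda>y. f (x + y) - f x) \<longlongrightarrow> 0) (at 0)"
  proof (rule Lim_null_comparison)
    show "\<forall>\<^sub>F y in at 0. norm (f (x + y) - f x) \<le> 2 * (M * w x) * norm y"
      unfolding eventually_at by (rule exI[of _ 1]) (auto intro: tame_first_difference[OF assms])
    show "((\<lambda>y. 2 * (M * w x) * norm y) \<longlongrightarrow> 0) (at (0::'a))"
      by (intro tendsto_eq_intros) auto
  qed
  then have "((\<lambda>y. f (x + y)) \<longlongrightarrow> f x) (at 0)" using LIM_zero_iff by blast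
  then show "isCont f x" by (simp add: isCont_iff)
qed

lemma tame_measurable: "tame w M f \<Longrightarrow> f \<in> borel_measurable borel"
  by (intro borel_measurable_continuous_onI tame_continuous)

lemma tame_mono:
  assumes "tame w M f" "\<And>x. M * w x \<le> M' * w' x"
  shows "tame w' M' f"
proof -
  obtain D where D: "\<And>x. \<bar>f x\<bar> \<le> M * w x" "\<And>x. norm (D x) \<le> M * w x"
     "\<And>x y. norm y \<le> 1 \<Longrightarrow> \<bar>f (x + y) - f x - D x \<bullet> y\<bar> \<le> M * (norm y)\<^sup>2 * w x"
    using assms(1) unfolding tame_def by blast
  have "\<bar>f (x + y) - f x - D x \<bullet> y\<bar> \<le> M' * (norm y)\<^sup>2 * w' x" if "norm y \<le> 1" for x y
  proof -
    have "(M * w x) * (norm y)\<^sup>2 \<le> (M' * w' x) * (norm y)\<^sup>2" using assms(2) by (intro mult_right_mono) auto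
    then show ?thesis using D(3)[OF that, of x] by (simp add: mult_ac)
  qed
  then show ?thesis unfolding tame_def using D assms(2) order_trans by blast
qed

text \<open>
  With \<open>R\<^sub>f\<close>, \<open>R\<^sub>g\<close> for the Taylor remainders, the remainder of \<open>g f\<close> is \<open>g R\<^sub>f + f R\<^sub>g\<close> plus the product of the two first
  differences; these three terms give the constants \<open>1 + 1 + 4\<close>.
\<close>

lemma tame_mult:
  assumes "tame (\<lambda>_. 1) A g" "tame w B f"
  shows "tame w (6 * A * B) (\<lambda>x. g x * f x)"
proof -
  obtain Dg where Dg: "\<And>x. norm (Dg x) \<le> A" "\<And>x y. norm y \<le> 1 \<Longrightarrow> \<bar>g (x + y) - g x - Dg x \<bullet> y\<bar> \<le> A * (norm y)\<^sup>2"
    using assms(1) unfolding tame_def by auto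
  obtain Df where Df: "\<And>x. norm (Df x) \<le> B * w x" "\<And>x y. norm y \<le> 1 \<Longrightarrow> \<bar>f (x + y) - f x - Df x \<bullet> y\<bar> \<le> B * (norm y)\<^sup>2 * w x"
    using assms(2) unfolding tame_def by auto
  have g: "\<bar>g x\<bar> \<le> A" for x using tame_bound[OF assms(1)] by simp
  have A: "A \<ge> 0" using g[of undefined] by linarith
  note f = tame_bound[OF assms(2)]
  note Bw = tame_nonneg[OF assms(2)]
  show ?thesis unfolding tame_def
  proof (intro exI[of _ "\<lambda>x. g x *\<^sub>R Df x + f x *\<^sub>R Dg x"] allI conjI impI)
    fix x y :: 'a
    have "\<bar>g x * f x\<bar> \<le> A * (B * w x)" unfolding abs_mult using g f A by (intro mult_mono) auto
    moreover have AB: "0 \<le> A * (B * w x)" using A Bw by simp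
    ultimately show "\<bar>g x * f x\<bar> \<le> 6 * A * B * w x" by (simp add: mult_ac)
    have "norm (g x *\<^sub>R Df x) \<le> A * (B * w x)" using g Df(1) A by (auto intro!: mult_mono)
    moreover have "norm (f x *\<^sub>R Dg x) \<le> (B * w x) * A" using f Dg(1) Bw by (auto intro!: mult_mono)
    moreover have "norm (g x *\<^sub>R Df x + f x *\<^sub>R Dg x) \<le> norm (g x *\<^sub>R Df x) + norm (f x *\<^sub>R Dg x)" by (rule norm_triangle_ineq)
    ultimately show "norm (g x *\<^sub>R Df x + f x *\<^sub>R Dg x) \<le> 6 * A * B * w x" using AB by (simp only: mult_ac)
    assume y: "norm y \<le> 1"
    let ?Q = "A * (B * w x) * (norm y)\<^sup>2"
    have Q: "0 \<le> ?Q" using AB by simp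
    have 1: "\<bar>g x * (f (x + y) - f x - Df x \<bullet> y)\<bar> \<le> A * (B * (norm y)\<^sup>2 * w x)"
      unfolding abs_mult using g Df(2)[OF y] A by (intro mult_mono) auto
    have 2: "\<bar>f x * (g (x + y) - g x - Dg x \<bullet> y)\<bar> \<le> (B * w x) * (A * (norm y)\<^sup>2)"
      unfolding abs_mult using f Dg(2)[OF y] Bw by (intro mult_mono) auto
    have 3: "\<bar>(g (x + y) - g x) * (f (x + y) - f x)\<bar> \<le> (2 * (A * 1) * norm y) * (2 * (B * w x) * norm y)"
      unfolding abs_mult using tame_first_difference[OF assms(1) y, of x] tame_first_difference[OF assms(2) y, of x] A
      by (intro mult_mono) auto
    have "g (x + y) * f (x + y) - g x * f x - (g x *\<^sub>R Df x + f x *\<^sub>R Dg x) \<bullet> y =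
       g x * (f (x + y) - f x - Df x \<bullet> y) + f x * (g (x + y) - g x - Dg x \<bullet> y) + (g (x + y) - g x) * (f (x + y) - f x)"
      by (simp add: algebra_simps inner_add_left)
    then have "\<bar>g (x + y) * f (x + y) - g x * f x - (g x *\<^sub>R Df x + f x *\<^sub>R Dg x) \<bullet> y\<bar> \<le>
      A * (B * (norm y)\<^sup>2 * w x) + (B * w x) * (A * (norm y)\<^sup>2) + (2 * (A * 1) * norm y) * (2 * (B * w x) * norm y)"
      using 1 2 3 by linarith
    also have "\<dots> = 6 * A * B * (norm y)\<^sup>2 * w x" by (simp add: power2_eq_square algebra_simps)
    finally show "\<bar>g (x + y) * f (x + y) - g x * f x - (g x *\<^sub>R Df x + f x *\<^sub>R Dg x) \<bullet> y\<bar> \<le> 6 * A * B * (norm y)\<^sup>2 * w x" .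
  qed
qed

text \<open>
  The constant does not grow with \<open>R\<close>, which is what makes truncation by dilated cutoffs uniform.
\<close>

lemma tame_dilate:
  assumes "tame (\<lambda>_. 1) A g" "R \<ge> 1"
  shows "tame (\<lambda>_. 1) A (\<lambda>x. g (x /\<^sub>R R))"
proof -
  obtain D where D: "\<And>x. norm (D x) \<le> A" "\<And>x y. norm y \<le> 1 \<Longrightarrow> \<bar>g (x + y) - g x - D x \<bullet> y\<bar> \<le> A * (norm y)\<^sup>2"
    using assms(1) unfolding tame_def by auto
  have g: "\<bar>g x\<bar> \<le> A" for x using tame_bound[OF assms(1)] by simp
  have A: "A \<ge> 0" using g[of undefined] by linarith
  have R: "inverse R \<le> 1" "inverse R > 0" using assms(2) by (auto simp: field_simps)
  show ?thesis unfolding tame_def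
  proof (intro exI[of _ "\<lambda>x. D (x /\<^sub>R R) /\<^sub>R R"] allI conjI impI)
    fix x y :: 'a
    show "\<bar>g (x /\<^sub>R R)\<bar> \<le> A * 1" using g by simp
    have "inverse R * norm (D (x /\<^sub>R R)) \<le> 1 * A" using R D(1) by (intro mult_mono) auto
    then show "norm (D (x /\<^sub>R R) /\<^sub>R R) \<le> A * 1" using R by simp
    assume y: "norm y \<le> 1"
    have ny: "norm (y /\<^sub>R R) \<le> norm y" using R by (simp add: mult_left_le_one_le)
    have "\<bar>g (x /\<^sub>R R + y /\<^sub>R R) - g (x /\<^sub>R R) - D (x /\<^sub>R R) \<bullet> (y /\<^sub>R R)\<bar> \<le> A * (norm (y /\<^sub>R R))\<^sup>2"
      using ny y by (intro D(2)) linarith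
    also have "\<dots> \<le> A * (norm y)\<^sup>2" using ny A by (intro mult_left_mono power_mono) auto
    finally show "\<bar>g ((x + y) /\<^sub>R R) - g (x /\<^sub>R R) - (D (x /\<^sub>R R) /\<^sub>R R) \<bullet> y\<bar> \<le> A * (norm y)\<^sup>2 * 1"
      by (simp add: scaleR_right_distrib)
  qed
qed

lemma lborel_integral_translate:
  fixes f :: "'a::euclidean_space \<Rightarrow> 'b::{banach, second_countable_topology}"
  shows "(LBINT x. f (a + x)) = (LBINT x. f x)"
    and "integrable lborel (\<lambda>x. f (a + x)) \<longleftrightarrow> integrable lborel f"
proof -
  have h: "integrable lborel (\<lambda>x. g (b + x))" if "integrable lborel g" for g :: "'a \<Rightarrow> 'b" and b
  proof -
    have "integrable (distr lborel borel ((+) b)) g" using that by (simp add: lborel_distr_plus)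
    then show ?thesis by (rule integrable_distr[rotated]) simp
  qed
  show i: "integrable lborel (\<lambda>x. f (a + x)) \<longleftrightarrow> integrable lborel f"
    using h[of f a] h[of "\<lambda>x. f (a + x)" "- a"] by auto
  show "(LBINT x. f (a + x)) = (LBINT x. f x)"
  proof (cases "integrable lborel f")
    case True
    have "(LBINT x. f x) = integral\<^sup>L (distr lborel borel ((+) a)) f" by (simp add: lborel_distr_plus)
    also have "\<dots> = (LBINT x. f (a + x))" using borel_measurable_integrable[OF True] by (intro integral_distr) auto
    finally show ?thesis ..
  qed (use i in \<open>auto simp: not_integrable_integral_eq\<close>)
qed

lemma lborel_integral_scale:
  fixes f :: "'a::euclidean_space \<Rightarrow> 'b::{banach, second_countable_topology}"
  assumes "c \<noteq> 0"
  shows "(LBINT x. f x) = \<bar>c\<bar> ^ DIM('a) *\<^sub>R (LBINT x. f (c *\<^sub>R x))"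
    and "integrable lborel (\<lambda>x. f (c *\<^sub>R x)) \<longleftrightarrow> integrable lborel f"
proof -
  have L: "lborel = density (distr lborel borel (\<lambda>x::'a. b *\<^sub>R x)) (\<lambda>_. ennreal (\<bar>b\<bar> ^ DIM('a)))" if "b \<noteq> 0" for b
    using lborel_affine[OF that, of "0::'a"] by simp
  have h: "integrable lborel (\<lambda>x. g (b *\<^sub>R x))" if "integrable lborel g" "b \<noteq> 0" for g :: "'a \<Rightarrow> 'b" and b
  proof -
    have gm: "g \<in> borel_measurable borel" using borel_measurable_integrable[OF that(1)] by simp
    have "integrable (density (distr lborel borel (\<lambda>x::'a. b *\<^sub>R x)) (\<lambda>_. ennreal (\<bar>b\<bar> ^ DIM('a)))) g"
      using that(1) L[OF that(2)] by simp
    then have "integrable (distr lborel borel (\<lambda>x::'a. b *\<^sub>R x)) (\<lambda>x. (\<bar>b\<bar> ^ DIM('a)) *\<^sub>R g x)"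
      using gm by (subst (asm) integrable_density) auto
    then have "integrable lborel (\<lambda>x. (\<bar>b\<bar> ^ DIM('a)) *\<^sub>R g (b *\<^sub>R x))"
      by (rule integrable_distr[rotated]) simp
    then have "integrable lborel (\<lambda>x. inverse (\<bar>b\<bar> ^ DIM('a)) *\<^sub>R ((\<bar>b\<bar> ^ DIM('a)) *\<^sub>R g (b *\<^sub>R x)))"
      by (rule integrable_scaleR_right)
    then show ?thesis using that(2) by simp
  qed
  show i: "integrable lborel (\<lambda>x. f (c *\<^sub>R x)) \<longleftrightarrow> integrable lborel f"
    using h[of f c] h[of "\<lambda>x. f (c *\<^sub>R x)" "inverse c"] assms by auto
  show "(LBINT x. f x) = \<bar>c\<bar> ^ DIM('a) *\<^sub>R (LBINT x. f (c *\<^sub>R x))"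
  proof (cases "integrable lborel f")
    case True
    have gm[measurable]: "f \<in> borel_measurable borel" using borel_measurable_integrable[OF True] by simp
    have "(LBINT x. f x) = integral\<^sup>L (distr lborel borel (\<lambda>x::'a. c *\<^sub>R x)) (\<lambda>x. (\<bar>c\<bar> ^ DIM('a)) *\<^sub>R f x)"
      by (subst L[OF assms], subst integral_density) auto
    also have "\<dots> = (LBINT x. (\<bar>c\<bar> ^ DIM('a)) *\<^sub>R f (c *\<^sub>R x))" by (rule integral_distr) auto
    finally show ?thesis by simp
  qed (use i in \<open>auto simp: not_integrable_integral_eq\<close>)
qed

lemma lborel_integral_reflect:
  fixes f :: "'a::euclidean_space \<Rightarrow> 'b::{banach, second_countable_topology}"
  shows "(LBINT x. f (a - x)) = (LBINT x. f x)"
    and "integrable lborel (\<lambda>x. f (a - x)) \<longleftrightarrow> integrable lborel f"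
  using lborel_integral_scale[of "-1" "\<lambda>x. f (a + x)"] lborel_integral_translate[of f a] by auto

context fixes \<alpha> :: real assumes \<alpha>: "0 < \<alpha>" "\<alpha> < 2" begin

lemma wt_nonneg [simp]: "0 \<le> wt \<alpha> x"
  by (simp add: wt_def)

lemma wt_pos: "0 < wt \<alpha> x"
proof -
  have "1 + norm x \<noteq> 0" using norm_ge_zero[of x] by linarith
  then show ?thesis by (simp add: wt_def)
qed

lemma wt_le_1: "wt \<alpha> x \<le> 1"
proof -
  have "1 \<le> (1 + norm x) powr (real DIM('a) + \<alpha>)" using \<alpha> by (intro ge_one_powr_ge_zero) auto
  then show ?thesis unfolding wt_def by (subst pos_divide_le_eq) linarith+
qed

text \<open>
  Weights are compared by comparing the bases of the powers.
\<close>

lemma wt_compare: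
  assumes "c > 0" "1 + norm x \<le> c * (1 + norm z)"
  shows "wt \<alpha> (z::'a::euclidean_space) \<le> c powr (real DIM('a) + \<alpha>) * wt \<alpha> (x::'a)"
proof -
  have "(1 + norm x) powr (real DIM('a) + \<alpha>) \<le> (c * (1 + norm z)) powr (real DIM('a) + \<alpha>)"
    using assms \<alpha> by (intro powr_mono2) auto
  also have "\<dots> = c powr (real DIM('a) + \<alpha>) * (1 + norm z) powr (real DIM('a) + \<alpha>)"
    using assms by (intro powr_mult) 
  finally have h: "(1 + norm x) powr (real DIM('a) + \<alpha>) \<le> c powr (real DIM('a) + \<alpha>) * (1 + norm z) powr (real DIM('a) + \<alpha>)" .
  have "0 < 1 + norm x" "0 < 1 + norm z" using norm_ge_zero[of x] norm_ge_zero[of z] by linarith+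
  then have "0 < (1 + norm x) powr (real DIM('a) + \<alpha>)" "0 < (1 + norm z) powr (real DIM('a) + \<alpha>)" by auto
  then show ?thesis using h by (simp add: wt_def field_simps)
qed

lemma wt_translate: "wt \<alpha> (x - a) \<le> (1 + norm a) powr (real DIM('a) + \<alpha>) * wt \<alpha> (x::'a::euclidean_space)"
proof (rule wt_compare)
  have "norm x \<le> norm (x - a) + norm a" by (metis diff_add_cancel norm_triangle_ineq)
  moreover have "0 \<le> norm a * norm (x - a)" by simp
  moreover have "(1 + norm a) * (1 + norm (x - a)) = 1 + norm a + norm (x - a) + norm a * norm (x - a)"
    by (simp add: algebra_simps)
  ultimately show "1 + norm x \<le> (1 + norm a) * (1 + norm (x - a))" by linarith
qed (use norm_ge_zero[of a] in linarith)

lemma tame_translate: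
  fixes f :: "'a::euclidean_space \<Rightarrow> real"
  assumes "tame (wt \<alpha>) M f"
  shows "tame (wt \<alpha>) (M * (1 + norm a) powr (real DIM('a) + \<alpha>)) (\<lambda>x. f (x - a))"
proof -
  have "tame (\<lambda>x. wt \<alpha> (x - a)) M (\<lambda>x. f (x - a))"
  proof -
    obtain D where D: "\<And>x. \<bar>f x\<bar> \<le> M * wt \<alpha> x" "\<And>x. norm (D x) \<le> M * wt \<alpha> x"
       "\<And>x y. norm y \<le> 1 \<Longrightarrow> \<bar>f (x + y) - f x - D x \<bullet> y\<bar> \<le> M * (norm y)\<^sup>2 * wt \<alpha> x"
      using assms(1) unfolding tame_def by blast
    show ?thesis unfolding tame_def
      by (intro exI[of _ "\<lambda>x. D (x - a)"]) (use D in \<open>auto simp: diff_add_eq[symmetric]\<close>)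
  qed
  then show ?thesis
  proof (rule tame_mono)
    fix x
    have "M \<ge> 0" using tame_nonneg[OF assms, of 0] wt_pos[of "0::'a"] by (simp add: zero_le_mult_iff)
    then show "M * wt \<alpha> (x - a) \<le> M * (1 + norm a) powr (real DIM('a) + \<alpha>) * wt \<alpha> x"
      unfolding mult.assoc by (intro mult_left_mono wt_translate)
  qed
qed

text \<open>
  Inside the unit ball the weight is at most \<open>1\<close>, outside it is dominated by the kernel.
\<close>

lemma wt_integrable: "integrable lborel (wt \<alpha> :: 'a::euclidean_space \<Rightarrow> real)"
proof -
  have "integrable lborel (\<lambda>x::'a. indicator (cball 0 1) x + min 1 ((norm x)\<^sup>2) * rker \<alpha> x)"
    using rker_min_integrable[OF \<alpha>] emeasure_bounded_finite[OF bounded_cball, of "0::'a" 1]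
    by (intro Bochner_Integration.integrable_add integrable_real_indicator) simp_all
  then show ?thesis
  proof (rule Bochner_Integration.integrable_bound)
    show "AE x::'a in lborel. norm (wt \<alpha> x) \<le> norm (indicator (cball 0 1) x + min 1 ((norm x)\<^sup>2) * rker \<alpha> x)"
    proof (rule AE_I2)
      fix x :: 'a
      show "norm (wt \<alpha> x) \<le> norm (indicator (cball 0 1) x + min 1 ((norm x)\<^sup>2) * rker \<alpha> x)"
      proof (cases "norm x \<le> 1")
        case True
        have "0 \<le> min 1 ((norm x)\<^sup>2) * rker \<alpha> x" by simp
        then have "wt \<alpha> x \<le> 1 + min 1 ((norm x)\<^sup>2) * rker \<alpha> x" using wt_le_1[of x] by linarith
        then show ?thesis using True by (simp add: indicator_def)
      next
        case False
        then have "1 \<le> (norm x)\<^sup>2" by (simp add: one_le_power)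
        moreover have "wt \<alpha> x \<le> rker \<alpha> x" unfolding wt_def rker_def using False \<alpha>
          by (intro divide_left_mono powr_mono2 mult_pos_pos) (auto intro!: powr_gt_zero[THEN iffD2])
        ultimately show ?thesis using False by (simp add: indicator_def)
      qed
    qed
  qed simp
qed

lemma rker_le_wt:
  fixes x y :: "'a::euclidean_space"
  assumes "1 + norm x \<le> 2 * norm y"
  shows "rker \<alpha> y \<le> 2 powr (real DIM('a) + \<alpha>) * wt \<alpha> x"
proof -
  have "(1 + norm x) powr (real DIM('a) + \<alpha>) \<le> (2 * norm y) powr (real DIM('a) + \<alpha>)"
    using assms \<alpha> by (intro powr_mono2) auto
  also have "\<dots> = 2 powr (real DIM('a) + \<alpha>) * norm y powr (real DIM('a) + \<alpha>)" by (intro powr_mult)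
  finally have h: "(1 + norm x) powr (real DIM('a) + \<alpha>) \<le> 2 powr (real DIM('a) + \<alpha>) * norm y powr (real DIM('a) + \<alpha>)" .
  have "0 < 1 + norm x" using norm_ge_zero[of x] by linarith
  then have "0 < norm y" using assms by linarith
  with \<open>0 < 1 + norm x\<close> have "0 < (1 + norm x) powr (real DIM('a) + \<alpha>)" "0 < norm y powr (real DIM('a) + \<alpha>)" by auto
  then show ?thesis using h by (simp add: rker_def wt_def field_simps)
qed

text \<open>
  Either \<open>x + y\<close> or \<open>y\<close> has size at least about half that of \<open>x\<close>, so one of the two factors on the left is at most
  a constant times \<open>wt \<alpha> x\<close>. This is why the operator preserves decay at the rate of the weight.
\<close>

lemma wt_rker:
  fixes x y :: "'a::euclidean_space"
  shows "wt \<alpha> (x + y) * rker \<alpha> y \<le> 2 powr (real DIM('a) + \<alpha>) * wt \<alpha> x * (wt \<alpha> (x + y) + rker \<alpha> y)"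
proof -
  let ?c = "2 powr (real DIM('a) + \<alpha>)"
  have tri: "norm x \<le> norm (x + y) + norm y" by (metis add_diff_cancel norm_triangle_ineq4)
  show ?thesis
  proof (cases "1 + norm x \<le> 2 * (1 + norm (x + y))")
    case True
    then have "wt \<alpha> (x + y) * rker \<alpha> y \<le> (?c * wt \<alpha> x) * rker \<alpha> y"
      by (intro mult_right_mono wt_compare) auto
    also have "\<dots> \<le> (?c * wt \<alpha> x) * (wt \<alpha> (x + y) + rker \<alpha> y)" by (intro mult_left_mono) auto
    finally show ?thesis .
  next
    case False
    then have "2 + 2 * norm (x + y) < 1 + norm x" by simp
    then have le: "1 + norm x \<le> 2 * norm y" using tri by linarith
    have "rker \<alpha> y \<le> ?c * wt \<alpha> x" by (rule rker_le_wt[OF le])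
    then have "wt \<alpha> (x + y) * rker \<alpha> y \<le> wt \<alpha> (x + y) * (?c * wt \<alpha> x)" by (intro mult_left_mono) auto
    also have "\<dots> = (?c * wt \<alpha> x) * wt \<alpha> (x + y)" by (simp add: mult_ac)
    also have "\<dots> \<le> (?c * wt \<alpha> x) * (wt \<alpha> (x + y) + rker \<alpha> y)" by (intro mult_left_mono) auto
    finally show ?thesis .
  qed
qed

text \<open>
  A majorant of the integrand of \<open>Lam \<alpha> f x\<close>, divided by the size of \<open>f\<close> and by \<open>wt \<alpha> x\<close>. Its integral over \<open>y\<close>
  does not depend on \<open>x\<close>.
\<close>

definition sd_majorant :: "'a::euclidean_space \<Rightarrow> 'a \<Rightarrow> real" where
  "sd_majorant x y = 2 * (min 1 ((norm y)\<^sup>2) * rker \<alpha> y) +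
     2 powr (real DIM('a) + \<alpha>) * (wt \<alpha> (x + y) + wt \<alpha> (x - y) + 2 * (min 1 ((norm y)\<^sup>2) * rker \<alpha> y))"

lemma sd_majorant_integral:
  "has_bochner_integral lborel (sd_majorant (x::'a::euclidean_space)) (2 * Lam_bound TYPE('a) \<alpha>)"
proof -
  have k: "has_bochner_integral lborel (\<lambda>y::'a. min 1 ((norm y)\<^sup>2) * rker \<alpha> y) (LBINT y::'a. min 1 ((norm y)\<^sup>2) * rker \<alpha> y)"
    using rker_min_integrable[OF \<alpha>] by (rule has_bochner_integral_integrable)
  have 1: "has_bochner_integral lborel (\<lambda>y. wt \<alpha> (x + y)) (LBINT y::'a. wt \<alpha> y)"
    using wt_integrable lborel_integral_translate[of "wt \<alpha>" x] by (simp add: has_bochner_integral_iff)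
  have 2: "has_bochner_integral lborel (\<lambda>y. wt \<alpha> (x - y)) (LBINT y::'a. wt \<alpha> y)"
    using wt_integrable lborel_integral_reflect[of "wt \<alpha>" x] by (simp add: has_bochner_integral_iff)
  have e: "2 * (LBINT y::'a. min 1 ((norm y)\<^sup>2) * rker \<alpha> y) + 2 powr (real DIM('a) + \<alpha>) * ((LBINT y::'a. wt \<alpha> y) + (LBINT y::'a. wt \<alpha> y) + 2 * (LBINT y::'a. min 1 ((norm y)\<^sup>2) * rker \<alpha> y))
    = 2 * Lam_bound TYPE('a) \<alpha>" unfolding Lam_bound_def by (simp add: algebra_simps)
  show ?thesis unfolding sd_majorant_def e[symmetric]
    by (intro has_bochner_integral_add has_bochner_integral_mult_right k 1 2)
qed

text \<open>
  For \<open>|y| \<le> 1\<close> the second difference is controlled by the Taylor remainder, for \<open>|y| > 1\<close> by the three values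
  of \<open>f\<close> and \<open>wt_rker\<close>.
\<close>

lemma sd_bound:
  fixes f :: "'a::euclidean_space \<Rightarrow> real"
  assumes f: "tame (wt \<alpha>) M f"
  shows "\<bar>sdiff f x y * rker \<alpha> y\<bar> \<le> (M * wt \<alpha> x) * sd_majorant x y"
proof -
  have Mw: "0 \<le> M * wt \<alpha> x" for x :: 'a by (rule tame_nonneg[OF f])
  have M: "M \<ge> 0" using Mw[of 0] wt_pos[of "0::'a"] by (simp add: zero_le_mult_iff)
  let ?c = "2 powr (real DIM('a) + \<alpha>)"
  let ?m = "min 1 ((norm y)\<^sup>2) * rker \<alpha> y"
  have m: "0 \<le> ?m" by simp
  show ?thesis
  proof (cases "norm y \<le> 1")
    case True
    then have y2: "min 1 ((norm y)\<^sup>2) = (norm y)\<^sup>2" by (simp add: power_le_one)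
    have "\<bar>sdiff f x y * rker \<alpha> y\<bar> \<le> (2 * (M * wt \<alpha> x) * (norm y)\<^sup>2) * rker \<alpha> y"
      unfolding abs_mult using tame_second_difference[OF f True] by (intro mult_mono) (auto intro!: mult_nonneg_nonneg Mw M)
    also have "\<dots> = (M * wt \<alpha> x) * (2 * ?m)" by (simp add: y2)
    also have "\<dots> \<le> (M * wt \<alpha> x) * sd_majorant x y" 
      unfolding sd_majorant_def using m by (intro mult_left_mono Mw) simp
    finally show ?thesis .
  next
    case False
    then have "1 \<le> (norm y)\<^sup>2" by (simp add: one_le_power)
    then have y2: "?m = rker \<alpha> y" by simp
    have "\<bar>sdiff f x y\<bar> \<le> 2 * (M * wt \<alpha> x) + M * wt \<alpha> (x + y) + M * wt \<alpha> (x - y)"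
      using tame_bound[OF f, of x] tame_bound[OF f, of "x + y"] tame_bound[OF f, of "x - y"] by linarith
    then have "\<bar>sdiff f x y * rker \<alpha> y\<bar> \<le> (2 * (M * wt \<alpha> x) + M * wt \<alpha> (x + y) + M * wt \<alpha> (x - y)) * rker \<alpha> y"
      unfolding abs_mult by (intro mult_mono) (auto intro!: add_nonneg_nonneg Mw)
    also have "\<dots> = M * (2 * wt \<alpha> x * rker \<alpha> y + wt \<alpha> (x + y) * rker \<alpha> y + wt \<alpha> (x + - y) * rker \<alpha> (- y))"
      by (simp add: algebra_simps)
    also have "\<dots> \<le> M * (2 * wt \<alpha> x * rker \<alpha> y + ?c * wt \<alpha> x * (wt \<alpha> (x + y) + rker \<alpha> y) + ?c * wt \<alpha> x * (wt \<alpha> (x + - y) + rker \<alpha> (- y)))"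
      by (intro mult_left_mono add_mono wt_rker M) simp_all
    also have "\<dots> = (M * wt \<alpha> x) * sd_majorant x y"
      unfolding sd_majorant_def y2 by (simp add: algebra_simps)
    finally show ?thesis .
  qed
qed

lemma sd_integrable:
  fixes f :: "'a::euclidean_space \<Rightarrow> real"
  assumes f: "tame (wt \<alpha>) M f"
  shows "integrable lborel (\<lambda>y. sdiff f x y * rker \<alpha> y)"
proof (rule Bochner_Integration.integrable_bound)
  show "integrable lborel (\<lambda>y. (M * wt \<alpha> x) * sd_majorant x y)"
    using sd_majorant_integral by (intro integrable_mult_right) (auto simp: has_bochner_integral_iff)
  show "(\<lambda>y. sdiff f x y * rker \<alpha> y) \<in> borel_measurable lborel"
    using tame_measurable[OF f] by measurable
  show "AE y in lborel. norm (sdiff f x y * rker \<alpha> y) \<le> norm (M * wt \<alpha> x * sd_majorant x y)"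
    using sd_bound[OF f] by (intro AE_I2) (simp add: order_trans[OF _ abs_ge_self])
qed

lemma Lam_le:
  fixes f :: "'a::euclidean_space \<Rightarrow> real"
  assumes f: "tame (wt \<alpha>) M f"
  shows "\<bar>Lam \<alpha> f x\<bar> \<le> Lam_bound TYPE('a) \<alpha> * M * wt \<alpha> x"
proof -
  have "\<bar>LBINT y. sdiff f x y * rker \<alpha> y\<bar> \<le> (LBINT y. (M * wt \<alpha> x) * sd_majorant x y)"
    using sd_majorant_integral sd_bound[OF f]
    by (intro integral_abs_bound[THEN order_trans] integral_mono integrable_abs sd_integrable[OF f] integrable_mult_right) (auto simp: has_bochner_integral_iff)
  also have "\<dots> = (M * wt \<alpha> x) * (2 * Lam_bound TYPE('a) \<alpha>)"
    using sd_majorant_integral[of x] by (simp add: has_bochner_integral_iff)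
  finally show ?thesis by (simp add: Lam_def mult_ac)
qed

lemma Lam_bound_nonneg: "0 \<le> Lam_bound TYPE('a::euclidean_space) \<alpha>"
  unfolding Lam_bound_def by (intro add_nonneg_nonneg mult_nonneg_nonneg integral_nonneg_AE AE_I2) auto

lemma Lam_measurable:
  fixes f :: "'a::euclidean_space \<Rightarrow> real"
  assumes [measurable]: "f \<in> borel_measurable borel"
  shows "Lam \<alpha> f \<in> borel_measurable borel"
  unfolding Lam_def[abs_def] by measurable

lemma Lam_tendsto:
  fixes f :: "'a::euclidean_space \<Rightarrow> real" and g :: "nat \<Rightarrow> 'a \<Rightarrow> real"
  assumes g: "\<And>k. tame (wt \<alpha>) M (g k)" and f: "f \<in> borel_measurable borel"
    and lim: "\<And>x. (\<lambda>k. g k x) \<longlonglongrightarrow> f x"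
  shows "(\<lambda>k. Lam \<alpha> (g k) x) \<longlonglongrightarrow> Lam \<alpha> f x"
proof -
  have "(\<lambda>k. LBINT y. sdiff (g k) x y * rker \<alpha> y) \<longlonglongrightarrow> (LBINT y. sdiff f x y * rker \<alpha> y)"
  proof (rule integral_dominated_convergence)
    show "integrable lborel (\<lambda>y. (M * wt \<alpha> x) * sd_majorant x y)"
      using sd_majorant_integral by (intro integrable_mult_right) (auto simp: has_bochner_integral_iff)
    show "(\<lambda>y. sdiff f x y * rker \<alpha> y) \<in> borel_measurable lborel"
      using f by measurable
    show "(\<lambda>y. sdiff (g k) x y * rker \<alpha> y) \<in> borel_measurable lborel" for k
      using tame_measurable[OF g] by measurable
    show "AE y in lborel. norm (sdiff (g k) x y * rker \<alpha> y) \<le> M * wt \<alpha> x * sd_majorant x y" for k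
      using sd_bound[OF g] by simp
    show "AE y in lborel. (\<lambda>k. sdiff (g k) x y * rker \<alpha> y) \<longlonglongrightarrow> sdiff f x y * rker \<alpha> y"
      by (intro AE_I2 tendsto_intros lim)
  qed
  then show ?thesis unfolding Lam_def by (intro tendsto_intros) auto
qed

text \<open>
  The kernel is homogeneous of degree \<open>-n - \<alpha>\<close> and the volume element of degree \<open>n\<close>.
\<close>

lemma Lam_scale:
  fixes f :: "'a::euclidean_space \<Rightarrow> real"
  assumes "s > 0"
  shows "Lam \<alpha> (\<lambda>x. f (x /\<^sub>R s)) x = s powr (- \<alpha>) * Lam \<alpha> f (x /\<^sub>R s)"
proof -
  have k: "s ^ DIM('a) * rker \<alpha> (s *\<^sub>R y) = s powr (- \<alpha>) * rker \<alpha> y" for y :: 'a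
  proof -
    have "(s * norm y) powr (real DIM('a) + \<alpha>) = s ^ DIM('a) * s powr \<alpha> * norm y powr (real DIM('a) + \<alpha>)"
      using assms by (simp add: powr_mult powr_add powr_realpow)
    then show ?thesis using assms by (simp add: rker_def powr_minus_divide)
  qed
  have h: "s ^ DIM('a) * (A * rker \<alpha> (s *\<^sub>R y)) = s powr (- \<alpha>) * (A * rker \<alpha> y)" for A and y :: 'a
    by (simp only: mult.left_commute[of _ A] k)
  have "(LBINT y. (2 * f (x /\<^sub>R s) - f ((x + y) /\<^sub>R s) - f ((x - y) /\<^sub>R s)) * rker \<alpha> y) =
     s ^ DIM('a) * (LBINT y. (2 * f (x /\<^sub>R s) - f ((x + s *\<^sub>R y) /\<^sub>R s) - f ((x - s *\<^sub>R y) /\<^sub>R s)) * rker \<alpha> (s *\<^sub>R y))"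
    using lborel_integral_scale(1)[of s "\<lambda>y. (2 * f (x /\<^sub>R s) - f ((x + y) /\<^sub>R s) - f ((x - y) /\<^sub>R s)) * rker \<alpha> y"] assms by simp
  also have "\<dots> = (LBINT y. s ^ DIM('a) * ((2 * f (x /\<^sub>R s) - f ((x + s *\<^sub>R y) /\<^sub>R s) - f ((x - s *\<^sub>R y) /\<^sub>R s)) * rker \<alpha> (s *\<^sub>R y)))"
    by simp
  also have "\<dots> = (LBINT y. s powr (- \<alpha>) * ((2 * f (x /\<^sub>R s) - f (x /\<^sub>R s + y) - f (x /\<^sub>R s - y)) * rker \<alpha> y))"
  proof (rule Bochner_Integration.integral_cong[OF refl])
    fix y :: 'a
    have "(x + s *\<^sub>R y) /\<^sub>R s = x /\<^sub>R s + y" "(x - s *\<^sub>R y) /\<^sub>R s = x /\<^sub>R s - y"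
      using assms by (simp_all add: scaleR_right_distrib scaleR_diff_right)
    then show "s ^ DIM('a) * ((2 * f (x /\<^sub>R s) - f ((x + s *\<^sub>R y) /\<^sub>R s) - f ((x - s *\<^sub>R y) /\<^sub>R s)) * rker \<alpha> (s *\<^sub>R y)) = s powr (- \<alpha>) * ((2 * f (x /\<^sub>R s) - f (x /\<^sub>R s + y) - f (x /\<^sub>R s - y)) * rker \<alpha> y)"
      by (simp only: h)
  qed
  finally show ?thesis by (simp add: Lam_def)
qed

lemma Lam_translate: "Lam \<alpha> (\<lambda>x. f (x - a)) x = Lam \<alpha> f (x - a)"
proof -
  have "x + y - a = x - a + y" "x - y - a = x - a - y" for y by simp_all
  then show ?thesis by (simp only: Lam_def)
qed

text \<open>
  The truncated integral is unchanged under \<open>y \<mapsto> -y\<close>. Averaging the two forms turns the first difference into a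
  second difference, which is integrable up to the singularity, so the truncation can be removed by dominated
  convergence.
\<close>

lemma frac_laplacian_pv_eq_Lam:
  fixes f :: "'a::euclidean_space \<Rightarrow> real"
  assumes f: "tame (wt \<alpha>) M f"
  shows "frac_laplacian_pv \<alpha> f x = Lam \<alpha> f x"
proof -
  let ?J = "\<lambda>e. LBINT y. indicator (- ball 0 e) y * (sdiff f x y * rker \<alpha> y) / 2"
  note [measurable] = tame_measurable[OF f]
  have M: "M \<ge> 0" using tame_nonneg[OF f, of 0] wt_pos[of "0::'a"] by (simp add: zero_le_mult_iff)
  have fb: "\<bar>f z\<bar> \<le> M" for z
    using tame_bound[OF f, of z] mult_left_mono[OF wt_le_1[of z] M] by simp
  have trunc: "(LINT z:(- ball x e)|lebesgue. (f x - f z) / norm (x - z) powr (real DIM('a) + \<alpha>)) = ?J e" if e: "e > 0" for e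
  proof -
    let ?g = "\<lambda>y. indicator (- ball 0 e) y * ((f x - f (x + y)) * rker \<alpha> y)"
    let ?h = "\<lambda>y. indicator (- ball 0 e) y * ((f x - f (x - y)) * rker \<alpha> y)"
    let ?G = "\<lambda>z. indicator (- ball x e) z *\<^sub>R ((f x - f z) / norm (x - z) powr (real DIM('a) + \<alpha>))"
    have "(LINT z:(- ball x e)|lebesgue. (f x - f z) / norm (x - z) powr (real DIM('a) + \<alpha>)) = (LBINT z. ?G z)"
      unfolding set_lebesgue_integral_def by (rule integral_completion) measurable
    moreover have "(LBINT z. ?G z) = (LBINT y. ?G (x + y))" by (rule lborel_integral_translate(1)[symmetric])
    moreover have "(LBINT z. ?G z) = (LBINT y. ?G (x - y))" by (rule lborel_integral_reflect(1)[symmetric])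
    moreover have "?G (x + y) = ?g y" "?G (x - y) = ?h y" for y
      by (auto simp: rker_def indicator_def dist_norm)
    ultimately have eqs: "(LINT z:(- ball x e)|lebesgue. (f x - f z) / norm (x - z) powr (real DIM('a) + \<alpha>)) = (LBINT y. ?g y)"
       "(LINT z:(- ball x e)|lebesgue. (f x - f z) / norm (x - z) powr (real DIM('a) + \<alpha>)) = (LBINT y. ?h y)" by simp_all
    have dom: "integrable lborel (\<lambda>y::'a. 2 * M * max 1 (1 / e\<^sup>2) * (min 1 ((norm y)\<^sup>2) * rker \<alpha> y))"
      by (intro integrable_mult_right rker_min_integrable \<alpha>)
    \<comment> \<open>Away from the singularity the kernel itself is integrable, with a bound depending on the truncation radius.\<close>
    have rk: "indicator (- ball 0 e) y * rker \<alpha> y \<le> max 1 (1 / e\<^sup>2) * (min 1 ((norm y)\<^sup>2) * rker \<alpha> y)" for y :: 'a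
    proof (cases "norm y < e")
      case False
      have "1 \<le> max 1 (1 / e\<^sup>2) * min 1 ((norm y)\<^sup>2)"
      proof (cases "norm y \<le> 1")
        case True
        have "1 \<le> (1 / e\<^sup>2) * (norm y)\<^sup>2" using False e by (simp add: field_simps power_mono)
        also have "\<dots> \<le> max 1 (1 / e\<^sup>2) * (norm y)\<^sup>2" by (intro mult_right_mono) auto
        finally show ?thesis using True by (simp add: power_le_one min_absorb2)
      next
        case False
        then have "1 \<le> (norm y)\<^sup>2" by (simp add: one_le_power)
        then show ?thesis by simp
      qed
      then have "1 * rker \<alpha> y \<le> (max 1 (1 / e\<^sup>2) * min 1 ((norm y)\<^sup>2)) * rker \<alpha> y" by (intro mult_right_mono) auto
      then show ?thesis using False by (simp add: indicator_def mult_ac)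
    qed (auto simp: indicator_def intro!: mult_nonneg_nonneg)
    have bnd: "\<bar>indicator (- ball 0 e) y * ((f x - f z) * rker \<alpha> y)\<bar> \<le> 2 * M * max 1 (1 / e\<^sup>2) * (min 1 ((norm y)\<^sup>2) * rker \<alpha> y)" for y z :: 'a
    proof -
      have "\<bar>f x - f z\<bar> * (indicator (- ball 0 e) y * rker \<alpha> y) \<le> (2 * M) * (max 1 (1 / e\<^sup>2) * (min 1 ((norm y)\<^sup>2) * rker \<alpha> y))"
      proof (rule mult_mono[OF _ rk])
        show "\<bar>f x - f z\<bar> \<le> 2 * M" using fb[of x] fb[of z] by linarith
      qed (use M in auto)
      then show ?thesis by (simp add: abs_mult mult_ac)
    qed
    have g: "integrable lborel ?g"
      by (rule Bochner_Integration.integrable_bound[OF dom]) (use bnd in \<open>auto intro!: AE_I2 order_trans[OF _ abs_ge_self]\<close>)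
    have h: "integrable lborel ?h"
      by (rule Bochner_Integration.integrable_bound[OF dom]) (use bnd in \<open>auto intro!: AE_I2 order_trans[OF _ abs_ge_self]\<close>)
    have "?J e = (LBINT y. (?g y + ?h y) / 2)"
      by (intro Bochner_Integration.integral_cong refl) (simp add: algebra_simps)
    also have "\<dots> = ((LBINT y. ?g y) + (LBINT y. ?h y)) / 2" using g h by simp
    finally show ?thesis using eqs by simp
  qed
  have "((\<lambda>e. ?J e) \<longlongrightarrow> Lam \<alpha> f x) (at_right 0)"
    unfolding tendsto_at_iff_sequentially comp_def
  proof (intro allI impI)
    fix X :: "nat \<Rightarrow> real"
    assume X: "\<forall>i. X i \<in> {0<..} - {0}" "X \<longlonglongrightarrow> 0"
    have "(\<lambda>i. ?J (X i)) \<longlonglongrightarrow> (LBINT y. sdiff f x y * rker \<alpha> y / 2)"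
    proof (rule integral_dominated_convergence)
      show "integrable lborel (\<lambda>y. \<bar>sdiff f x y * rker \<alpha> y\<bar>)" by (intro integrable_abs sd_integrable[OF f])
      show "AE y in lborel. (\<lambda>i. indicator (- ball 0 (X i)) y * (sdiff f x y * rker \<alpha> y) / 2) \<longlonglongrightarrow> sdiff f x y * rker \<alpha> y / 2"
        using AE_lborel_singleton[of "0::'a"]
      proof eventually_elim
        case (elim y)
        then have "\<forall>\<^sub>F i in sequentially. X i < norm y" using order_tendstoD(2)[OF X(2), of "norm y"] by simp
        then have "\<forall>\<^sub>F i in sequentially. indicator (- ball 0 (X i)) y * (sdiff f x y * rker \<alpha> y) / 2 = sdiff f x y * rker \<alpha> y / 2"
          by eventually_elim (auto simp: indicator_def)
        then show ?case by (rule tendsto_eventually)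
      qed
      show "AE y in lborel. norm (indicator (- ball 0 (X i)) y * (sdiff f x y * rker \<alpha> y) / 2) \<le> \<bar>sdiff f x y * rker \<alpha> y\<bar>" for i
        by (intro AE_I2) (auto simp: indicator_def)
    qed measurable
    then show "(\<lambda>i. ?J (X i)) \<longlonglongrightarrow> Lam \<alpha> f x" by (simp add: Lam_def)
  qed
  moreover have "\<forall>\<^sub>F e in at_right 0. ?J e = (LINT z:(- ball x e)|lebesgue. (f x - f z) / norm (x - z) powr (real DIM('a) + \<alpha>))"
    using eventually_at_right_less[of 0] by eventually_elim (use trunc in auto)
  ultimately have "((\<lambda>e. LINT z:(- ball x e)|lebesgue. (f x - f z) / norm (x - z) powr (real DIM('a) + \<alpha>)) \<longlongrightarrow> Lam \<alpha> f x) (at_right 0)"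
    by (rule Lim_transform_eventually)
  then show ?thesis unfolding frac_laplacian_pv_def by (intro tendsto_Lim) auto
qed

end

section \<open>The operator on the Fourier side\<close>

lemma cos_second_difference: "2 * cos a - cos (a + b) - cos (a - b) = 2 * cos a * (1 - cos b)" for a b :: real
  by (simp add: cos_add cos_diff algebra_simps)

lemma fourier_lborel:
  assumes [measurable]: "f \<in> borel_measurable borel"
  shows "fourier f \<xi> = (LBINT x. cis (- (x \<bullet> \<xi>)) * complex_of_real (f x))"
  unfolding fourier_def by (rule integral_completion) measurable

context fixes \<alpha> :: real assumes \<alpha>: "0 < \<alpha>" "\<alpha> < 2" begin

lemma tame_integrable:
  fixes f :: "'a::euclidean_space \<Rightarrow> real"
  assumes f: "tame (wt \<alpha>) M f"
  shows "integrable lborel f"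
proof (rule Bochner_Integration.integrable_bound)
  show "integrable lborel (\<lambda>x::'a. M * wt \<alpha> x)" by (intro integrable_mult_right wt_integrable \<alpha>)
qed (use tame_measurable[OF f] tame_bound[OF f] in \<open>auto intro!: AE_I2 order_trans[OF _ abs_ge_self]\<close>)

text \<open>
  Fubini's theorem: for fixed \<open>y\<close> the transform of the second difference is \<open>2 (1 - cos(y \<bullet> \<xi>))\<close> times that of \<open>f\<close>,
  and integrating this factor against the kernel gives the symbol.
\<close>

lemma fourier_Lam:
  fixes f :: "'a::euclidean_space \<Rightarrow> real"
  assumes f: "tame (wt \<alpha>) M f"
  shows "fourier (Lam \<alpha> f) \<xi> = complex_of_real (symbol_const TYPE('a) \<alpha> * norm \<xi> powr \<alpha>) * fourier f \<xi>"
proof -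
  note [measurable] = tame_measurable[OF f]
  note Lam_measurable[OF \<alpha> this, measurable]
  define F where "F x y = cis (- (x \<bullet> \<xi>)) * complex_of_real (sdiff f x y * rker \<alpha> y)" for x y
  have Fm: "case_prod F \<in> borel_measurable (lborel \<Otimes>\<^sub>M lborel)" unfolding F_def by measurable
  have Fn: "norm (F x y) = \<bar>sdiff f x y * rker \<alpha> y\<bar>" for x y
    by (simp only: F_def norm_mult norm_cis norm_of_real mult_1)
  have Fi: "integrable lborel (F x)" for x
    using sd_integrable[OF \<alpha> f, of x] Fm by (subst integrable_norm_iff[symmetric]) (auto simp: Fn intro: integrable_abs)
  have inner_le: "(LBINT y. norm (F x y)) \<le> (M * wt \<alpha> x) * (2 * Lam_bound TYPE('a) \<alpha>)" for x
  proof -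
    have "(LBINT y. norm (F x y)) \<le> (LBINT y. (M * wt \<alpha> x) * sd_majorant \<alpha> x y)"
      using sd_majorant_integral[OF \<alpha>, of x] sd_bound[OF \<alpha> f, of x] Fi[of x]
      by (intro integral_mono integrable_mult_right) (auto simp: has_bochner_integral_iff Fn intro: integrable_abs sd_integrable[OF \<alpha> f])
    then show ?thesis using sd_majorant_integral[OF \<alpha>, of x] by (simp add: has_bochner_integral_iff)
  qed
  have Fint: "integrable (lborel \<Otimes>\<^sub>M lborel) (case_prod F)"
  proof (rule lborel_pair.Fubini_integrable[OF Fm])
    show "integrable lborel (\<lambda>x. LBINT y. norm (case (x, y) of (x, y) \<Rightarrow> F x y))"
    proof (rule Bochner_Integration.integrable_bound)
      show "integrable lborel (\<lambda>x::'a. (M * wt \<alpha> x) * (2 * Lam_bound TYPE('a) \<alpha>))"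
        by (intro integrable_mult_right integrable_mult_left wt_integrable \<alpha>)
      show "(\<lambda>x. LBINT y. norm (case (x, y) of (x, y) \<Rightarrow> F x y)) \<in> borel_measurable lborel"
        using Fm by measurable
      show "AE x in lborel. norm (LBINT y. norm (case (x, y) of (x, y) \<Rightarrow> F x y)) \<le> norm ((M * wt \<alpha> x) * (2 * Lam_bound TYPE('a) \<alpha>))"
        using inner_le by (intro AE_I2) (simp add: order_trans[OF _ abs_ge_self])
    qed
  qed (use Fi in simp)
  have "(LBINT x. LBINT y. F x y) = (LBINT x. 2 * (cis (- (x \<bullet> \<xi>)) * complex_of_real (Lam \<alpha> f x)))"
  proof (rule Bochner_Integration.integral_cong[OF refl])
    fix x
    show "(LBINT y. F x y) = 2 * (cis (- (x \<bullet> \<xi>)) * complex_of_real (Lam \<alpha> f x))"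
      unfolding F_def Lam_def by (simp only: integral_mult_right_zero integral_complex_of_real) simp
  qed
  also have "\<dots> = 2 * fourier (Lam \<alpha> f) \<xi>"
    by (simp add: fourier_lborel Lam_measurable[OF \<alpha> tame_measurable[OF f]])
  finally have L: "(LBINT x. LBINT y. F x y) = 2 * fourier (Lam \<alpha> f) \<xi>" .
  define E where "E x = cis (- (x \<bullet> \<xi>)) * complex_of_real (f x)" for x
  have E: "integrable lborel E"
  proof (subst integrable_norm_iff[symmetric])
    show "E \<in> borel_measurable lborel" unfolding E_def by measurable
    show "integrable lborel (\<lambda>x. norm (E x))" using tame_integrable[OF f] by (simp add: E_def norm_mult)
  qed
  have sh: "has_bochner_integral lborel (\<lambda>x. cis (- (x \<bullet> \<xi>)) * complex_of_real (f (x + y))) (cis (y \<bullet> \<xi>) * fourier f \<xi>)" for y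
  proof -
    have "has_bochner_integral lborel (\<lambda>x. E (y + x)) (fourier f \<xi>)"
      using lborel_integral_translate[of E y] E fourier_lborel[of f \<xi>] by (simp add: has_bochner_integral_iff E_def)
    then have "has_bochner_integral lborel (\<lambda>x. cis (y \<bullet> \<xi>) * E (y + x)) (cis (y \<bullet> \<xi>) * fourier f \<xi>)"
      by (rule has_bochner_integral_mult_right) 
    moreover have "cis (y \<bullet> \<xi>) * E (y + x) = cis (- (x \<bullet> \<xi>)) * complex_of_real (f (x + y))" for x
      by (simp add: E_def mult.assoc[symmetric] cis_mult inner_add_left add.commute)
    ultimately show ?thesis by simp
  qed
  have Ey: "(LBINT x. F x y) = 2 * (complex_of_real ((1 - cos (y \<bullet> \<xi>)) * rker \<alpha> y) * fourier f \<xi>)" for y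
  proof -
    have "has_bochner_integral lborel (\<lambda>x. complex_of_real (rker \<alpha> y) * (2 * (cis (- (x \<bullet> \<xi>)) * complex_of_real (f (x + 0)))
        - cis (- (x \<bullet> \<xi>)) * complex_of_real (f (x + y)) - cis (- (x \<bullet> \<xi>)) * complex_of_real (f (x + - y))))
      (complex_of_real (rker \<alpha> y) * (2 * (cis (0 \<bullet> \<xi>) * fourier f \<xi>) - cis (y \<bullet> \<xi>) * fourier f \<xi> - cis (- y \<bullet> \<xi>) * fourier f \<xi>))"
      by (intro has_bochner_integral_mult_right has_bochner_integral_diff sh)
    moreover have "complex_of_real (rker \<alpha> y) * (2 * (cis (- (x \<bullet> \<xi>)) * complex_of_real (f (x + 0)))
        - cis (- (x \<bullet> \<xi>)) * complex_of_real (f (x + y)) - cis (- (x \<bullet> \<xi>)) * complex_of_real (f (x + - y))) = F x y" for x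
      by (simp add: F_def algebra_simps)
    moreover have "complex_of_real (rker \<alpha> y) * (2 * (cis (0 \<bullet> \<xi>) * fourier f \<xi>) - cis (y \<bullet> \<xi>) * fourier f \<xi> - cis (- y \<bullet> \<xi>) * fourier f \<xi>)
      = 2 * (complex_of_real ((1 - cos (y \<bullet> \<xi>)) * rker \<alpha> y) * fourier f \<xi>)"
    proof -
      have "cis (y \<bullet> \<xi>) + cis (- (y \<bullet> \<xi>)) = complex_of_real (2 * cos (y \<bullet> \<xi>))" by (simp add: complex_eq_iff)
      then have e: "cis (y \<bullet> \<xi>) = complex_of_real (2 * cos (y \<bullet> \<xi>)) - cis (- (y \<bullet> \<xi>))" by (simp add: algebra_simps)
      show ?thesis by (simp add: e algebra_simps)
    qed
    ultimately have "has_bochner_integral lborel (\<lambda>x. F x y) (2 * (complex_of_real ((1 - cos (y \<bullet> \<xi>)) * rker \<alpha> y) * fourier f \<xi>))"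
      by (simp only:)
    then show ?thesis by (rule has_bochner_integral_integral_eq)
  qed
  have "(LBINT y. LBINT x. F x y) = 2 * ((LBINT y. complex_of_real ((1 - cos (y \<bullet> \<xi>)) * rker \<alpha> y)) * fourier f \<xi>)"
    unfolding Ey by (simp only: integral_mult_right_zero integral_mult_left_zero)
  also have "(LBINT y. complex_of_real ((1 - cos (y \<bullet> \<xi>)) * rker \<alpha> y)) = complex_of_real (symbol_const TYPE('a) \<alpha> * norm \<xi> powr \<alpha>)"
    using rker_symbol[OF \<alpha>, of \<xi>] by (simp only: integral_complex_of_real has_bochner_integral_iff)
  finally have R: "(LBINT y. LBINT x. F x y) = 2 * (complex_of_real (symbol_const TYPE('a) \<alpha> * norm \<xi> powr \<alpha>) * fourier f \<xi>)" .
  have "(LBINT y. LBINT x. F x y) = (LBINT x. LBINT y. F x y)" by (rule lborel_pair.Fubini_integral[OF Fint])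
  then show ?thesis using L R by simp
qed

text \<open>
  The same computation for a function given as a Fourier integral. Fubini's theorem applies because the absolute value
  of the integrand has the integral \<open>2 K |m| |\<xi>|\<^sup>\<alpha> |cos(x \<bullet> \<xi>)|\<close> over \<open>y\<close>. The result is a pointwise identity, which is the form
  needed for superpositions.
\<close>

lemma Lam_cos_integral:
  fixes m :: "'a::euclidean_space \<Rightarrow> real"
  assumes m: "integrable lborel m" and ma: "integrable lborel (\<lambda>\<xi>. m \<xi> * norm \<xi> powr \<alpha>)"
  shows "Lam \<alpha> (\<lambda>x. LBINT \<xi>. m \<xi> * cos (x \<bullet> \<xi>)) x = symbol_const TYPE('a) \<alpha> * (LBINT \<xi>. m \<xi> * norm \<xi> powr \<alpha> * cos (x \<bullet> \<xi>))"
proof -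
  have [measurable]: "m \<in> borel_measurable borel" using borel_measurable_integrable[OF m] by simp
  have mc: "integrable lborel (\<lambda>\<xi>. m \<xi> * cos (z \<bullet> \<xi>))" for z
    by (rule Bochner_Integration.integrable_bound[OF m]) (auto simp: abs_mult mult_left_le)
  define F where "F \<xi> y = (m \<xi> * (2 * cos (x \<bullet> \<xi>))) * ((1 - cos (y \<bullet> \<xi>)) * rker \<alpha> y)" for \<xi> y
  have Fm: "case_prod F \<in> borel_measurable (lborel \<Otimes>\<^sub>M lborel)" unfolding F_def by measurable
  have Fi: "integrable lborel (F \<xi>)" for \<xi>
    using rker_symbol[OF \<alpha>, of \<xi>] unfolding F_def by (intro integrable_mult_right) (simp add: has_bochner_integral_iff)
  have Fn: "(LBINT y. norm (F \<xi> y)) = \<bar>m \<xi> * (2 * cos (x \<bullet> \<xi>))\<bar> * (symbol_const TYPE('a) \<alpha> * norm \<xi> powr \<alpha>)" for \<xi>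
  proof -
    have "norm (F \<xi> y) = \<bar>m \<xi> * (2 * cos (x \<bullet> \<xi>))\<bar> * ((1 - cos (y \<bullet> \<xi>)) * rker \<alpha> y)" for y
      unfolding F_def real_norm_def by (rule abs_mult_pos[symmetric]) simp
    then show ?thesis using rker_symbol[OF \<alpha>, of \<xi>] by (simp add: has_bochner_integral_iff)
  qed
  have K: "symbol_const TYPE('a) \<alpha> > 0" by (rule symbol_const_pos[OF \<alpha>])
  have Fint: "integrable (lborel \<Otimes>\<^sub>M lborel) (case_prod F)"
  proof (rule lborel_pair.Fubini_integrable[OF Fm])
    show "integrable lborel (\<lambda>\<xi>. LBINT y. norm (case (\<xi>, y) of (\<xi>, y) \<Rightarrow> F \<xi> y))"
    proof (rule Bochner_Integration.integrable_bound)
      show "integrable lborel (\<lambda>\<xi>. (2 * symbol_const TYPE('a) \<alpha>) * \<bar>m \<xi> * norm \<xi> powr \<alpha>\<bar>)"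
        using ma by (intro integrable_mult_right integrable_abs)
      show "(\<lambda>\<xi>. LBINT y. norm (case (\<xi>, y) of (\<xi>, y) \<Rightarrow> F \<xi> y)) \<in> borel_measurable lborel"
        using Fm by measurable
      show "AE \<xi> in lborel. norm (LBINT y. norm (case (\<xi>, y) of (\<xi>, y) \<Rightarrow> F \<xi> y)) \<le> norm ((2 * symbol_const TYPE('a) \<alpha>) * \<bar>m \<xi> * norm \<xi> powr \<alpha>\<bar>)"
      proof (rule AE_I2)
        fix \<xi> :: 'a
        have "\<bar>m \<xi>\<bar> * \<bar>cos (x \<bullet> \<xi>)\<bar> \<le> \<bar>m \<xi>\<bar>" by (intro mult_left_le) auto
        then have "\<bar>m \<xi> * (2 * cos (x \<bullet> \<xi>))\<bar> * (symbol_const TYPE('a) \<alpha> * norm \<xi> powr \<alpha>) \<le> (2 * \<bar>m \<xi>\<bar>) * (symbol_const TYPE('a) \<alpha> * norm \<xi> powr \<alpha>)"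
          using K by (intro mult_right_mono) (auto simp: abs_mult)
        then show "norm (LBINT y. norm (case (\<xi>, y) of (\<xi>, y) \<Rightarrow> F \<xi> y)) \<le> norm ((2 * symbol_const TYPE('a) \<alpha>) * \<bar>m \<xi> * norm \<xi> powr \<alpha>\<bar>)"
          using K by (simp add: Fn[unfolded real_norm_def] abs_mult mult_ac)
      qed
    qed
  qed (use Fi in simp)
  let ?f = "\<lambda>x. LBINT \<xi>. m \<xi> * cos (x \<bullet> \<xi>)"
  have sd: "sdiff ?f x y * rker \<alpha> y = (LBINT \<xi>. F \<xi> y)" for y
  proof -
    have "2 * ?f x - ?f (x + y) - ?f (x - y) = (LBINT \<xi>. 2 * (m \<xi> * cos (x \<bullet> \<xi>)) - m \<xi> * cos ((x + y) \<bullet> \<xi>) - m \<xi> * cos ((x - y) \<bullet> \<xi>))"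
      using mc by simp
    also have "\<dots> = (LBINT \<xi>. m \<xi> * (2 * cos (x \<bullet> \<xi>) * (1 - cos (y \<bullet> \<xi>))))"
      unfolding cos_second_difference[symmetric]
      by (intro Bochner_Integration.integral_cong refl) (simp add: inner_add_left inner_diff_left algebra_simps)
    finally have "sdiff ?f x y * rker \<alpha> y = (LBINT \<xi>. m \<xi> * (2 * cos (x \<bullet> \<xi>) * (1 - cos (y \<bullet> \<xi>))) * rker \<alpha> y)"
      by simp
    then show ?thesis by (simp add: F_def mult.assoc)
  qed
  have "Lam \<alpha> ?f x = (LBINT y. LBINT \<xi>. F \<xi> y) / 2" unfolding Lam_def sd ..
  also have "(LBINT y. LBINT \<xi>. F \<xi> y) = (LBINT \<xi>. LBINT y. F \<xi> y)" by (rule lborel_pair.Fubini_integral[OF Fint])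
  also have "\<dots> = (LBINT \<xi>. (2 * symbol_const TYPE('a) \<alpha>) * (m \<xi> * norm \<xi> powr \<alpha> * cos (x \<bullet> \<xi>)))"
  proof (rule Bochner_Integration.integral_cong[OF refl])
    fix \<xi> :: 'a
    show "(LBINT y. F \<xi> y) = (2 * symbol_const TYPE('a) \<alpha>) * (m \<xi> * norm \<xi> powr \<alpha> * cos (x \<bullet> \<xi>))"
      using rker_symbol[OF \<alpha>, of \<xi>] by (simp add: F_def has_bochner_integral_iff)
  qed
  finally show ?thesis by simp
qed

end

section \<open>Criteria for tameness\<close>

text \<open>
  The mean value inequality, applied to the gradient \<open>D\<close> and then to \<open>z \<mapsto> f z - D x \<bullet> z\<close>.
\<close>

lemma tame_of_derivatives:
  fixes f :: "'a::euclidean_space \<Rightarrow> real"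
  assumes f: "\<And>x. (f has_derivative (\<lambda>h. D x \<bullet> h)) (at x)"
    and D: "\<And>x. (D has_derivative D2 x) (at x)"
    and D2: "\<And>z h. norm (D2 z h) \<le> B z * norm h"
    and b: "\<And>x. \<bar>f x\<bar> \<le> M * w x" "\<And>x. norm (D x) \<le> M * w x"
      "\<And>x z. norm (z - x) \<le> 1 \<Longrightarrow> B z \<le> M * w x"
  shows "tame w M f"
  unfolding tame_def
proof (intro exI[of _ D] allI conjI impI b)
  fix x y :: 'a assume y: "norm y \<le> 1"
  let ?S = "cball x (norm y)"
  have Mw: "0 \<le> M * w x" using b(1)[of x] by linarith
  have Dl: "norm (D z - D x) \<le> (M * w x) * norm (z - x)" if "z \<in> ?S" for z
  proof (rule differentiable_bound[of ?S D D2])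
    show "(D has_derivative D2 z) (at z within ?S)" for z using D has_derivative_at_withinI by blast
    show "onorm (D2 z) \<le> M * w x" if "z \<in> ?S" for z
    proof (rule onorm_le)
      fix h :: 'a
      have "norm (z - x) \<le> 1" using that y by (simp add: dist_norm norm_minus_commute)
      then have "B z * norm h \<le> M * w x * norm h" by (intro mult_right_mono b) auto
      then show "norm (D2 z h) \<le> M * w x * norm h" using D2[of z h] by linarith
    qed
  qed (use that in auto)
  let ?g = "\<lambda>z. f z - D x \<bullet> z"
  have "norm (?g (x + y) - ?g x) \<le> ((M * w x) * norm y) * norm (x + y - x)"
  proof (rule differentiable_bound[of ?S ?g "\<lambda>z h. (D z - D x) \<bullet> h"])
    show "(?g has_derivative (\<lambda>h. (D z - D x) \<bullet> h)) (at z within ?S)" for z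
    proof -
      have "(?g has_derivative (\<lambda>h. D z \<bullet> h - D x \<bullet> h)) (at z)"
        by (intro has_derivative_diff f has_derivative_inner_right has_derivative_ident)
      then show ?thesis by (simp add: inner_diff_left has_derivative_at_withinI)
    qed
    show "onorm (\<lambda>h. (D z - D x) \<bullet> h) \<le> M * w x * norm y" if "z \<in> ?S" for z
    proof (rule onorm_le)
      fix h :: 'a
      have "norm (z - x) \<le> norm y" using that by (simp add: dist_norm norm_minus_commute)
      then have "(M * w x) * norm (z - x) \<le> (M * w x) * norm y" using Mw by (intro mult_left_mono)
      then have "norm (D z - D x) \<le> (M * w x) * norm y" using Dl[OF that] by linarith
      then have "norm (D z - D x) * norm h \<le> (M * w x) * norm y * norm h" by (intro mult_right_mono) auto
      then show "norm ((D z - D x) \<bullet> h) \<le> M * w x * norm y * norm h"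
        using Cauchy_Schwarz_ineq2[of "D z - D x" h] by simp
    qed
  qed (auto simp: dist_norm)
  then show "\<bar>f (x + y) - f x - D x \<bullet> y\<bar> \<le> M * (norm y)\<^sup>2 * w x"
    by (simp add: inner_add_right power2_eq_square mult_ac algebra_simps)
qed

lemma wt_near:
  assumes "0 < \<alpha>" "\<alpha> < 2" "norm (z - x) \<le> 1"
  shows "wt \<alpha> z \<le> 2 powr (real DIM('a) + \<alpha>) * wt \<alpha> (x::'a::euclidean_space)"
proof (rule wt_compare[OF assms(1,2)])
  have "norm x \<le> norm z + norm (z - x)" by (metis norm_minus_commute norm_triangle_sub add.commute)
  moreover have "2 * (1 + norm z) = 2 + 2 * norm z" by simp
  ultimately show "1 + norm x \<le> 2 * (1 + norm z)" using assms(3) norm_ge_zero[of z] by linarith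
qed simp

lemma inverse_power_le_wt:
  assumes "0 < \<alpha>" "\<alpha> < 2"
  shows "1 / (1 + norm (x::'a::euclidean_space)) ^ (DIM('a) + 2) \<le> wt \<alpha> x"
proof -
  have "0 < 1 + norm x" using norm_ge_zero[of x] by linarith
  moreover have "(1 + norm x) powr (real DIM('a) + \<alpha>) \<le> (1 + norm x) powr (real (DIM('a) + 2))"
    using assms by (intro powr_mono) auto
  ultimately show ?thesis unfolding wt_def
    by (subst (asm) powr_realpow) (auto intro!: divide_left_mono mult_pos_pos)
qed

text \<open>
  Take the \<open>K\<close>-th power of \<open>x / K \<le> exp (x / K)\<close>.
\<close>

lemma power_le_exp:
  fixes x :: real
  assumes "x \<ge> 0" shows "x ^ K \<le> real K ^ K * exp x"
proof (cases "K = 0")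
  case False
  have "x / K \<le> exp (x / K)" using exp_ge_add_one_self[of "x / K"] by linarith
  then have "(x / K) ^ K \<le> exp (x / K) ^ K" using assms by (intro power_mono) auto
  also have "exp (x / K) ^ K = exp x" using False by (simp flip: exp_of_nat_mult)
  finally show ?thesis using False by (simp add: power_divide field_simps)
qed (use assms in auto)

text \<open>
  Apply \<open>power_le_exp\<close> to \<open>c (1 + t\<^sup>2)\<close>.
\<close>

lemma poly_gauss_bounded:
  assumes "c > 0"
  obtains C where "C > 0" "\<And>t. t \<ge> 0 \<Longrightarrow> (1 + t) ^ K * exp (- c * t\<^sup>2) \<le> (C::real)"
proof
  let ?C = "2 ^ K * (real K ^ K * exp c / c ^ K)"
  have "0 < real K ^ K" by (cases "K = 0") auto
  then show "?C > 0" using assms by simp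
  fix t :: real assume t: "t \<ge> 0"
  let ?x = "c * (1 + t\<^sup>2)"
  have "?x ^ K \<le> real K ^ K * exp ?x" using assms by (intro power_le_exp) auto
  then have "(1 + t\<^sup>2) ^ K \<le> real K ^ K * exp (c * (1 + t\<^sup>2)) / c ^ K"
    using assms by (simp only: power_mult_distrib) (simp add: pos_le_divide_eq mult.commute)
  moreover have "(1 + t) ^ K \<le> (2 * (1 + t\<^sup>2)) ^ K"
  proof (rule power_mono)
    have "0 \<le> t\<^sup>2 + (t - 1)\<^sup>2" by simp
    then show "1 + t \<le> 2 * (1 + t\<^sup>2)" by (simp add: power2_diff) (sos)
  qed (use t in auto)
  ultimately have "(1 + t) ^ K \<le> 2 ^ K * (real K ^ K * exp (c * (1 + t\<^sup>2)) / c ^ K)"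
    unfolding power_mult_distrib by (meson mult_left_mono order_trans zero_le_numeral zero_le_power)
  then have "(1 + t) ^ K * exp (- c * t\<^sup>2) \<le> 2 ^ K * (real K ^ K * exp (c * (1 + t\<^sup>2)) / c ^ K) * exp (- c * t\<^sup>2)"
    by (intro mult_right_mono) auto
  also have "\<dots> = 2 ^ K * (real K ^ K * (exp (c * (1 + t\<^sup>2)) * exp (- c * t\<^sup>2)) / c ^ K)" by simp
  also have "exp (c * (1 + t\<^sup>2)) * exp (- c * t\<^sup>2) = exp c" by (simp add: exp_add[symmetric] algebra_simps)
  finally show "(1 + t) ^ K * exp (- c * t\<^sup>2) \<le> ?C" .
qed

text \<open>
  The gradient and the Hessian are again a polynomial times the Gaussian; all three are dominated by the function
  \<open>B\<close> of the proof, which decays faster than any power. The family is large enough for the heat kernel and its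
  time derivative.
\<close>

lemma tame_gauss:
  fixes a b c \<alpha> :: real
  assumes c: "c > 0" and \<alpha>: "0 < \<alpha>" "\<alpha> < 2"
  shows "\<exists>M>0. tame (wt \<alpha>) M (\<lambda>z::'a::euclidean_space. (a * (norm z)\<^sup>2 + b) * exp (- c * (norm z)\<^sup>2))"
proof -
  let ?E = "\<lambda>z::'a. exp (- c * (norm z)\<^sup>2)"
  let ?P = "\<lambda>z::'a. a - c * (a * (norm z)\<^sup>2 + b)"
  let ?f = "\<lambda>z::'a. (a * (norm z)\<^sup>2 + b) * ?E z"
  let ?D = "\<lambda>z::'a. (2 * ?P z * ?E z) *\<^sub>R z"
  let ?D2 = "\<lambda>z h::'a. (2 * ?P z * ?E z) *\<^sub>R h + (2 * (- (2 * c * a) - 2 * c * ?P z) * ?E z * (z \<bullet> h)) *\<^sub>R z"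
  define A where "A = \<bar>a\<bar> + \<bar>b\<bar> + c * (\<bar>a\<bar> + \<bar>b\<bar>)"
  have A: "A \<ge> 0" using c by (simp add: A_def)
  define B where "B z = (2 * A + 8 * c * A) * ((1 + norm z) ^ 4 * ?E z)" for z :: 'a
  have ns: "((\<lambda>z. (norm z)\<^sup>2) has_derivative (\<lambda>h. 2 * (z \<bullet> h))) (at z)" for z :: 'a
    unfolding power2_norm_eq_inner by (auto intro!: derivative_eq_intros simp: inner_commute)
  have f: "(?f has_derivative (\<lambda>h. ?D z \<bullet> h)) (at z)" for z
    by (auto intro!: derivative_eq_intros ns simp: algebra_simps)
  have D: "(?D has_derivative ?D2 z) (at z)" for z
  proof -
    have "((\<lambda>z. 2 * ?P z * ?E z) has_derivative (\<lambda>h. 2 * (- (2 * c * a) - 2 * c * ?P z) * ?E z * (z \<bullet> h))) (at z)"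
      by (auto intro!: derivative_eq_intros ns simp: algebra_simps)
    from has_derivative_scaleR[OF this has_derivative_ident] show ?thesis by simp
  qed
  have n1: "1 \<le> (1 + norm z) ^ 2" "(norm z)\<^sup>2 \<le> (1 + norm z)\<^sup>2" for z :: 'a
    by (auto intro!: one_le_power power_mono)
  have P: "\<bar>a\<bar> + \<bar>?P z\<bar> \<le> 2 * A * (1 + norm z)\<^sup>2" and Q: "\<bar>a * (norm z)\<^sup>2 + b\<bar> \<le> A * (1 + norm z)\<^sup>2" and P': "\<bar>?P z\<bar> \<le> A * (1 + norm z)\<^sup>2" for z
  proof -
    have "\<bar>a * (norm z)\<^sup>2 + b\<bar> \<le> \<bar>a\<bar> * (norm z)\<^sup>2 + \<bar>b\<bar> * 1" by (simp add: abs_mult abs_triangle_ineq[THEN order_trans])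
    also have "\<dots> \<le> \<bar>a\<bar> * (1 + norm z)\<^sup>2 + \<bar>b\<bar> * (1 + norm z)\<^sup>2" by (intro add_mono mult_left_mono n1) auto
    finally have q: "\<bar>a * (norm z)\<^sup>2 + b\<bar> \<le> (\<bar>a\<bar> + \<bar>b\<bar>) * (1 + norm z)\<^sup>2" by (simp add: algebra_simps)
    also have "\<dots> \<le> A * (1 + norm z)\<^sup>2" using c by (intro mult_right_mono) (auto simp: A_def)
    finally show "\<bar>a * (norm z)\<^sup>2 + b\<bar> \<le> A * (1 + norm z)\<^sup>2" .
    have "c * \<bar>a * (norm z)\<^sup>2 + b\<bar> \<le> c * ((\<bar>a\<bar> + \<bar>b\<bar>) * (1 + norm z)\<^sup>2)" using c q by (intro mult_left_mono) auto
    moreover have "\<bar>?P z\<bar> \<le> \<bar>a\<bar> + c * \<bar>a * (norm z)\<^sup>2 + b\<bar>"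
      using c abs_triangle_ineq4[of a "c * (a * (norm z)\<^sup>2 + b)"] by (simp add: abs_mult)
    moreover have "\<bar>a\<bar> * 1 \<le> \<bar>a\<bar> * (1 + norm z)\<^sup>2" by (intro mult_left_mono n1) auto
    moreover have "0 \<le> \<bar>b\<bar> * (1 + norm z)\<^sup>2" by simp
    moreover have "A * (1 + norm z)\<^sup>2 = \<bar>a\<bar> * (1 + norm z)\<^sup>2 + \<bar>b\<bar> * (1 + norm z)\<^sup>2 + c * ((\<bar>a\<bar> + \<bar>b\<bar>) * (1 + norm z)\<^sup>2)"
      by (simp add: A_def algebra_simps)
    ultimately show P': "\<bar>?P z\<bar> \<le> A * (1 + norm z)\<^sup>2" by linarith
    have "\<bar>a\<bar> * (1 + norm z)\<^sup>2 \<le> A * (1 + norm z)\<^sup>2" using c by (intro mult_right_mono) (auto simp: A_def)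
    then show "\<bar>a\<bar> + \<bar>?P z\<bar> \<le> 2 * A * (1 + norm z)\<^sup>2" using P' \<open>\<bar>a\<bar> * 1 \<le> \<bar>a\<bar> * (1 + norm z)\<^sup>2\<close> by (simp add: algebra_simps)
  qed
  have p4: "(1 + norm z)\<^sup>2 * (1 + norm z)\<^sup>2 = (1 + norm z) ^ 4" for z :: 'a by (simp flip: power_add)
  have p24: "(1 + norm z)\<^sup>2 \<le> (1 + norm z) ^ 4" for z :: 'a by (intro power_increasing) auto
  have p34: "(1 + norm z)\<^sup>2 * norm z \<le> (1 + norm z) ^ 4" for z :: 'a
  proof -
    have "norm z \<le> (1 + norm z)\<^sup>2" by (simp add: power2_eq_square algebra_simps)
    then have "(1 + norm z)\<^sup>2 * norm z \<le> (1 + norm z)\<^sup>2 * (1 + norm z)\<^sup>2" by (intro mult_left_mono) auto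
    then show ?thesis by (simp only: p4)
  qed
  have fB: "\<bar>?f z\<bar> \<le> B z" for z
  proof -
    have "\<bar>?f z\<bar> \<le> (A * (1 + norm z)\<^sup>2) * ?E z" unfolding abs_mult by (intro mult_mono Q) (auto simp: A)
    also have "\<dots> \<le> A * ((1 + norm z) ^ 4 * ?E z)" unfolding mult.assoc by (intro mult_left_mono mult_right_mono p24 A) auto
    also have "\<dots> \<le> B z" unfolding B_def using A c by (intro mult_right_mono) auto
    finally show ?thesis .
  qed
  have DB: "norm (?D z) \<le> B z" for z
  proof -
    have "norm (?D z) = 2 * (\<bar>?P z\<bar> * norm z) * ?E z" by (simp only: norm_scaleR abs_mult) simp
    also have "\<dots> \<le> 2 * ((A * (1 + norm z)\<^sup>2) * norm z) * ?E z" by (intro mult_mono mult_left_mono P' mult_nonneg_nonneg A) (auto simp: A)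
    also have "\<dots> = 2 * A * (((1 + norm z)\<^sup>2 * norm z) * ?E z)" by simp
    also have "\<dots> \<le> 2 * A * ((1 + norm z) ^ 4 * ?E z)" using A by (intro mult_left_mono mult_right_mono p34) auto
    also have "\<dots> \<le> B z" unfolding B_def using A c by (intro mult_right_mono) auto
    finally show ?thesis .
  qed
  have D2B: "norm (?D2 z h) \<le> B z * norm h" for z h
  proof -
    have "norm ((2 * ?P z * ?E z) *\<^sub>R h) = 2 * (\<bar>?P z\<bar> * ?E z) * norm h" by (simp only: norm_scaleR abs_mult) simp
    also have "\<dots> \<le> 2 * ((A * (1 + norm z)\<^sup>2) * ?E z) * norm h" by (intro mult_right_mono mult_left_mono P') auto
    also have "\<dots> \<le> 2 * ((A * (1 + norm z) ^ 4) * ?E z) * norm h" by (intro mult_right_mono mult_left_mono p24 A) auto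
    finally have 1: "norm ((2 * ?P z * ?E z) *\<^sub>R h) \<le> 2 * A * ((1 + norm z) ^ 4 * ?E z) * norm h" by (simp add: mult_ac)
    have e: "\<bar>- (2 * c * a) - 2 * c * ?P z\<bar> \<le> 2 * c * (\<bar>a\<bar> + \<bar>?P z\<bar>)"
    proof -
      have "- (2 * c * a) - 2 * c * ?P z = - (2 * c * (a + ?P z))" by (simp add: algebra_simps)
      then have "\<bar>- (2 * c * a) - 2 * c * ?P z\<bar> = 2 * c * \<bar>a + ?P z\<bar>" using c by (simp add: abs_mult)
      then show ?thesis using c by (simp only:) (intro mult_left_mono abs_triangle_ineq, simp)
    qed
    have e2: "\<bar>- (2 * c * a) - 2 * c * ?P z\<bar> \<le> 4 * c * A * (1 + norm z)\<^sup>2"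
      using order_trans[OF e mult_left_mono[OF P[of z], of "2 * c"]] c by (simp add: mult_ac)
    have zh: "\<bar>z \<bullet> h\<bar> * norm z \<le> (1 + norm z)\<^sup>2 * norm h"
    proof -
      have "\<bar>z \<bullet> h\<bar> * norm z \<le> (norm z * norm h) * norm z" by (intro mult_right_mono Cauchy_Schwarz_ineq2) auto
      also have "\<dots> = (norm z)\<^sup>2 * norm h" by (simp add: power2_eq_square)
      also have "\<dots> \<le> (1 + norm z)\<^sup>2 * norm h" by (intro mult_right_mono n1) auto
      finally show ?thesis .
    qed
    have "norm ((2 * (- (2 * c * a) - 2 * c * ?P z) * ?E z * (z \<bullet> h)) *\<^sub>R z) = 2 * \<bar>- (2 * c * a) - 2 * c * ?P z\<bar> * ?E z * (\<bar>z \<bullet> h\<bar> * norm z)"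
      by (simp only: norm_scaleR abs_mult) simp
    also have "\<dots> \<le> 2 * (4 * c * A * (1 + norm z)\<^sup>2) * ?E z * ((1 + norm z)\<^sup>2 * norm h)"
      using A c by (intro mult_mono mult_right_mono mult_left_mono e2 zh) auto
    also have "\<dots> = 8 * c * A * (((1 + norm z)\<^sup>2 * (1 + norm z)\<^sup>2) * ?E z) * norm h" by simp
    finally have 2: "norm ((2 * (- (2 * c * a) - 2 * c * ?P z) * ?E z * (z \<bullet> h)) *\<^sub>R z) \<le> 8 * c * A * ((1 + norm z) ^ 4 * ?E z) * norm h" unfolding p4 .
    have "norm (?D2 z h) \<le> 2 * A * ((1 + norm z) ^ 4 * ?E z) * norm h + 8 * c * A * ((1 + norm z) ^ 4 * ?E z) * norm h"
      using 1 2 by (rule norm_add_rule_thm)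
    then show ?thesis unfolding B_def by (simp add: algebra_simps)
  qed
  obtain C where C: "C > 0" "\<And>t. t \<ge> 0 \<Longrightarrow> (1 + t) ^ (4 + (DIM('a) + 2)) * exp (- c * t\<^sup>2) \<le> C"
    using poly_gauss_bounded[OF c] by blast
  have BW: "B z \<le> ((2 * A + 8 * c * A) * C) * wt \<alpha> z" for z
  proof -
    have pos: "0 < (1 + norm z) ^ (DIM('a) + 2)" by (intro zero_less_power) (use norm_ge_zero[of z] in linarith)
    have "(1 + norm z) ^ 4 * ?E z * (1 + norm z) ^ (DIM('a) + 2) \<le> C"
      using C(2)[OF norm_ge_zero[of z]] by (simp only: power_add[of _ 4 "DIM('a) + 2"] mult_ac)
    then have "(1 + norm z) ^ 4 * ?E z \<le> C * (1 / (1 + norm z) ^ (DIM('a) + 2))"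
      using pos by (simp add: pos_le_divide_eq)
    also have "\<dots> \<le> C * wt \<alpha> z" using C(1) by (intro mult_left_mono inverse_power_le_wt \<alpha>) auto
    finally show ?thesis unfolding B_def mult.assoc using A c by (intro mult_left_mono) auto
  qed
  let ?q = "2 powr (real DIM('a) + \<alpha>)"
  define M where "M = ((2 * A + 8 * c * A) * C) * ?q + 1"
  have cc: "0 \<le> (2 * A + 8 * c * A) * C" using A c C by simp
  have q1: "1 \<le> ?q" using \<alpha> by (intro ge_one_powr_ge_zero) auto
  have BM: "B z \<le> M * wt \<alpha> x" if "norm (z - x) \<le> 1" for z x
  proof -
    have "B z \<le> ((2 * A + 8 * c * A) * C) * (?q * wt \<alpha> x)"
      using BW[of z] mult_left_mono[OF wt_near[OF \<alpha> that] cc] by linarith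
    also have "\<dots> \<le> M * wt \<alpha> x" unfolding M_def mult.assoc[symmetric] by (intro mult_right_mono) (auto simp: wt_nonneg[OF \<alpha>])
    finally show ?thesis .
  qed
  have "tame (wt \<alpha>) M ?f"
    by (rule tame_of_derivatives[OF f D D2B order_trans[OF fB BM] order_trans[OF DB BM] BM]) auto
  moreover have "M > 0" unfolding M_def by (rule add_nonneg_pos[OF mult_nonneg_nonneg[OF cc]]) auto
  ultimately show ?thesis by blast
qed

section \<open>Smooth functions\<close>

text \<open>
  The functions \<open>t^(-k) e^(-1/t)\<close>, extended by \<open>0\<close>. The family over all \<open>k\<close> is closed under differentiation up to linear
  combinations, which makes compactly supported bumps smooth.
\<close>

definition flat_exp :: "nat \<Rightarrow> real \<Rightarrow> real" where
  "flat_exp k t = (if t \<le> 0 then 0 else (1 / t) ^ k * exp (- (1 / t)))"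

lemma flat_exp_le: "\<bar>flat_exp k t\<bar> \<le> real (k + 2) ^ (k + 2) * t\<^sup>2"
proof (cases "t \<le> 0")
  case False
  have "(1 / t) ^ k * exp (- (1 / t)) = ((1 / t) ^ (k + 2) * exp (- (1 / t))) * t\<^sup>2"
    using False by (simp add: power_add power2_eq_square)
  also have "(1 / t) ^ (k + 2) * exp (- (1 / t)) \<le> (real (k + 2) ^ (k + 2) * exp (1 / t)) * exp (- (1 / t))"
    using False by (intro mult_right_mono power_le_exp) auto
  also have "\<dots> = real (k + 2) ^ (k + 2)" by (simp add: exp_minus)
  finally show ?thesis using False by (simp add: flat_exp_def mult_right_mono)
qed (simp add: flat_exp_def)

text \<open>
  The only delicate point is \<open>t = 0\<close>, where \<open>flat_exp_le\<close> makes the difference quotient \<open>O(|t|)\<close>.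
\<close>

lemma flat_exp_deriv:
  "(flat_exp k has_field_derivative (- real k * flat_exp (Suc k) t + flat_exp (k + 2) t)) (at t)"
proof -
  consider "t < 0" | "t > 0" | "t = 0" by linarith
  then show ?thesis
  proof cases
    case 1
    have "((\<lambda>_. 0) has_field_derivative 0) (at t)" by simp
    then have "(flat_exp k has_field_derivative 0) (at t)"
      by (rule has_field_derivative_transform_within_open[of _ _ _ "{..<0}"]) (use 1 in \<open>auto simp: flat_exp_def\<close>)
    then show ?thesis using 1 by (simp add: flat_exp_def)
  next
    case 2
    have "((\<lambda>t. inverse t ^ k * exp (- inverse t)) has_field_derivative
        (- real k * (inverse t ^ Suc k * exp (- inverse t)) + inverse t ^ (k + 2) * exp (- inverse t))) (at t)"
    proof -
      have p: "((\<lambda>t. inverse t ^ k) has_field_derivative (- real k * inverse t ^ Suc k)) (at t)"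
      proof (cases k)
        case (Suc j)
        have "(inverse has_field_derivative - (inverse t)\<^sup>2) (at t)"
          using DERIV_inverse[of t] 2 by (simp add: numeral_2_eq_2)
        from DERIV_power_Suc[OF this, of j] show ?thesis unfolding Suc
          by (rule DERIV_cong) (simp add: power2_eq_square algebra_simps)
      qed simp
      have e: "((\<lambda>t. exp (- inverse t)) has_field_derivative exp (- inverse t) * (inverse t)\<^sup>2) (at t)"
        using 2 by (auto intro!: derivative_eq_intros simp: power2_eq_square)
      show ?thesis
        by (rule DERIV_cong[OF DERIV_mult[OF p e]]) (simp add: power_add power2_eq_square algebra_simps)
    qed
    then have "(flat_exp k has_field_derivative
        (- real k * (inverse t ^ Suc k * exp (- inverse t)) + inverse t ^ (k + 2) * exp (- inverse t))) (at t)"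
      by (rule has_field_derivative_transform_within_open[of _ _ _ "{0<..}"])
        (use 2 in \<open>auto simp: flat_exp_def inverse_eq_divide\<close>)
    then show ?thesis using 2 by (simp add: flat_exp_def inverse_eq_divide)
  next
    case 3
    let ?C = "real (k + 2) ^ (k + 2)"
    have "((\<lambda>h. (flat_exp k (0 + h) - flat_exp k 0) / h) \<longlongrightarrow> 0) (at 0)"
    proof (rule Lim_null_comparison)
      show "\<forall>\<^sub>F h in at 0. norm ((flat_exp k (0 + h) - flat_exp k 0) / h) \<le> ?C * \<bar>h\<bar>"
        unfolding eventually_at
      proof (intro exI[of _ 1] conjI ballI impI)
        fix h :: real assume "h \<noteq> 0 \<and> dist h 0 < 1"
        then have h: "\<bar>h\<bar> > 0" by simp
        have "\<bar>flat_exp k h\<bar> \<le> (?C * \<bar>h\<bar>) * \<bar>h\<bar>"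
          using flat_exp_le[of k h] by (simp only: mult.assoc abs_mult_self_eq power2_eq_square)
        then have "\<bar>flat_exp k h\<bar> / \<bar>h\<bar> \<le> ?C * \<bar>h\<bar>" using h by (simp only: pos_divide_le_eq)
        then show "norm ((flat_exp k (0 + h) - flat_exp k 0) / h) \<le> ?C * \<bar>h\<bar>"
          by (simp add: flat_exp_def)
      qed simp
      show "((\<lambda>h. ?C * \<bar>h\<bar>) \<longlongrightarrow> 0) (at (0::real))" by (intro tendsto_eq_intros) auto
    qed
    then have "(flat_exp k has_field_derivative 0) (at 0)" by (simp add: DERIV_def)
    then show ?thesis using 3 by (simp add: flat_exp_def)
  qed
qed

text \<open>
  A class of functions that is closed under partial derivatives by construction, so that its members are smooth.
  It contains bumps, Gaussians and their products with polynomials.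
\<close>

inductive_set elementary :: "('a::euclidean_space \<Rightarrow> real) set" where
  const: "(\<lambda>_. c) \<in> elementary"
| coord: "(\<lambda>x. x \<bullet> b) \<in> elementary"
| add: "f \<in> elementary \<Longrightarrow> g \<in> elementary \<Longrightarrow> (\<lambda>x. f x + g x) \<in> elementary"
| mult: "f \<in> elementary \<Longrightarrow> g \<in> elementary \<Longrightarrow> (\<lambda>x. f x * g x) \<in> elementary"
| exp: "f \<in> elementary \<Longrightarrow> (\<lambda>x. exp (f x)) \<in> elementary"
| flat: "f \<in> elementary \<Longrightarrow> (\<lambda>x. flat_exp k (f x)) \<in> elementary"

lemma elementary_closed_under_derivatives:
  assumes "f \<in> elementary"
  shows "\<exists>f'. (\<forall>x. (f has_derivative f' x) (at x)) \<and> (\<forall>b. (\<lambda>x. f' x b) \<in> elementary)"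
  using assms
proof induction
  case (const c)
  show ?case by (intro exI[of _ "\<lambda>_ _. 0"]) (auto intro: elementary.const)
next
  case (coord b)
  show ?case
    by (intro exI[of _ "\<lambda>_ h. h \<bullet> b"]) (auto intro: elementary.const derivative_eq_intros)
next
  case (add f g)
  then obtain f' g' where "\<forall>x. (f has_derivative f' x) (at x)" "\<forall>b. (\<lambda>x. f' x b) \<in> elementary"
    "\<forall>x. (g has_derivative g' x) (at x)" "\<forall>b. (\<lambda>x. g' x b) \<in> elementary" by blast
  then show ?case
    by (intro exI[of _ "\<lambda>x h. f' x h + g' x h"]) (auto intro: elementary.add has_derivative_add)
next
  case (mult f g)
  then obtain f' g' where "\<forall>x. (f has_derivative f' x) (at x)" "\<forall>b. (\<lambda>x. f' x b) \<in> elementary"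
    "\<forall>x. (g has_derivative g' x) (at x)" "\<forall>b. (\<lambda>x. g' x b) \<in> elementary" by blast
  with mult.hyps show ?case
    by (intro exI[of _ "\<lambda>x h. f x * g' x h + f' x h * g x"] conjI allI elementary.add elementary.mult has_derivative_mult) auto
next
  case (exp f)
  then obtain f' where "\<forall>x. (f has_derivative f' x) (at x)" "\<forall>b. (\<lambda>x. f' x b) \<in> elementary" by blast
  with exp.hyps show ?case
    by (intro exI[of _ "\<lambda>x h. exp (f x) * f' x h"] conjI allI elementary.mult elementary.exp
        has_derivative_compose[OF _ DERIV_exp[unfolded has_field_derivative_def]]) auto
next
  case (flat f k)
  then obtain f' where f': "\<forall>x. (f has_derivative f' x) (at x)" "\<forall>b. (\<lambda>x. f' x b) \<in> elementary" by blast
  show ?case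
  proof (intro exI[of _ "\<lambda>x h. (- real k * flat_exp (Suc k) (f x) + flat_exp (k + 2) (f x)) * f' x h"] conjI allI)
    show "((\<lambda>x. flat_exp k (f x)) has_derivative (\<lambda>h. (- real k * flat_exp (Suc k) (f x) + flat_exp (k + 2) (f x)) * f' x h)) (at x)" for x
      using has_derivative_compose[OF f'(1)[rule_format] flat_exp_deriv[unfolded has_field_derivative_def]] .
    show "(\<lambda>x. (- real k * flat_exp (Suc k) (f x) + flat_exp (k + 2) (f x)) * f' x b) \<in> elementary" for b
      using f'(2) flat.hyps by (intro elementary.mult elementary.add elementary.const elementary.flat) auto
  qed
qed

lemma elementary_iter_partial:
  assumes "f \<in> elementary" shows "iter_partial bs f \<in> elementary"
proof (induction bs)
  case (Cons b bs)
  then obtain f' where f': "\<And>x. (iter_partial bs f has_derivative f' x) (at x)" "\<And>b. (\<lambda>x. f' x b) \<in> elementary"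
    using elementary_closed_under_derivatives by metis
  have "frechet_derivative (iter_partial bs f) (at x) = f' x" for x
    using frechet_derivative_at[OF f'(1)] by simp
  then show ?case using f'(2) by simp
qed (use assms in simp)

lemma elementary_smooth:
  assumes "f \<in> elementary" shows "smooth f"
  unfolding smooth_def
proof (intro ballI allI)
  fix bs x
  show "iter_partial bs f differentiable at x"
    using elementary_closed_under_derivatives[OF elementary_iter_partial[OF assms, of bs]]
    unfolding differentiable_def by blast
qed

lemma elementary_norm_diff: "(\<lambda>x. (norm (x - a))\<^sup>2) \<in> elementary"
proof -
  have s: "(\<lambda>x::'a. \<Sum>b\<in>A. (x \<bullet> b + (- (a \<bullet> b))) * (x \<bullet> b + (- (a \<bullet> b)))) \<in> elementary" if "finite A" for A
    using that
  proof induction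
    case (insert b A)
    then show ?case
      by (simp only: sum.insert[OF insert.hyps(1,2)]) (intro elementary.add elementary.mult elementary.coord elementary.const)
  qed (auto intro: elementary.const)
  have "(norm (x - a))\<^sup>2 = (\<Sum>b\<in>Basis. (x \<bullet> b + (- (a \<bullet> b))) * (x \<bullet> b + (- (a \<bullet> b))))" for x
    unfolding power2_norm_eq_inner euclidean_inner[of "x - a" "x - a"] by (simp add: inner_diff_left)
  then show ?thesis using s[OF finite_Basis] by simp
qed

text \<open>
  The factor \<open>e\<close> normalizes the value at the origin to \<open>1\<close>, so that dilated bumps converge to \<open>1\<close>.
\<close>

definition bump :: "'a::euclidean_space \<Rightarrow> real" where
  "bump x = exp 1 * flat_exp 0 (1 - (norm x)\<^sup>2)"

lemma bump_dilate_elementary: "(\<lambda>x::'a::euclidean_space. bump (x /\<^sub>R R)) \<in> elementary"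
proof -
  have "(\<lambda>x::'a. exp 1 * flat_exp 0 (1 + (- (inverse R)\<^sup>2) * (norm (x - 0))\<^sup>2)) \<in> elementary"
    by (intro elementary.mult elementary.const elementary.flat elementary.add elementary_norm_diff)
  then show ?thesis by (simp only: bump_def norm_scaleR power_mult_distrib power2_abs) simp
qed

lemma bump_nonneg: "0 \<le> bump x"
  by (simp add: bump_def flat_exp_def)

lemma bump_zero: "bump 0 = 1"
  by (simp add: bump_def flat_exp_def exp_add[symmetric])

lemma bump_support: "norm x \<ge> 1 \<Longrightarrow> bump x = 0"
  by (simp add: bump_def flat_exp_def one_le_power)

lemma test_function_criterion:
  fixes f :: "'a::euclidean_space \<Rightarrow> real"
  assumes "f \<in> elementary" "\<And>x. norm x > R \<Longrightarrow> f x = 0"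
  shows "f \<in> test_functions"
proof -
  have "{x. f x \<noteq> 0} \<subseteq> cball 0 R" using assms(2) by (force simp: not_less[symmetric])
  then have "bounded {x. f x \<noteq> 0}" by (rule bounded_subset[OF bounded_cball])
  then show ?thesis using elementary_smooth[OF assms(1)] by (simp add: test_functions_def compact_closure)
qed

text \<open>
  Derivatives vanish outside the support, and a continuous function is bounded on a compact set.
\<close>

lemma test_functions_subset_schwartz: "test_functions \<subseteq> schwartz"
proof
  fix \<phi> :: "'a \<Rightarrow> real" assume \<phi>: "\<phi> \<in> test_functions"
  then have sm: "smooth \<phi>" and K: "compact (closure {x. \<phi> x \<noteq> 0})" by (auto simp: test_functions_def)
  let ?K = "closure {x. \<phi> x \<noteq> 0}"
  have z: "\<forall>x. x \<notin> ?K \<longrightarrow> iter_partial bs \<phi> x = 0" for bs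
  proof (induction bs)
    case Nil
    then show ?case using closure_subset[of "{x. \<phi> x \<noteq> 0}"] by auto
  next
    case (Cons b bs)
    show ?case
    proof (intro allI impI)
      fix x assume x: "x \<notin> ?K"
      have "((\<lambda>_. 0::real) has_derivative (\<lambda>_. 0)) (at x)" by simp
      then have "(iter_partial bs \<phi> has_derivative (\<lambda>_. 0)) (at x)"
        by (rule has_derivative_transform_within_open[of _ _ _ _ "- ?K"]) (use x Cons in \<open>simp_all add: open_Compl\<close>)
      then have "frechet_derivative (iter_partial bs \<phi>) (at x) = (\<lambda>_. 0)" using frechet_derivative_at by metis
      then show "iter_partial (b # bs) \<phi> x = 0" by simp
    qed
  qed
  have "bounded (range (\<lambda>x. norm x ^ k * iter_partial bs \<phi> x))" if "bs \<in> lists Basis" for bs k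
  proof -
    have "continuous_on ?K (iter_partial bs \<phi>)"
      using sm that unfolding smooth_def
      by (intro continuous_at_imp_continuous_on) (auto intro: differentiable_imp_continuous_within)
    then have "compact ((\<lambda>x. norm x ^ k * iter_partial bs \<phi> x) ` ?K)"
      by (intro compact_continuous_image K continuous_intros)
    then have "bounded (insert 0 ((\<lambda>x. norm x ^ k * iter_partial bs \<phi> x) ` ?K))"
      by (simp add: compact_imp_bounded)
    then show ?thesis
    proof (rule bounded_subset, intro image_subsetI)
      fix x
      show "norm x ^ k * iter_partial bs \<phi> x \<in> insert 0 ((\<lambda>x. norm x ^ k * iter_partial bs \<phi> x) ` ?K)"
        using z[of bs] by (cases "x \<in> ?K") simp_all
    qed
  qed
  then show "\<phi> \<in> schwartz" using sm by (simp add: schwartz_def)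
qed

lemma schwartz_decay:
  fixes \<phi> :: "'a::euclidean_space \<Rightarrow> real"
  assumes "\<phi> \<in> schwartz" "bs \<in> lists Basis" "0 < \<alpha>" "\<alpha> < 2"
  shows "\<exists>C\<ge>0. \<forall>x. \<bar>iter_partial bs \<phi> x\<bar> \<le> C * wt \<alpha> x"
proof -
  let ?N = "DIM('a) + 2"
  have bd: "\<exists>B. \<forall>x. \<bar>norm x ^ k * iter_partial bs \<phi> x\<bar> \<le> B" for k
  proof -
    have "bounded (range (\<lambda>x. norm x ^ k * iter_partial bs \<phi> x))" using assms(1,2) by (simp add: schwartz_def)
    then show ?thesis by (auto simp: bounded_iff)
  qed
  obtain B0 BN where B0: "\<And>x. \<bar>norm x ^ 0 * iter_partial bs \<phi> x\<bar> \<le> B0" and BN: "\<And>x. \<bar>norm x ^ ?N * iter_partial bs \<phi> x\<bar> \<le> BN"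
    using bd by metis
  let ?C = "2 ^ ?N * (B0 + BN)"
  have C: "?C \<ge> 0" using B0[of 0] BN[of 0] by (intro mult_nonneg_nonneg) auto
  have div: "a \<le> d * (1 / p)" if "p * a \<le> d" "0 < p" for a d p :: real
    using that by (simp add: pos_le_divide_eq mult.commute)
  have "\<bar>iter_partial bs \<phi> x\<bar> \<le> ?C * wt \<alpha> x" for x
  proof -
    have "(1 + norm x) ^ ?N \<le> 2 ^ ?N * (1 + norm x ^ ?N)"
    proof (cases "norm x \<le> 1")
      case True
      then have "(1 + norm x) ^ ?N \<le> 2 ^ ?N * 1" by (simp only: mult_1_right, intro power_mono) auto
      also have "\<dots> \<le> 2 ^ ?N * (1 + norm x ^ ?N)" by (intro mult_left_mono) auto
      finally show ?thesis .
    next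
      case False
      then have "(1 + norm x) ^ ?N \<le> (2 * norm x) ^ ?N" by (intro power_mono) auto
      also have "\<dots> = 2 ^ ?N * norm x ^ ?N" by (rule power_mult_distrib)
      also have "\<dots> \<le> 2 ^ ?N * (1 + norm x ^ ?N)" by (intro mult_left_mono) auto
      finally show ?thesis .
    qed
    then have "(1 + norm x) ^ ?N * \<bar>iter_partial bs \<phi> x\<bar> \<le> 2 ^ ?N * (1 + norm x ^ ?N) * \<bar>iter_partial bs \<phi> x\<bar>"
      by (intro mult_right_mono) auto
    also have "\<dots> = 2 ^ ?N * (\<bar>norm x ^ 0 * iter_partial bs \<phi> x\<bar> + \<bar>norm x ^ ?N * iter_partial bs \<phi> x\<bar>)"
      by (simp add: abs_mult algebra_simps)
    also have "\<dots> \<le> ?C" by (intro mult_left_mono add_mono B0 BN) auto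
    finally have "(1 + norm x) ^ ?N * \<bar>iter_partial bs \<phi> x\<bar> \<le> ?C" .
    moreover have "0 < (1 + norm x) ^ ?N" by (intro zero_less_power) (use norm_ge_zero[of x] in linarith)
    ultimately have "\<bar>iter_partial bs \<phi> x\<bar> \<le> ?C * (1 / (1 + norm x) ^ ?N)"
      by (rule div)
    also have "\<dots> \<le> ?C * wt \<alpha> x" using C by (intro mult_left_mono inverse_power_le_wt assms)
    finally show ?thesis .
  qed
  then show ?thesis using C by blast
qed

text \<open>
  Gradient and Hessian are assembled from the first and second iterated partial derivatives.
\<close>

lemma schwartz_tame:
  fixes \<phi> :: "'a::euclidean_space \<Rightarrow> real"
  assumes \<phi>: "\<phi> \<in> schwartz" and \<alpha>: "0 < \<alpha>" "\<alpha> < 2"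
  shows "\<exists>M. tame (wt \<alpha>) M \<phi>"
proof -
  have "\<forall>bs\<in>lists Basis. \<exists>C\<ge>0. \<forall>x. \<bar>iter_partial bs \<phi> x\<bar> \<le> C * wt \<alpha> x"
    using schwartz_decay[OF \<phi> _ \<alpha>] by blast
  then obtain C where C: "\<And>bs x. bs \<in> lists Basis \<Longrightarrow> \<bar>iter_partial bs \<phi> x\<bar> \<le> C bs * wt \<alpha> x" "\<And>bs. bs \<in> lists Basis \<Longrightarrow> C bs \<ge> 0"
    by metis
  have dif: "iter_partial bs \<phi> differentiable (at x)" if "bs \<in> lists Basis" for bs x
    using \<phi> that by (auto simp: schwartz_def smooth_def)
  have der: "(iter_partial bs \<phi> has_derivative (\<lambda>h. \<Sum>b\<in>Basis. (h \<bullet> b) * iter_partial (b # bs) \<phi> x)) (at x)" if "bs \<in> lists Basis" for bs x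
  proof -
    let ?L = "frechet_derivative (iter_partial bs \<phi>) (at x)"
    have L: "(iter_partial bs \<phi> has_derivative ?L) (at x)" using dif[OF that] by (simp add: frechet_derivative_works)
    then have lin: "linear ?L" by (rule has_derivative_linear)
    have "?L h = (\<Sum>b\<in>Basis. (h \<bullet> b) * iter_partial (b # bs) \<phi> x)" for h
    proof -
      have "?L h = ?L (\<Sum>b\<in>Basis. (h \<bullet> b) *\<^sub>R b)" by (simp add: euclidean_representation)
      also have "\<dots> = (\<Sum>b\<in>Basis. (h \<bullet> b) * ?L b)" by (simp add: linear_sum[OF lin] linear_scale[OF lin])
      finally show ?thesis by (simp only: iter_partial.simps)
    qed
    then have "?L = (\<lambda>h. \<Sum>b\<in>Basis. (h \<bullet> b) * iter_partial (b # bs) \<phi> x)" by (rule ext)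
    with L show ?thesis by (rule subst[rotated])
  qed
  let ?D = "\<lambda>x. \<Sum>b\<in>Basis. iter_partial [b] \<phi> x *\<^sub>R b"
  let ?D2 = "\<lambda>x h. \<Sum>b\<in>Basis. (\<Sum>c\<in>Basis. (h \<bullet> c) * iter_partial [c, b] \<phi> x) *\<^sub>R b"
  have l: "[b] \<in> lists Basis" "[c, b] \<in> lists Basis" "[] \<in> lists Basis" if "b \<in> Basis" "c \<in> Basis" for b c :: 'a using that by auto
  have l0: "[] \<in> lists (Basis::'a set)" by simp
  have f: "(\<phi> has_derivative (\<lambda>h. ?D x \<bullet> h)) (at x)" for x
  proof -
    have "?D x \<bullet> h = (\<Sum>b\<in>Basis. (h \<bullet> b) * iter_partial [b] \<phi> x)" for h
      by (simp add: inner_sum_left inner_commute[of h] mult.commute)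
    then show ?thesis using der[OF l0, of x] by simp
  qed
  have D: "(?D has_derivative ?D2 x) (at x)" for x
    by (rule has_derivative_sum, rule has_derivative_scaleR_left, rule der) simp
  let ?C1 = "\<Sum>b\<in>Basis. C [b::'a]"
  let ?C2 = "\<Sum>b\<in>Basis. \<Sum>c\<in>Basis. C [c, b::'a]"
  have C1: "0 \<le> ?C1" and C2: "0 \<le> ?C2" using C(2) by (auto intro!: sum_nonneg)
  have C0: "0 \<le> C []" using C(2)[OF l0] .
  have D1: "norm (?D x) \<le> ?C1 * wt \<alpha> x" for x
    unfolding sum_distrib_right
  proof (rule sum_norm_le)
    fix b :: 'a assume b: "b \<in> Basis"
    show "norm (iter_partial [b] \<phi> x *\<^sub>R b) \<le> C [b] * wt \<alpha> x"
      using C(1)[OF l(1)[OF b b], of x] b by (simp del: iter_partial.simps)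
  qed
  have D2: "norm (?D2 x h) \<le> (?C2 * wt \<alpha> x) * norm h" for x h
    unfolding sum_distrib_right
  proof (rule sum_norm_le)
    fix b :: 'a assume b: "b \<in> Basis"
    have "norm ((\<Sum>c\<in>Basis. (h \<bullet> c) * iter_partial [c, b] \<phi> x) *\<^sub>R b) = norm (\<Sum>c\<in>Basis. (h \<bullet> c) * iter_partial [c, b] \<phi> x)"
      using b by simp
    also have "\<dots> \<le> (\<Sum>c\<in>Basis. C [c, b] * wt \<alpha> x * norm h)"
    proof (rule sum_norm_le)
      fix c :: 'a assume c: "c \<in> Basis"
      have "\<bar>h \<bullet> c\<bar> * \<bar>iter_partial [c, b] \<phi> x\<bar> \<le> norm h * (C [c, b] * wt \<alpha> x)"
        using C(1)[OF l(2)[OF b c]] Basis_le_norm[OF c, of h] by (intro mult_mono) auto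
      then show "norm ((h \<bullet> c) * iter_partial [c, b] \<phi> x) \<le> C [c, b] * wt \<alpha> x * norm h"
        unfolding real_norm_def abs_mult by (simp only: mult_ac)
    qed
    finally show "norm ((\<Sum>c\<in>Basis. (h \<bullet> c) * iter_partial [c, b] \<phi> x) *\<^sub>R b) \<le> (\<Sum>c\<in>Basis. C [c, b] * wt \<alpha> x * norm h)" .
  qed
  let ?q = "2 powr (real DIM('a) + \<alpha>)"
  let ?M = "C [] + ?C1 + ?C2 * ?q"
  have "tame (wt \<alpha>) ?M \<phi>"
  proof (rule tame_of_derivatives[OF f D D2])
    fix x :: 'a
    have q: "0 \<le> ?C2 * ?q" using C2 by simp
    have w: "0 \<le> wt \<alpha> x" by (rule wt_nonneg[OF \<alpha>])
    have "C [] * wt \<alpha> x \<le> ?M * wt \<alpha> x" using C1 q w by (intro mult_right_mono) linarith+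
    then show "\<bar>\<phi> x\<bar> \<le> ?M * wt \<alpha> x" using C(1)[OF l0, of x] by simp
    have "?C1 * wt \<alpha> x \<le> ?M * wt \<alpha> x" using C0 q w by (intro mult_right_mono) linarith+
    then show "norm (?D x) \<le> ?M * wt \<alpha> x" using D1[of x] by linarith
    fix z :: 'a assume "norm (z - x) \<le> 1"
    then have "?C2 * wt \<alpha> z \<le> ?C2 * (?q * wt \<alpha> x)" by (intro mult_left_mono wt_near \<alpha> C2)
    also have "\<dots> = (?C2 * ?q) * wt \<alpha> x" by simp
    also have "\<dots> \<le> ?M * wt \<alpha> x" using C0 C1 w by (intro mult_right_mono) linarith+
    finally show "?C2 * wt \<alpha> z \<le> ?M * wt \<alpha> x" .
  qed
  then show ?thesis by blast
qed

lemma bump_test_function: "bump \<in> test_functions"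
proof (rule test_function_criterion[of _ 1])
  show "bump \<in> elementary" using bump_dilate_elementary[of 1] by simp
qed (simp add: bump_support)

lemma bump_tame_one: "\<exists>A. tame (\<lambda>_::'a::euclidean_space. 1) A bump"
proof -
  obtain M where M: "tame (wt 1) M (bump :: 'a \<Rightarrow> real)"
    using schwartz_tame[of bump 1] bump_test_function test_functions_subset_schwartz by auto
  have "M \<ge> 0" using tame_nonneg[OF M, of 0] wt_pos[of 1 "0::'a"] by (simp add: zero_le_mult_iff)
  then have "tame (\<lambda>_. 1) M (bump :: 'a \<Rightarrow> real)"
    using wt_le_1[of 1] by (intro tame_mono[OF M]) (auto intro: mult_left_le)
  then show ?thesis ..
qed

section \<open>The normalizing constant\<close>

text \<open>
  The support lies in the unit ball, where \<open>cos(x \<bullet> e)\<close> is positive because \<open>|x \<bullet> e| < \<pi> / 2\<close>. Hence the real part of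
  the transform is positive.
\<close>

lemma fourier_bump_nonzero:
  fixes e :: "'a::euclidean_space"
  assumes "norm e = 1"
  shows "fourier bump e \<noteq> 0"
proof -
  obtain M where M: "tame (wt 1) M (bump :: 'a \<Rightarrow> real)"
    using schwartz_tame[of bump 1] bump_test_function test_functions_subset_schwartz by auto
  note [measurable] = tame_measurable[OF M]
  have int: "integrable lborel (bump :: 'a \<Rightarrow> real)" using tame_integrable[OF _ _ M] by simp
  have intc: "integrable lborel (\<lambda>x. cis (- (x \<bullet> e)) * complex_of_real (bump x))"
    by (rule Bochner_Integration.integrable_bound[OF int]) (auto simp: norm_mult)
  have nn: "0 \<le> cos (x \<bullet> e) * bump x" and pos: "norm x < 1 \<Longrightarrow> 0 < cos (x \<bullet> e) * bump x" for x
  proof -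
    have c: "0 < cos (x \<bullet> e)" if "norm x < 1"
    proof (rule cos_gt_zero_pi)
      have "\<bar>x \<bullet> e\<bar> < 1" using Cauchy_Schwarz_ineq2[of x e] that assms by simp
      then show "- (pi / 2) < x \<bullet> e" "x \<bullet> e < pi / 2" using pi_gt3 by auto
    qed
    show "0 \<le> cos (x \<bullet> e) * bump x"
      using c bump_support[of x] bump_nonneg[of x] by (cases "norm x < 1") auto
    assume "norm x < 1"
    moreover then have "(norm x)\<^sup>2 < 1" by (simp add: power_less_one_iff)
    ultimately show "0 < cos (x \<bullet> e) * bump x" using c by (simp add: bump_def flat_exp_def)
  qed
  have Re: "Re (fourier bump e) = (LBINT x. cos (x \<bullet> e) * bump x)"
    using integral_Re[OF intc] fourier_lborel[of "bump :: 'a \<Rightarrow> real" e] by simp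
  have ci: "integrable lborel (\<lambda>x. cos (x \<bullet> e) * bump x)" using integrable_Re[OF intc] by simp
  have "(LBINT x. cos (x \<bullet> e) * bump x) \<noteq> 0"
  proof
    assume "(LBINT x. cos (x \<bullet> e) * bump x) = 0"
    then have "AE x in lborel. cos (x \<bullet> e) * bump x = 0"
      using integral_nonneg_eq_0_iff_AE[OF ci] nn by simp
    then have "AE x in lborel. x \<notin> ball (0::'a) 1"
      by eventually_elim (use pos in force)
    then have "ball (0::'a) 1 \<in> null_sets lborel" by (subst AE_iff_null_sets) auto
    then have "emeasure lborel (ball (0::'a) 1) = 0" by (rule null_setsD1)
    then show False using unit_ball_vol_pos[of "DIM('a)"] by (subst (asm) emeasure_ball) auto
  qed
  then show ?thesis using Re by auto
qed

text \<open>
  Existence is \<open>fourier_Lam\<close>; for uniqueness it is enough to have one Schwartz function whose transform does not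
  vanish at one point other than the origin.
\<close>

lemma frac_laplacian_const_eq:
  assumes \<alpha>: "0 < \<alpha>" "\<alpha> < 2"
  shows "frac_laplacian_const TYPE('a::euclidean_space) \<alpha> = 1 / symbol_const TYPE('a) \<alpha>"
  unfolding frac_laplacian_const_def
proof (rule the_equality)
  let ?K = "symbol_const TYPE('a) \<alpha>"
  have K: "?K > 0" by (rule symbol_const_pos[OF \<alpha>])
  have F: "fourier (\<lambda>x. c * frac_laplacian_pv \<alpha> \<phi> x) \<xi> = complex_of_real (c * ?K * norm \<xi> powr \<alpha>) * fourier \<phi> \<xi>"
    if \<phi>: "\<phi> \<in> schwartz" for c and \<phi> :: "'a \<Rightarrow> real" and \<xi>
  proof -
    obtain M where M: "tame (wt \<alpha>) M \<phi>" using schwartz_tame[OF \<phi> \<alpha>] by blast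
    have "fourier (\<lambda>x. c * frac_laplacian_pv \<alpha> \<phi> x) \<xi> = complex_of_real c * fourier (Lam \<alpha> \<phi>) \<xi>"
      unfolding fourier_def frac_laplacian_pv_eq_Lam[OF \<alpha> M]
      by (simp add: mult.left_commute[of _ "complex_of_real c"])
    also have "\<dots> = complex_of_real (c * ?K * norm \<xi> powr \<alpha>) * fourier \<phi> \<xi>"
      unfolding fourier_Lam[OF \<alpha> M] by simp
    finally show ?thesis .
  qed
  show "1 / ?K > 0 \<and> (\<forall>\<phi>\<in>schwartz. \<forall>\<xi>::'a. fourier (\<lambda>x. 1 / ?K * frac_laplacian_pv \<alpha> \<phi> x) \<xi> = complex_of_real (norm \<xi> powr \<alpha>) * fourier \<phi> \<xi>)"
    using K F[of _ "1 / ?K"] by simp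
  fix c :: real
  assume c: "c > 0 \<and> (\<forall>\<phi>\<in>schwartz. \<forall>\<xi>::'a. fourier (\<lambda>x. c * frac_laplacian_pv \<alpha> \<phi> x) \<xi> = complex_of_real (norm \<xi> powr \<alpha>) * fourier \<phi> \<xi>)"
  obtain e :: 'a where e: "norm e = 1" using vector_choose_size[of 1] by auto
  have "bump \<in> (schwartz :: ('a \<Rightarrow> real) set)" using bump_test_function test_functions_subset_schwartz by blast
  then have "complex_of_real (c * ?K) * fourier bump e = fourier bump e"
    using F[of bump c e] c e by simp
  then have "complex_of_real (c * ?K) = 1" using fourier_bump_nonzero[OF e] by simp
  then have "c * ?K = 1" by (simp only: of_real_eq_1_iff)
  then show "c = 1 / ?K" using K by (simp add: field_simps)
qed

section \<open>The heat kernel\<close>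

definition heat :: "real \<Rightarrow> 'a::euclidean_space \<Rightarrow> real" where
  "heat r x = (4 * pi * r) powr (- real DIM('a) / 2) * exp (- (norm x)\<^sup>2 / (4 * r))"

definition heat_dt :: "real \<Rightarrow> 'a::euclidean_space \<Rightarrow> real" where
  "heat_dt r x = ((norm x)\<^sup>2 / (4 * r\<^sup>2) - real DIM('a) / (2 * r)) * heat r x"

lemma heat_measurable [measurable (raw)]:
  assumes [measurable]: "f \<in> borel_measurable M" "g \<in> borel_measurable M"
  shows "(\<lambda>w. heat (f w) (g w)) \<in> borel_measurable M"
  unfolding heat_def by measurable

lemma heat_dt_measurable [measurable (raw)]:
  assumes [measurable]: "f \<in> borel_measurable M" "g \<in> borel_measurable M"
  shows "(\<lambda>w. heat_dt (f w) (g w)) \<in> borel_measurable M"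
  unfolding heat_dt_def by measurable

lemma heat_pos: "r > 0 \<Longrightarrow> heat r x > 0"
  by (simp add: heat_def)

lemma heat_scale:
  fixes x :: "'a::euclidean_space"
  assumes "r > 0"
  shows "heat r x = r powr (- real DIM('a) / 2) * heat 1 (x /\<^sub>R sqrt r)"
proof -
  have "(norm (x /\<^sub>R sqrt r))\<^sup>2 = (norm x)\<^sup>2 / r"
    using assms by (simp add: power_mult_distrib power_inverse divide_inverse mult.commute)
  then show ?thesis using assms by (simp add: heat_def powr_mult mult_ac)
qed

lemma heat_dt_scale:
  fixes x :: "'a::euclidean_space"
  assumes "r > 0"
  shows "heat_dt r x = r powr (- real DIM('a) / 2 - 1) * heat_dt 1 (x /\<^sub>R sqrt r)"
proof -
  have n: "(norm (x /\<^sub>R sqrt r))\<^sup>2 = (norm x)\<^sup>2 / r"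
    using assms by (simp add: power_mult_distrib power_inverse divide_inverse mult.commute)
  have p: "r powr (- real DIM('a) / 2 - 1) = r powr (- real DIM('a) / 2) / r"
    using assms by (simp add: powr_diff)
  show ?thesis unfolding heat_dt_def heat_scale[OF assms, of x] n p
    using assms by (simp add: field_simps power2_eq_square)
qed

lemma heat_tame:
  assumes \<alpha>: "0 < \<alpha>" "\<alpha> < 2" and r: "r > 0"
  shows "\<exists>M>0. tame (wt \<alpha>) M (heat r :: 'a::euclidean_space \<Rightarrow> real)"
proof -
  have "heat r = (\<lambda>z::'a. (0 * (norm z)\<^sup>2 + (4 * pi * r) powr (- real DIM('a) / 2)) * exp (- (1 / (4 * r)) * (norm z)\<^sup>2))"
    by (simp add: heat_def fun_eq_iff)
  then show ?thesis using tame_gauss[of "1 / (4 * r)" \<alpha> 0 "(4 * pi * r) powr (- real DIM('a) / 2)"] r \<alpha> by simp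
qed

lemma heat_dt_eq_poly:
  "heat_dt r = (\<lambda>z::'a::euclidean_space. ((4 * pi * r) powr (- real DIM('a) / 2) / (4 * r\<^sup>2) * (norm z)\<^sup>2
     + (- (real DIM('a) / (2 * r) * (4 * pi * r) powr (- real DIM('a) / 2)))) * exp (- (1 / (4 * r)) * (norm z)\<^sup>2))"
  by (simp add: heat_dt_def heat_def fun_eq_iff algebra_simps)

lemma heat_dt_tame:
  assumes \<alpha>: "0 < \<alpha>" "\<alpha> < 2" and r: "r > 0"
  shows "\<exists>M>0. tame (wt \<alpha>) M (heat_dt r :: 'a::euclidean_space \<Rightarrow> real)"
  unfolding heat_dt_eq_poly by (rule tame_gauss[OF _ \<alpha>]) (use r in simp)

lemma heat_dt_elementary: "(\<lambda>x::'a::euclidean_space. heat_dt r (x - a)) \<in> elementary"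
  unfolding heat_dt_eq_poly
  by (intro elementary.mult elementary.add elementary.const elementary.exp elementary_norm_diff)

lemma poly_gauss_integrable:
  assumes "c > 0"
  shows "integrable lborel (\<lambda>\<xi>::'a::euclidean_space. (1 + norm \<xi>) ^ K * exp (- c * (norm \<xi>)\<^sup>2))"
proof -
  obtain C where C: "C > 0" "\<And>t. t \<ge> 0 \<Longrightarrow> (1 + t) ^ K * exp (- (c / 2) * t\<^sup>2) \<le> C"
    using poly_gauss_bounded[of "c / 2" K] assms by auto
  have "integrable lborel (\<lambda>\<xi>::'a. C * exp (- (c / 2) * (norm \<xi>)\<^sup>2))"
    using gauss_integral[of "c / 2", where 'a='a] assms by (intro integrable_mult_right) (simp add: has_bochner_integral_iff)
  then show ?thesis
  proof (rule Bochner_Integration.integrable_bound)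
    show "AE \<xi>::'a in lborel. norm ((1 + norm \<xi>) ^ K * exp (- c * (norm \<xi>)\<^sup>2)) \<le> norm (C * exp (- (c / 2) * (norm \<xi>)\<^sup>2))"
    proof (rule AE_I2)
      fix \<xi> :: 'a
      have "exp (- c * (norm \<xi>)\<^sup>2) = exp (- (c / 2) * (norm \<xi>)\<^sup>2) * exp (- (c / 2) * (norm \<xi>)\<^sup>2)"
        by (simp flip: exp_add)
      then have "(1 + norm \<xi>) ^ K * exp (- c * (norm \<xi>)\<^sup>2) = ((1 + norm \<xi>) ^ K * exp (- (c / 2) * (norm \<xi>)\<^sup>2)) * exp (- (c / 2) * (norm \<xi>)\<^sup>2)"
        by simp
      also have "\<dots> \<le> C * exp (- (c / 2) * (norm \<xi>)\<^sup>2)" by (intro mult_right_mono C) auto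
      finally show "norm ((1 + norm \<xi>) ^ K * exp (- c * (norm \<xi>)\<^sup>2)) \<le> norm (C * exp (- (c / 2) * (norm \<xi>)\<^sup>2))"
        using C(1) by (simp add: abs_mult)
    qed
  qed simp
qed

lemma gauss_weight_integrable:
  fixes f :: "'a::euclidean_space \<Rightarrow> real"
  assumes "c > 0" "f \<in> borel_measurable borel" "\<And>\<xi>. \<bar>f \<xi>\<bar> \<le> (1 + norm \<xi>) ^ K"
  shows "integrable lborel (\<lambda>\<xi>. f \<xi> * exp (- c * (norm \<xi>)\<^sup>2))"
proof (rule Bochner_Integration.integrable_bound[OF poly_gauss_integrable[OF assms(1), of K]])
  show "AE \<xi> in lborel. norm (f \<xi> * exp (- c * (norm \<xi>)\<^sup>2)) \<le> norm ((1 + norm \<xi>) ^ K * exp (- c * (norm \<xi>)\<^sup>2))"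
    using assms(3) by (intro AE_I2) (auto simp: abs_mult intro!: mult_right_mono order_trans[OF _ abs_ge_self])
qed (use assms(2) in measurable)

text \<open>
  Crude, but a polynomial bound is all that integrability against a Gaussian requires.
\<close>

lemma norm_powr_le_poly:
  assumes "0 < \<alpha>" "\<alpha> < 2"
  shows "\<bar>(norm \<xi>)\<^sup>2 * norm \<xi> powr \<alpha>\<bar> \<le> (1 + norm \<xi>) ^ 4"
proof -
  have "norm \<xi> powr \<alpha> \<le> (1 + norm \<xi>) powr \<alpha>" using assms by (intro powr_mono2) auto
  also have "\<dots> \<le> (1 + norm \<xi>) powr 2" using assms by (intro powr_mono) auto
  also have "\<dots> = (1 + norm \<xi>)\<^sup>2" by (subst powr_numeral) auto
  finally have "(norm \<xi>)\<^sup>2 * norm \<xi> powr \<alpha> \<le> (1 + norm \<xi>)\<^sup>2 * (1 + norm \<xi>)\<^sup>2"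
    by (intro mult_mono power_mono) auto
  then show ?thesis by (simp flip: power_add)
qed

lemma heat_fourier:
  fixes x :: "'a::euclidean_space"
  assumes "r > 0"
  shows "heat r x = (4 * pi\<^sup>2) powr (- real DIM('a) / 2) * (LBINT \<xi>. exp (- r * (norm \<xi>)\<^sup>2) * cos (x \<bullet> \<xi>))"
proof -
  have "(4 * pi\<^sup>2) powr (- real DIM('a) / 2) * (pi / r) powr (real DIM('a) / 2) = (4 * pi * r) powr (- real DIM('a) / 2)"
  proof -
    have "(pi / r) powr (real DIM('a) / 2) = (r / pi) powr (- real DIM('a) / 2)"
      using assms by (simp add: powr_minus powr_divide)
    moreover have "(4 * pi\<^sup>2) * (r / pi) = 4 * pi * r" by (simp add: power2_eq_square)
    ultimately show ?thesis using assms by (metis powr_mult)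
  qed
  then show ?thesis
    using gauss_cos_integral[OF assms, of x] by (simp add: heat_def has_bochner_integral_iff mult.assoc[symmetric])
qed

lemma exp_second_order: "\<bar>exp z - 1 - z\<bar> \<le> z\<^sup>2 * exp \<bar>z\<bar>" for z :: real
proof -
  have a: "0 \<le> exp z - 1 - z" using exp_ge_add_one_self[of z] by linarith
  have "(1 + - z) * exp z \<le> exp (- z) * exp z" by (intro mult_right_mono exp_ge_add_one_self) auto
  then have "exp z - 1 \<le> z * exp z" by (simp add: algebra_simps flip: exp_add)
  then have b: "exp z - 1 - z \<le> z * (exp z - 1)" by (simp add: algebra_simps)
  have "z * (exp z - 1) \<le> z\<^sup>2 * exp \<bar>z\<bar>"
  proof (cases "z \<ge> 0")
    case True
    then have "z * (exp z - 1) \<le> z * (z * exp z)" using \<open>exp z - 1 \<le> z * exp z\<close> by (intro mult_left_mono)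
    then show ?thesis using True by (simp add: power2_eq_square mult.assoc)
  next
    case False
    have "1 - exp z \<le> - z" using exp_ge_add_one_self[of z] by linarith
    then have "(- z) * (1 - exp z) \<le> (- z) * (- z)" using False by (intro mult_left_mono) auto
    also have "\<dots> = z\<^sup>2 * 1" by (simp add: power2_eq_square)
    also have "\<dots> \<le> z\<^sup>2 * exp \<bar>z\<bar>" by (intro mult_left_mono) auto
    finally show ?thesis by (simp add: algebra_simps)
  qed
  then show ?thesis using a b by linarith
qed

lemma heat_has_derivative:
  fixes x :: "'a::euclidean_space"
  assumes "r > 0"
  shows "((\<lambda>r. heat r x) has_field_derivative heat_dt r x) (at r)"
proof -
  have "((\<lambda>r. (4 * pi * r) powr p * exp (- q / (4 * r))) has_field_derivative
     (q / (4 * r\<^sup>2) + p / r) * ((4 * pi * r) powr p * exp (- q / (4 * r)))) (at r)" for p q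
    using assms by (auto intro!: derivative_eq_intros simp: powr_diff field_simps power2_eq_square)
  from this[of "- real DIM('a) / 2" "(norm x)\<^sup>2"] show ?thesis
    by (simp add: heat_def[abs_def] heat_dt_def)
qed

text \<open>
  Differentiation of \<open>heat_fourier\<close> under the integral sign. The bound \<open>exp_second_order\<close> shows that the integral
  differs from its linearization in \<open>r\<close> by \<open>O(s\<^sup>2)\<close>, and uniqueness of derivatives identifies the result with
  \<open>heat_dt\<close>.
\<close>

lemma heat_dt_fourier:
  fixes x :: "'a::euclidean_space"
  assumes r: "r > 0"
  shows "heat_dt r x = (LBINT \<xi>. - ((4 * pi\<^sup>2) powr (- real DIM('a) / 2)) * ((norm \<xi>)\<^sup>2 * exp (- r * (norm \<xi>)\<^sup>2)) * cos (x \<bullet> \<xi>))"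
proof -
  let ?G = "\<lambda>r. LBINT \<xi>. exp (- r * (norm \<xi>)\<^sup>2) * cos (x \<bullet> \<xi>)"
  let ?I = "LBINT \<xi>. (norm \<xi>)\<^sup>2 * exp (- r * (norm \<xi>)\<^sup>2) * cos (x \<bullet> \<xi>)"
  let ?J = "LBINT \<xi>::'a. ((norm \<xi>)\<^sup>2)\<^sup>2 * exp (- (r / 2) * (norm \<xi>)\<^sup>2)"
  have cosle: "\<bar>a * cos t\<bar> \<le> \<bar>a\<bar>" for a t :: real by (simp add: abs_mult mult_left_le)
  have le0: "\<bar>cos (x \<bullet> \<xi>)\<bar> \<le> (1 + norm \<xi>) ^ 0" for \<xi> by simp
  have le2: "\<bar>(norm \<xi>)\<^sup>2 * cos (x \<bullet> \<xi>)\<bar> \<le> (1 + norm \<xi>) ^ 2" for \<xi>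
    using order_trans[OF cosle[of "(norm \<xi>)\<^sup>2" "x \<bullet> \<xi>"]] power_mono[of "norm \<xi>" "1 + norm \<xi>" 2] by simp
  have le4: "\<bar>((norm \<xi>)\<^sup>2)\<^sup>2\<bar> \<le> (1 + norm \<xi>) ^ 4" for \<xi> :: 'a
    using power_mono[of "norm \<xi>" "1 + norm \<xi>" 4] by (simp flip: power_mult)
  have i0: "integrable lborel (\<lambda>\<xi>. exp (- s * (norm \<xi>)\<^sup>2) * cos (x \<bullet> \<xi>))" if "s > 0" for s
    using gauss_weight_integrable[OF that _ le0] by (simp add: mult.commute)
  have i2: "integrable lborel (\<lambda>\<xi>. (norm \<xi>)\<^sup>2 * exp (- r * (norm \<xi>)\<^sup>2) * cos (x \<bullet> \<xi>))"
    using gauss_weight_integrable[OF r _ le2] by (simp add: mult_ac)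
  have i4: "integrable lborel (\<lambda>\<xi>::'a. ((norm \<xi>)\<^sup>2)\<^sup>2 * exp (- (r / 2) * (norm \<xi>)\<^sup>2))"
    using r by (intro gauss_weight_integrable[OF _ _ le4]) auto
  have quad: "\<bar>?G (r + s) - ?G r + s * ?I\<bar> \<le> s\<^sup>2 * ?J" if s: "\<bar>s\<bar> < r / 2" for s
  proof -
    have rs: "r + s > 0" using s by linarith
    have E: "?G (r + s) - ?G r + s * ?I = (LBINT \<xi>. exp (- (r + s) * (norm \<xi>)\<^sup>2) * cos (x \<bullet> \<xi>) - exp (- r * (norm \<xi>)\<^sup>2) * cos (x \<bullet> \<xi>)
        + s * ((norm \<xi>)\<^sup>2 * exp (- r * (norm \<xi>)\<^sup>2) * cos (x \<bullet> \<xi>)))"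
      using i0[OF rs] i0[OF r] i2 by simp
    have "\<bar>?G (r + s) - ?G r + s * ?I\<bar> \<le> (LBINT \<xi>::'a. s\<^sup>2 * (((norm \<xi>)\<^sup>2)\<^sup>2 * exp (- (r / 2) * (norm \<xi>)\<^sup>2)))"
      unfolding E
    proof (intro integral_abs_bound[THEN order_trans] integral_mono integrable_abs integrable_mult_right i4
        Bochner_Integration.integrable_add Bochner_Integration.integrable_diff i0 i2 r rs)
      fix \<xi> :: 'a
      let ?q = "(norm \<xi>)\<^sup>2"
      let ?L = "exp (- (r + s) * ?q) * cos (x \<bullet> \<xi>) - exp (- r * ?q) * cos (x \<bullet> \<xi>) + s * (?q * exp (- r * ?q) * cos (x \<bullet> \<xi>))"
      have L: "?L = (exp (- r * ?q) * (exp (- s * ?q) - 1 - (- s * ?q))) * cos (x \<bullet> \<xi>)"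
        by (simp add: algebra_simps flip: exp_add)
      have "\<bar>?L\<bar> \<le> \<bar>exp (- r * ?q) * (exp (- s * ?q) - 1 - (- s * ?q))\<bar>" unfolding L by (rule cosle)
      also have "\<dots> \<le> exp (- r * ?q) * ((- s * ?q)\<^sup>2 * exp \<bar>- s * ?q\<bar>)"
        unfolding abs_mult[of "exp (- r * ?q)"] abs_exp_cancel by (rule mult_left_mono[OF exp_second_order]) simp
      also have "\<dots> = s\<^sup>2 * (?q\<^sup>2 * exp (- r * ?q + \<bar>s\<bar> * ?q))"
        by (simp only: exp_add) (simp add: power_mult_distrib abs_mult)
      also have "\<dots> \<le> s\<^sup>2 * (?q\<^sup>2 * exp (- (r / 2) * ?q))"
      proof -
        have "\<bar>s\<bar> * ?q \<le> (r / 2) * ?q" using s by (intro mult_right_mono) auto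
        then show ?thesis by (intro mult_left_mono) auto
      qed
      finally show "\<bar>exp (- (r + s) * ?q) * cos (x \<bullet> \<xi>) - exp (- r * ?q) * cos (x \<bullet> \<xi>) + s * (?q * exp (- r * ?q) * cos (x \<bullet> \<xi>))\<bar> \<le> s\<^sup>2 * (?q\<^sup>2 * exp (- (r / 2) * ?q))" .
    qed
    then show ?thesis by simp
  qed
  have "((\<lambda>s. (?G (r + s) - ?G r) / s + ?I) \<longlongrightarrow> 0) (at 0)"
  proof (rule Lim_null_comparison)
    show "\<forall>\<^sub>F s in at 0. norm ((?G (r + s) - ?G r) / s + ?I) \<le> \<bar>s\<bar> * ?J"
      unfolding eventually_at
    proof (intro exI[of _ "r / 2"] conjI ballI impI)
      fix s :: real assume "s \<noteq> 0 \<and> dist s 0 < r / 2"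
      then have s: "s \<noteq> 0" "\<bar>s\<bar> < r / 2" by auto
      then have e: "(?G (r + s) - ?G r) / s + ?I = (?G (r + s) - ?G r + s * ?I) / s" by (simp add: field_simps)
      have "\<bar>?G (r + s) - ?G r + s * ?I\<bar> / \<bar>s\<bar> \<le> s\<^sup>2 * ?J / \<bar>s\<bar>" by (intro divide_right_mono quad s) auto
      also have "\<dots> = \<bar>s\<bar> * ?J" using s(1) by (simp add: field_simps power2_eq_square flip: abs_mult)
      finally show "norm ((?G (r + s) - ?G r) / s + ?I) \<le> \<bar>s\<bar> * ?J" unfolding e real_norm_def abs_divide .
    qed (use r in simp)
    show "((\<lambda>s. \<bar>s\<bar> * ?J) \<longlongrightarrow> 0) (at (0::real))" by (intro tendsto_eq_intros) auto
  qed
  then have "((\<lambda>s. (?G (r + s) - ?G r) / s + ?I - ?I) \<longlongrightarrow> 0 - ?I) (at 0)" by (intro tendsto_intros)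
  then have "(?G has_field_derivative - ?I) (at r)" by (simp only: DERIV_def add_diff_cancel_right' diff_0)
  then have "((\<lambda>r. (4 * pi\<^sup>2) powr (- real DIM('a) / 2) * ?G r) has_field_derivative (4 * pi\<^sup>2) powr (- real DIM('a) / 2) * (- ?I)) (at r)"
    by (rule DERIV_cmult)
  then have "((\<lambda>r. heat r x) has_field_derivative (4 * pi\<^sup>2) powr (- real DIM('a) / 2) * (- ?I)) (at r)"
    by (rule has_field_derivative_transform_within_open[of _ _ _ "{0<..}"]) (use r in \<open>auto simp: heat_fourier\<close>)
  then have "heat_dt r x = (4 * pi\<^sup>2) powr (- real DIM('a) / 2) * (- ?I)"
    using DERIV_unique heat_has_derivative[OF r] by blast
  also have "\<dots> = (LBINT \<xi>. - ((4 * pi\<^sup>2) powr (- real DIM('a) / 2)) * ((norm \<xi>)\<^sup>2 * exp (- r * (norm \<xi>)\<^sup>2) * cos (x \<bullet> \<xi>)))"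
    by simp
  finally show ?thesis by (simp add: mult.assoc)
qed

lemma Gamma_laplace:
  fixes q A :: real
  assumes "q > 0" "A > 0"
  shows "has_bochner_integral lborel (\<lambda>l. indicator {0<..} l * (l powr (q - 1) * exp (- l * A))) (Gamma q * A powr (- q))"
  by (rule has_bochner_integral_nn_integral[OF _ _ _ Gamma_subordination[OF assms]])
    (use Gamma_real_pos[OF assms(1)] in \<open>auto simp: indicator_def\<close>)

context fixes \<alpha> :: real assumes \<alpha>: "0 < \<alpha>" "\<alpha> < 2" begin

lemma Lam_heat_dt:
  fixes x :: "'a::euclidean_space"
  assumes r: "r > 0"
  shows "Lam \<alpha> (heat_dt r) x = symbol_const TYPE('a) \<alpha> *
     (LBINT \<xi>. - ((4 * pi\<^sup>2) powr (- real DIM('a) / 2)) * ((norm \<xi>)\<^sup>2 * exp (- r * (norm \<xi>)\<^sup>2)) * norm \<xi> powr \<alpha> * cos (x \<bullet> \<xi>))"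
proof -
  let ?m = "\<lambda>\<xi>::'a. - ((4 * pi\<^sup>2) powr (- real DIM('a) / 2)) * ((norm \<xi>)\<^sup>2 * exp (- r * (norm \<xi>)\<^sup>2))"
  have le2: "\<bar>(norm \<xi>)\<^sup>2\<bar> \<le> (1 + norm \<xi>) ^ 2" for \<xi> :: 'a
    using power_mono[of "norm \<xi>" "1 + norm \<xi>" 2] by simp
  have i: "integrable lborel ?m"
    by (intro integrable_mult_right gauss_weight_integrable[OF r _ le2]) auto
  have "integrable lborel (\<lambda>\<xi>::'a. - ((4 * pi\<^sup>2) powr (- real DIM('a) / 2)) * (((norm \<xi>)\<^sup>2 * norm \<xi> powr \<alpha>) * exp (- r * (norm \<xi>)\<^sup>2)))"
    by (intro integrable_mult_right gauss_weight_integrable[OF r _ norm_powr_le_poly[OF \<alpha>]]) auto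
  then have ia: "integrable lborel (\<lambda>\<xi>. ?m \<xi> * norm \<xi> powr \<alpha>)" by (simp add: mult_ac)
  have "heat_dt r = (\<lambda>x::'a. LBINT \<xi>. ?m \<xi> * cos (x \<bullet> \<xi>))" using heat_dt_fourier[OF r] by (intro ext)
  then show ?thesis using Lam_cos_integral[OF \<alpha> i ia, of x] by simp
qed

text \<open>
  Fourier integrals on both sides: \<open>\<Lambda>\<close> contributes \<open>|\<xi>|\<^sup>\<alpha>\<close>, and integrating \<open>\<rho>^(\<alpha>/2-1) exp(-\<rho> |\<xi>|\<^sup>2)\<close> removes it again. In this
  sense the heat semigroup inverts \<open>\<Lambda>\<close>.
\<close>

lemma Lam_heat_dt_superposition:
  fixes x :: "'a::euclidean_space"
  assumes t: "t > 0"
  shows "(LBINT \<rho>. indicator {0<..} \<rho> * (\<rho> powr (\<alpha> / 2 - 1) * Lam \<alpha> (heat_dt (t + \<rho>)) x)) =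
     symbol_const TYPE('a) \<alpha> * Gamma (\<alpha> / 2) * heat_dt t x"
proof -
  let ?c = "(4 * pi\<^sup>2) powr (- real DIM('a) / 2)"
  let ?h = "\<lambda>\<rho>::real. indicator {0<..} \<rho> * \<rho> powr (\<alpha> / 2 - 1) :: real"
  define F where "F \<xi> \<rho> = (- ?c * ((norm \<xi>)\<^sup>2 * norm \<xi> powr \<alpha> * exp (- t * (norm \<xi>)\<^sup>2)) * cos (x \<bullet> \<xi>)) *
     (indicator {0<..} \<rho> * (\<rho> powr (\<alpha> / 2 - 1) * exp (- \<rho> * (norm \<xi>)\<^sup>2)))" for \<xi> :: 'a and \<rho> :: real
  have Fm: "case_prod F \<in> borel_measurable (lborel \<Otimes>\<^sub>M lborel)" unfolding F_def by measurable
  have F\<rho>: "has_bochner_integral lborel (F \<xi>) (Gamma (\<alpha> / 2) * (- ?c * ((norm \<xi>)\<^sup>2 * exp (- t * (norm \<xi>)\<^sup>2)) * cos (x \<bullet> \<xi>)))" for \<xi>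
  proof (cases "\<xi> = 0")
    case True
    then have "F \<xi> = (\<lambda>_. 0)" by (simp add: F_def fun_eq_iff)
    then show ?thesis using True by (simp add: has_bochner_integral_zero)
  next
    case False
    then have q: "(norm \<xi>)\<^sup>2 > 0" by simp
    have e: "((norm \<xi>)\<^sup>2) powr (- (\<alpha> / 2)) * norm \<xi> powr \<alpha> = 1"
    proof -
      have "((norm \<xi>)\<^sup>2) powr (- (\<alpha> / 2)) = norm \<xi> powr (2 * (- (\<alpha> / 2)))"
        using powr_powr[of "norm \<xi>" 2 "- (\<alpha> / 2)"] False by simp
      then show ?thesis using False by (simp flip: powr_add)
    qed
    have "has_bochner_integral lborel (F \<xi>) ((- ?c * ((norm \<xi>)\<^sup>2 * norm \<xi> powr \<alpha> * exp (- t * (norm \<xi>)\<^sup>2)) * cos (x \<bullet> \<xi>)) * (Gamma (\<alpha> / 2) * ((norm \<xi>)\<^sup>2) powr (- (\<alpha> / 2))))"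
      unfolding F_def using \<alpha> by (intro has_bochner_integral_mult_right Gamma_laplace q) simp
    moreover have "(- ?c * ((norm \<xi>)\<^sup>2 * norm \<xi> powr \<alpha> * exp (- t * (norm \<xi>)\<^sup>2)) * cos (x \<bullet> \<xi>)) * (Gamma (\<alpha> / 2) * ((norm \<xi>)\<^sup>2) powr (- (\<alpha> / 2)))
      = (((norm \<xi>)\<^sup>2) powr (- (\<alpha> / 2)) * norm \<xi> powr \<alpha>) * (Gamma (\<alpha> / 2) * (- ?c * ((norm \<xi>)\<^sup>2 * exp (- t * (norm \<xi>)\<^sup>2)) * cos (x \<bullet> \<xi>)))"
      by (simp add: mult_ac)
    ultimately show ?thesis by (simp only: e mult_1)
  qed
  have Fabs: "(LBINT \<rho>. norm (F \<xi> \<rho>)) = \<bar>Gamma (\<alpha> / 2) * (- ?c * ((norm \<xi>)\<^sup>2 * exp (- t * (norm \<xi>)\<^sup>2)) * cos (x \<bullet> \<xi>))\<bar>" for \<xi>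
  proof -
    let ?A = "- ?c * ((norm \<xi>)\<^sup>2 * norm \<xi> powr \<alpha> * exp (- t * (norm \<xi>)\<^sup>2)) * cos (x \<bullet> \<xi>)"
    let ?B = "\<lambda>\<rho>::real. indicator {0<..} \<rho> * (\<rho> powr (\<alpha> / 2 - 1) * exp (- \<rho> * (norm \<xi>)\<^sup>2)) :: real"
    have B: "0 \<le> ?B \<rho>" for \<rho> by (auto simp: indicator_def)
    have "(LBINT \<rho>. norm (F \<xi> \<rho>)) = (LBINT \<rho>. \<bar>?A\<bar> * ?B \<rho>)"
      unfolding F_def real_norm_def by (intro Bochner_Integration.integral_cong refl abs_mult_pos[symmetric] B)
    also have "\<dots> = \<bar>?A\<bar> * (LBINT \<rho>. ?B \<rho>)" by simp
    also have "\<dots> = \<bar>?A * (LBINT \<rho>. ?B \<rho>)\<bar>"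
      by (intro abs_mult_pos integral_nonneg_AE AE_I2 B)
    also have "?A * (LBINT \<rho>. ?B \<rho>) = (LBINT \<rho>. F \<xi> \<rho>)" unfolding F_def by simp
    finally show ?thesis using F\<rho>[of \<xi>] by (simp add: has_bochner_integral_iff)
  qed
  have i2: "integrable lborel (\<lambda>\<xi>. Gamma (\<alpha> / 2) * (- ?c * ((norm \<xi>)\<^sup>2 * exp (- t * (norm \<xi>)\<^sup>2)) * cos (x \<bullet> \<xi>)))"
  proof -
    have "\<bar>(norm \<xi>)\<^sup>2 * cos (x \<bullet> \<xi>)\<bar> \<le> (1 + norm \<xi>) ^ 2" for \<xi> :: 'a
    proof -
      have "(norm \<xi>)\<^sup>2 * \<bar>cos (x \<bullet> \<xi>)\<bar> \<le> (1 + norm \<xi>)\<^sup>2 * 1" by (intro mult_mono power_mono) auto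
      then show ?thesis by (simp add: abs_mult)
    qed
    then have "integrable lborel (\<lambda>\<xi>. Gamma (\<alpha> / 2) * (- ?c * (((norm \<xi>)\<^sup>2 * cos (x \<bullet> \<xi>)) * exp (- t * (norm \<xi>)\<^sup>2))))"
      by (intro integrable_mult_right gauss_weight_integrable[OF t]) auto
    then show ?thesis by (simp add: mult_ac)
  qed
  have Fint: "integrable (lborel \<Otimes>\<^sub>M lborel) (case_prod F)"
  proof (rule lborel_pair.Fubini_integrable[OF Fm])
    show "integrable lborel (\<lambda>\<xi>. LBINT \<rho>. norm (case (\<xi>, \<rho>) of (\<xi>, \<rho>) \<Rightarrow> F \<xi> \<rho>))"
      using integrable_abs[OF i2] by (simp only: prod.case Fabs)
    show "AE \<xi> in lborel. integrable lborel (\<lambda>\<rho>. case (\<xi>, \<rho>) of (\<xi>, \<rho>) \<Rightarrow> F \<xi> \<rho>)"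
      using F\<rho> by (simp add: has_bochner_integral_iff)
  qed
  have K: "symbol_const TYPE('a) \<alpha> > 0" by (rule symbol_const_pos[OF \<alpha>])
  have inner: "symbol_const TYPE('a) \<alpha> * (LBINT \<xi>. F \<xi> \<rho>) = indicator {0<..} \<rho> * (\<rho> powr (\<alpha> / 2 - 1) * Lam \<alpha> (heat_dt (t + \<rho>)) x)" for \<rho>
  proof (cases "\<rho> > 0")
    case True
    have "F \<xi> \<rho> = \<rho> powr (\<alpha> / 2 - 1) * (- ?c * ((norm \<xi>)\<^sup>2 * exp (- (t + \<rho>) * (norm \<xi>)\<^sup>2)) * norm \<xi> powr \<alpha> * cos (x \<bullet> \<xi>))" for \<xi>
    proof -
      have "exp (- (t + \<rho>) * (norm \<xi>)\<^sup>2) = exp (- t * (norm \<xi>)\<^sup>2) * exp (- \<rho> * (norm \<xi>)\<^sup>2)"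
        by (simp add: exp_add[symmetric] algebra_simps)
      then show ?thesis using True by (simp add: F_def mult_ac)
    qed
    then show ?thesis using True t by (simp add: Lam_heat_dt)
  qed (simp add: F_def)
  have "(LBINT \<rho>. LBINT \<xi>. F \<xi> \<rho>) = (LBINT \<xi>. LBINT \<rho>. F \<xi> \<rho>)" by (rule lborel_pair.Fubini_integral[OF Fint])
  also have "\<dots> = (LBINT \<xi>. Gamma (\<alpha> / 2) * (- ?c * ((norm \<xi>)\<^sup>2 * exp (- t * (norm \<xi>)\<^sup>2)) * cos (x \<bullet> \<xi>)))"
    using F\<rho> by (simp add: has_bochner_integral_iff)
  also have "\<dots> = Gamma (\<alpha> / 2) * heat_dt t x" unfolding heat_dt_fourier[OF t] by (rule integral_mult_right_zero)
  finally have "symbol_const TYPE('a) \<alpha> * (LBINT \<rho>. LBINT \<xi>. F \<xi> \<rho>) = symbol_const TYPE('a) \<alpha> * (Gamma (\<alpha> / 2) * heat_dt t x)" by simp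
  moreover have "(LBINT \<rho>. indicator {0<..} \<rho> * (\<rho> powr (\<alpha> / 2 - 1) * Lam \<alpha> (heat_dt (t + \<rho>)) x)) = symbol_const TYPE('a) \<alpha> * (LBINT \<rho>. LBINT \<xi>. F \<xi> \<rho>)"
    unfolding inner[symmetric] by (rule integral_mult_right_zero)
  ultimately show ?thesis by (simp only: mult.assoc)
qed

text \<open>
  Used with \<open>\<surd>r\<close> as the length scale of the heat kernel at time \<open>r\<close>. The parameter \<open>m\<close> allows a uniform estimate for all
  times bounded away from \<open>0\<close>.
\<close>

lemma wt_rescale:
  fixes x :: "'a::euclidean_space"
  assumes "0 < m" "m \<le> 1" "m \<le> r"
  shows "wt \<alpha> (x /\<^sub>R sqrt r) \<le> (r / m) powr ((real DIM('a) + \<alpha>) / 2) * wt \<alpha> x"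
proof -
  have r: "r > 0" using assms by linarith
  have "wt \<alpha> (x /\<^sub>R sqrt r) \<le> sqrt (r / m) powr (real DIM('a) + \<alpha>) * wt \<alpha> x"
  proof (rule wt_compare[OF \<alpha>])
    have 1: "1 \<le> sqrt (r / m)" using assms by simp
    have "1 \<le> 1 / sqrt m" using assms by simp
    also have "1 / sqrt m = sqrt (r / m) * inverse (sqrt r)" using r by (simp add: real_sqrt_divide field_simps)
    finally have "1 * norm x \<le> sqrt (r / m) * inverse (sqrt r) * norm x" by (intro mult_right_mono) auto
    then have "1 + norm x \<le> sqrt (r / m) + sqrt (r / m) * inverse (sqrt r) * norm x" using 1 by linarith
    then show "1 + norm x \<le> sqrt (r / m) * (1 + norm (x /\<^sub>R sqrt r))" using r by (simp add: algebra_simps)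
  qed (use assms r in simp)
  also have "sqrt (r / m) powr (real DIM('a) + \<alpha>) = (r / m) powr ((real DIM('a) + \<alpha>) / 2)"
    using r assms by (simp add: powr_half_sqrt[symmetric] powr_powr)
  finally show ?thesis .
qed

lemma Lam_cmult: "Lam \<alpha> (\<lambda>x. c * f x) x = c * Lam \<alpha> f x"
proof -
  have "(2 * (c * f x) - c * f (x + y) - c * f (x - y)) * rker \<alpha> y = c * (sdiff f x y * rker \<alpha> y)" for y
    by (simp add: algebra_simps)
  then show ?thesis unfolding Lam_def by (simp only: integral_mult_right_zero)
qed

text \<open>
  By scaling, \<open>\<Lambda>(\<partial>\<^sub>t h\<^sub>r)\<close> is \<open>r^(-n/2-1-\<alpha>/2)\<close> times a fixed function of \<open>x / \<surd>r\<close>, which is \<open>O(wt \<alpha> (x / \<surd>r))\<close>. Passing from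
  \<open>wt \<alpha> (x / \<surd>r)\<close> to \<open>wt \<alpha> x\<close> costs \<open>r^((n+\<alpha>)/2)\<close>, and exactly \<open>1 / r\<close> is left.
\<close>

lemma Lam_heat_dt_le:
  obtains C where "C \<ge> 0" "\<And>m r x. 0 < m \<Longrightarrow> m \<le> 1 \<Longrightarrow> m \<le> r \<Longrightarrow>
    \<bar>Lam \<alpha> (heat_dt r) (x::'a::euclidean_space)\<bar> \<le> C * m powr (- ((real DIM('a) + \<alpha>) / 2)) * (1 / r) * wt \<alpha> x"
proof -
  obtain M where M: "M > 0" "tame (wt \<alpha>) M (heat_dt 1 :: 'a \<Rightarrow> real)" using heat_dt_tame[OF \<alpha>, of 1] by auto
  let ?p = "(real DIM('a) + \<alpha>) / 2"
  let ?C = "Lam_bound TYPE('a) \<alpha> * M"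
  have C: "?C \<ge> 0" using M(1) Lam_bound_nonneg[OF \<alpha>, where 'a='a] by simp
  have "\<bar>Lam \<alpha> (heat_dt r) x\<bar> \<le> ?C * m powr (- ?p) * (1 / r) * wt \<alpha> x" if m: "0 < m" "m \<le> 1" "m \<le> r" for m r and x :: 'a
  proof -
    have r: "r > 0" using m by linarith
    have hd: "heat_dt r = (\<lambda>x::'a. r powr (- real DIM('a) / 2 - 1) * heat_dt 1 (x /\<^sub>R sqrt r))"
      using heat_dt_scale[OF r] by blast
    have "Lam \<alpha> (heat_dt r) x = r powr (- real DIM('a) / 2 - 1) * (sqrt r powr (- \<alpha>) * Lam \<alpha> (heat_dt 1) (x /\<^sub>R sqrt r))"
      unfolding hd Lam_cmult using Lam_scale[OF \<alpha>, of "sqrt r" "heat_dt 1" x] r by simp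
    also have "sqrt r powr (- \<alpha>) = r powr (- \<alpha> / 2)" using r by (simp add: powr_half_sqrt[symmetric] powr_powr)
    finally have "\<bar>Lam \<alpha> (heat_dt r) x\<bar> = r powr (- real DIM('a) / 2 - 1) * (r powr (- \<alpha> / 2) * \<bar>Lam \<alpha> (heat_dt 1) (x /\<^sub>R sqrt r)\<bar>)"
      by (simp add: abs_mult)
    also have "\<dots> \<le> r powr (- real DIM('a) / 2 - 1) * (r powr (- \<alpha> / 2) * (?C * ((r / m) powr ?p * wt \<alpha> x)))"
      using order_trans[OF Lam_le[OF \<alpha> M(2)] mult_left_mono[OF wt_rescale[OF m] C]]
      by (intro mult_left_mono) auto
    also have "\<dots> = (r powr (- real DIM('a) / 2 - 1) * r powr (- \<alpha> / 2) * r powr ?p) * ?C * m powr (- ?p) * wt \<alpha> x"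
    proof -
      have e0: "(r / m) powr ?p = r powr ?p * m powr (- ?p)"
        by (simp only: powr_divide powr_minus_divide times_divide_eq_right mult_1_right)
      have e: "r powr a * (r powr b * (K * ((r / m) powr ?p * w))) = (r powr a * r powr b * r powr ?p) * K * m powr (- ?p) * w" for a b K w
        unfolding e0 by (simp only: mult_ac)
      show ?thesis by (rule e)
    qed
    also have "r powr (- real DIM('a) / 2 - 1) * r powr (- \<alpha> / 2) * r powr ?p = 1 / r"
    proof -
      have "r powr (- real DIM('a) / 2 - 1) * r powr (- \<alpha> / 2) * r powr ?p = r powr (- 1)"
        unfolding powr_add[symmetric] by (rule arg_cong[where f="\<lambda>a. r powr a"]) (simp add: field_simps)
      then show ?thesis using r by (simp add: powr_minus_divide)
    qed
    finally show ?thesis by (simp add: mult_ac)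
  qed
  then show ?thesis using that C by blast
qed

lemma heat_dt_le:
  assumes "0 < s"
  obtains C where "C \<ge> 0" "\<And>r x. s \<le> r \<Longrightarrow> r \<le> t \<Longrightarrow> \<bar>heat_dt r (x::'a::euclidean_space)\<bar> \<le> C * wt \<alpha> x"
proof -
  obtain M where M: "M > 0" "tame (wt \<alpha>) M (heat_dt 1 :: 'a \<Rightarrow> real)" using heat_dt_tame[OF \<alpha>, of 1] by auto
  let ?p = "(real DIM('a) + \<alpha>) / 2"
  let ?m = "min 1 s"
  let ?C = "s powr (- real DIM('a) / 2 - 1) * M * (t / ?m) powr ?p"
  have "\<bar>heat_dt r x\<bar> \<le> ?C * wt \<alpha> x" if r: "s \<le> r" "r \<le> t" for r and x :: 'a
  proof -
    have r0: "r > 0" using r assms by linarith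
    have "(r / ?m) powr ?p \<le> (t / ?m) powr ?p" using r0 r assms \<alpha> by (intro powr_mono2 divide_right_mono) auto
    then have w: "wt \<alpha> (x /\<^sub>R sqrt r) \<le> (t / ?m) powr ?p * wt \<alpha> x"
      using order_trans[OF wt_rescale[of ?m r x]] r assms mult_right_mono[of "(r / ?m) powr ?p" "(t / ?m) powr ?p" "wt \<alpha> x"] wt_nonneg[OF \<alpha>, of x] by auto
    have "\<bar>heat_dt r x\<bar> = r powr (- real DIM('a) / 2 - 1) * \<bar>heat_dt 1 (x /\<^sub>R sqrt r)\<bar>"
      by (simp only: heat_dt_scale[OF r0, of x] abs_mult) simp
    also have "\<dots> \<le> s powr (- real DIM('a) / 2 - 1) * (M * ((t / ?m) powr ?p * wt \<alpha> x))"
      using r assms M(1) by (intro mult_mono powr_mono2' order_trans[OF tame_bound[OF M(2)] mult_left_mono[OF w]]) auto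
    finally show ?thesis by (simp add: mult_ac)
  qed
  moreover have "?C \<ge> 0" using M by simp
  ultimately show ?thesis using that by blast
qed

end

lemma integrable_product_bound:
  fixes F :: "'a::euclidean_space \<Rightarrow> 'b::euclidean_space \<Rightarrow> real"
  assumes F: "case_prod F \<in> borel_measurable (lborel \<Otimes>\<^sub>M lborel)"
    and b: "\<And>x y. \<bar>F x y\<bar> \<le> f x * g y" and f: "integrable lborel f" and g: "integrable lborel g"
  shows "integrable (lborel \<Otimes>\<^sub>M lborel) (case_prod F)"
proof (rule lborel_pair.Fubini_integrable[OF F])
  have Fi: "integrable lborel (F x)" for x
  proof (rule Bochner_Integration.integrable_bound)
    show "integrable lborel (\<lambda>y. f x * g y)" using g by simp
    show "F x \<in> borel_measurable lborel" using F by measurable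
    show "AE y in lborel. norm (F x y) \<le> norm (f x * g y)"
      using b by (intro AE_I2) (simp add: order_trans[OF _ abs_ge_self])
  qed
  then show "AE x in lborel. integrable lborel (\<lambda>y. case (x, y) of (x, y) \<Rightarrow> F x y)" by simp
  show "integrable lborel (\<lambda>x. LBINT y. norm (case (x, y) of (x, y) \<Rightarrow> F x y))"
  proof (rule Bochner_Integration.integrable_bound)
    show "integrable lborel (\<lambda>x. f x * (LBINT y. g y))" using f by simp
    show "(\<lambda>x. LBINT y. norm (case (x, y) of (x, y) \<Rightarrow> F x y)) \<in> borel_measurable lborel"
      using F by measurable
    show "AE x in lborel. norm (LBINT y. norm (case (x, y) of (x, y) \<Rightarrow> F x y)) \<le> norm (f x * (LBINT y. g y))"
    proof (rule AE_I2)
      fix x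
      have "(LBINT y. \<bar>F x y\<bar>) \<le> (LBINT y. f x * g y)"
        using g b by (intro integral_mono integrable_abs Fi) auto
      then show "norm (LBINT y. norm (case (x, y) of (x, y) \<Rightarrow> F x y)) \<le> norm (f x * (LBINT y. g y))"
        by (simp add: order_trans[OF _ abs_ge_self])
    qed
  qed
qed

section \<open>Harmonic functions against heat kernels\<close>

lemma wt_continuous: "continuous_on UNIV (wt \<alpha> :: 'a::euclidean_space \<Rightarrow> real)"
proof -
  have "1 + norm x \<noteq> 0" for x :: 'a using norm_ge_zero[of x] by linarith
  then show ?thesis unfolding wt_def by (intro continuous_intros) auto
qed

text \<open>
  Indicators of closed sets are limits of continuous functions of the distance to the set, and the closed sets
  generate the Borel sets and are stable under intersection.
\<close>

lemma AE_zero_of_continuous_tests: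
  fixes h :: "'a::euclidean_space \<Rightarrow> real"
  assumes h: "integrable lborel h"
    and z: "\<And>\<psi>. continuous_on UNIV \<psi> \<Longrightarrow> (\<And>x. 0 \<le> \<psi> x \<and> \<psi> x \<le> 1) \<Longrightarrow> (LBINT x. \<psi> x * h x) = 0"
  shows "AE x in lborel. h x = 0"
proof -
  have [measurable]: "h \<in> borel_measurable borel" using borel_measurable_integrable[OF h] by simp
  have si: "set_integrable lborel A h" if "A \<in> sets borel" for A
    using h that unfolding set_integrable_def by (intro integrable_mult_indicator) auto
  have whole: "(LBINT x. h x) = 0" using z[of "\<lambda>_. 1"] by simp
  have closed0: "(LINT x:A|lborel. h x) = 0" if A: "closed A" for A
  proof (cases "A = {}")
    case False
    let ?\<psi> = "\<lambda>k x. max 0 (1 - real k * infdist x A)"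
    have "(\<lambda>k. LBINT x. ?\<psi> k x * h x) \<longlonglongrightarrow> (LBINT x. indicator A x * h x)"
    proof (rule integral_dominated_convergence)
      show "integrable lborel (\<lambda>x. \<bar>h x\<bar>)" using h by simp
      show "(\<lambda>x. indicator A x * h x) \<in> borel_measurable lborel" using borel_closed[OF A] by measurable
      have "?\<psi> k \<in> borel_measurable borel" for k
        by (intro borel_measurable_continuous_onI continuous_intros)
      then show "(\<lambda>x. ?\<psi> k x * h x) \<in> borel_measurable lborel" for k by measurable
      show "AE x in lborel. norm (?\<psi> k x * h x) \<le> \<bar>h x\<bar>" for k
        by (intro AE_I2) (auto simp: abs_mult infdist_nonneg intro!: mult_left_le_one_le)
      show "AE x in lborel. (\<lambda>k. ?\<psi> k x * h x) \<longlonglongrightarrow> indicator A x * h x"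
      proof (rule AE_I2, intro tendsto_mult tendsto_const)
        fix x
        show "(\<lambda>k. ?\<psi> k x) \<longlonglongrightarrow> indicator A x"
        proof (cases "x \<in> A")
          case False
          then have d: "infdist x A > 0" using infdist_pos_not_in_closed[OF A \<open>A \<noteq> {}\<close>] by blast
          obtain K :: nat where K: "1 / infdist x A \<le> real K" using real_arch_simple by blast
          have "\<forall>\<^sub>F k in sequentially. ?\<psi> k x = indicator A x"
            using eventually_ge_at_top[of K]
          proof eventually_elim
            case (elim k)
            then have "1 / infdist x A \<le> real k" using K by (meson of_nat_mono order_trans)
            then show ?case using d \<open>x \<notin> A\<close> by (simp add: field_simps)
          qed
          then show ?thesis by (rule tendsto_eventually)
        qed simp
      qed
    qed
    moreover have "(LBINT x. ?\<psi> k x * h x) = 0" for k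
      by (intro z) (auto intro!: continuous_intros simp: infdist_nonneg)
    ultimately have "(LBINT x. indicator A x * h x) = 0" by (simp add: LIMSEQ_const_iff)
    then show ?thesis by (simp add: set_lebesgue_integral_def)
  qed (simp add: set_lebesgue_integral_def)
  have all0: "(LINT x:A|lborel. h x) = 0" if "A \<in> sets borel" for A
  proof -
    have sb: "sigma_sets UNIV (Collect closed) = sets (borel :: 'a measure)"
      unfolding borel_eq_closed by (simp add: sets_measure_of)
    have mem: "A \<in> sigma_sets UNIV (Collect closed)" using that unfolding sb .
    have IS: "Int_stable (Collect closed :: 'a set set)" by (auto simp: Int_stable_def)
    have sub: "Collect closed \<subseteq> Pow (UNIV :: 'a set)" by simp
    from IS sub mem show ?thesis
    proof (induction rule: sigma_sets_induct_disjoint)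
      case (compl A)
      note A = compl
      then have Ab: "A \<in> sets borel" using sb by simp
      have "(LINT x:UNIV - A|lborel. h x) = (LBINT x. h x - indicator A x *\<^sub>R h x)"
        unfolding set_lebesgue_integral_def by (intro Bochner_Integration.integral_cong refl) (auto simp: indicator_def)
      also have "\<dots> = (LBINT x. h x) - (LINT x:A|lborel. h x)"
        using h si[OF Ab] unfolding set_lebesgue_integral_def set_integrable_def by simp
      finally show "(LINT x:UNIV - A|lborel. h x) = 0" using whole A by simp
    next
      case (union A)
      note d = union(1) and r = union(2) and 0 = union(3)
      have Ab: "A i \<in> sets borel" for i using r unfolding sb by auto
      have "(LINT x:(\<Union>i. A i)|lborel. h x) = (\<Sum>i. (LINT x:(A i)|lborel. h x))"
        by (rule lebesgue_integral_countable_add) (use Ab d in \<open>auto simp: disjoint_family_on_def intro!: si\<close>)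
      then show "(LINT x:\<Union> (range A)|lborel. h x) = 0" using 0 by simp
    next
      case (basic A)
      then show ?case using closed0 by simp
    qed (simp add: set_lebesgue_integral_def)
  qed
  show ?thesis
  proof (rule density_unique_real[OF h])
    show "integrable lborel (\<lambda>_::'a. 0::real)" by simp
  qed (use all0 in \<open>simp add: set_lebesgue_integral_def\<close>)
qed

lemma heat_integral_1: "has_bochner_integral lborel (heat 1 :: 'a::euclidean_space \<Rightarrow> real) 1"
proof -
  have "has_bochner_integral lborel (\<lambda>x::'a. (4 * pi) powr (- real DIM('a) / 2) * exp (- (1/4) * (norm x)\<^sup>2))
     ((4 * pi) powr (- real DIM('a) / 2) * (pi / (1/4)) powr (real DIM('a) / 2))"
    by (intro has_bochner_integral_mult_right gauss_integral) simp
  then show ?thesis by (simp add: heat_def[abs_def] powr_minus mult.commute[of pi 4])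
qed

text \<open>
  The substitution \<open>x = z - \<surd>t y\<close>.
\<close>

lemma heat_convolution_rescale:
  fixes \<phi> :: "'a::euclidean_space \<Rightarrow> real"
  assumes "t > 0"
  shows "(LBINT x. \<phi> x * heat t (z - x)) = (LBINT y. \<phi> (z - sqrt t *\<^sub>R y) * heat 1 y)"
proof -
  have "(LBINT x. \<phi> x * heat t (z - x)) = (LBINT y. \<phi> (z - y) * heat t (z - (z - y)))"
    by (rule lborel_integral_reflect(1)[symmetric])
  also have "\<dots> = (LBINT y. \<phi> (z - y) * heat t y)" by simp
  also have "\<dots> = \<bar>sqrt t\<bar> ^ DIM('a) *\<^sub>R (LBINT y. \<phi> (z - sqrt t *\<^sub>R y) * heat t (sqrt t *\<^sub>R y))"
    by (rule lborel_integral_scale(1)) (use assms in simp)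
  also have "\<dots> = (LBINT y. sqrt t ^ DIM('a) * (\<phi> (z - sqrt t *\<^sub>R y) * heat t (sqrt t *\<^sub>R y)))"
    using assms by simp
  also have "\<dots> = (LBINT y. \<phi> (z - sqrt t *\<^sub>R y) * heat 1 y)"
  proof (intro Bochner_Integration.integral_cong refl)
    fix y :: 'a
    have "sqrt t ^ DIM('a) = t powr (real DIM('a) / 2)"
      using assms by (simp add: powr_half_sqrt[symmetric] powr_powr flip: powr_realpow)
    then have "sqrt t ^ DIM('a) * t powr (- real DIM('a) / 2) = 1"
      using assms by (simp add: powr_minus)
    moreover have "heat t (sqrt t *\<^sub>R y) = t powr (- real DIM('a) / 2) * heat 1 y"
      using heat_scale[OF assms, of "sqrt t *\<^sub>R y"] assms by simp
    ultimately show "sqrt t ^ DIM('a) * (\<phi> (z - sqrt t *\<^sub>R y) * heat t (sqrt t *\<^sub>R y)) = \<phi> (z - sqrt t *\<^sub>R y) * heat 1 y"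
      by simp
  qed
  finally show ?thesis .
qed

context
  fixes \<alpha> :: real and u :: "'a::euclidean_space \<Rightarrow> real"
  assumes \<alpha>: "0 < \<alpha>" "\<alpha> < 2"
    and u_measurable [measurable]: "u \<in> borel_measurable borel"
    and u_weighted: "integrable lborel (\<lambda>x. u x * wt \<alpha> x)"
    and u_harmonic: "\<And>\<phi>. \<phi> \<in> test_functions \<Longrightarrow> (LBINT x. u x * Lam \<alpha> \<phi> x) = 0"
begin

lemma weighted_integrable:
  assumes "g \<in> borel_measurable borel" "\<And>x. \<bar>g x\<bar> \<le> C * wt \<alpha> x"
  shows "integrable lborel (\<lambda>x. u x * g x)"
proof (rule Bochner_Integration.integrable_bound)
  show "integrable lborel (\<lambda>x. C * \<bar>u x * wt \<alpha> x\<bar>)" using u_weighted by (intro integrable_mult_right integrable_abs)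
  show "AE x in lborel. norm (u x * g x) \<le> norm (C * \<bar>u x * wt \<alpha> x\<bar>)"
  proof (rule AE_I2)
    fix x
    have "\<bar>u x\<bar> * \<bar>g x\<bar> \<le> \<bar>u x\<bar> * (C * wt \<alpha> x)" by (intro mult_left_mono assms) auto
    also have "\<dots> = C * \<bar>u x * wt \<alpha> x\<bar>" using wt_nonneg[OF \<alpha>, of x] by (simp add: abs_mult)
    finally have "\<bar>u x * g x\<bar> \<le> C * \<bar>u x * wt \<alpha> x\<bar>" by (simp only: abs_mult)
    then show "norm (u x * g x) \<le> norm (C * \<bar>u x * wt \<alpha> x\<bar>)"
      unfolding real_norm_def by (rule order_trans[OF _ abs_ge_self])
  qed
qed (use assms(1) in measurable)

text \<open>
  Truncate with \<open>bump (x / R)\<close>. The truncations are test functions and are tame with a constant independent of \<open>R\<close>,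
  so dominated convergence passes to the limit, first inside \<open>\<Lambda>\<close> and then in the integral against \<open>u\<close>.
\<close>

lemma pairing_elementary_zero:
  assumes "f \<in> elementary" and f: "tame (wt \<alpha>) M f"
  shows "(LBINT x. u x * Lam \<alpha> f x) = 0"
proof -
  obtain A where A: "tame (\<lambda>_::'a. 1) A bump" using bump_tame_one by blast
  define g where "g k x = bump (x /\<^sub>R (real k + 1)) * f x" for k :: nat and x :: 'a
  have gt: "tame (wt \<alpha>) (6 * A * M) (g k)" for k
    unfolding g_def by (intro tame_mult tame_dilate A f) simp
  have "g k \<in> test_functions" for k
  proof (rule test_function_criterion)
    show "g k \<in> elementary" unfolding g_def by (intro elementary.mult bump_dilate_elementary assms)
    fix x :: 'a assume "norm x > real k + 1"
    then have "norm (x /\<^sub>R (real k + 1)) \<ge> 1" by (simp add: field_simps)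
    then show "g k x = 0" unfolding g_def by (simp only: bump_support mult_zero_left)
  qed
  then have z: "(LBINT x. u x * Lam \<alpha> (g k) x) = 0" for k by (rule u_harmonic)
  have lim: "(\<lambda>k. g k x) \<longlonglongrightarrow> f x" for x
  proof -
    have "(\<lambda>k. inverse (real k + 1)) \<longlonglongrightarrow> 0" using LIMSEQ_inverse_real_of_nat by (simp add: add.commute)
    then have "(\<lambda>k. x /\<^sub>R (real k + 1)) \<longlonglongrightarrow> 0 *\<^sub>R x" by (intro tendsto_intros)
    then have s: "(\<lambda>k. x /\<^sub>R (real k + 1)) \<longlonglongrightarrow> 0" by (simp only: scaleR_zero_left)
    have "isCont bump (0::'a)" using tame_continuous[OF A] by (simp add: continuous_on_eq_continuous_at)
    then have "(\<lambda>k. bump (x /\<^sub>R (real k + 1))) \<longlonglongrightarrow> bump (0::'a)" by (rule isCont_tendsto_compose[OF _ s])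
    then have "(\<lambda>k. g k x) \<longlonglongrightarrow> 1 * f x" unfolding g_def bump_zero by (intro tendsto_intros)
    then show ?thesis by simp
  qed
  let ?C = "Lam_bound TYPE('a) \<alpha> * (6 * A * M)"
  have "(\<lambda>k. LBINT x. u x * Lam \<alpha> (g k) x) \<longlonglongrightarrow> (LBINT x. u x * Lam \<alpha> f x)"
  proof (rule integral_dominated_convergence)
    show "integrable lborel (\<lambda>x. ?C * \<bar>u x * wt \<alpha> x\<bar>)" using u_weighted by (intro integrable_mult_right integrable_abs)
    show "(\<lambda>x. u x * Lam \<alpha> f x) \<in> borel_measurable lborel"
      using Lam_measurable[OF \<alpha> tame_measurable[OF f]] by measurable
    show "(\<lambda>x. u x * Lam \<alpha> (g k) x) \<in> borel_measurable lborel" for k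
      using Lam_measurable[OF \<alpha> tame_measurable[OF gt]] by measurable
    show "AE x in lborel. (\<lambda>k. u x * Lam \<alpha> (g k) x) \<longlonglongrightarrow> u x * Lam \<alpha> f x"
      by (intro AE_I2 tendsto_mult tendsto_const Lam_tendsto[OF \<alpha> gt tame_measurable[OF f] lim])
    show "AE x in lborel. norm (u x * Lam \<alpha> (g k) x) \<le> ?C * \<bar>u x * wt \<alpha> x\<bar>" for k
    proof (rule AE_I2)
      fix x
      have "\<bar>u x\<bar> * \<bar>Lam \<alpha> (g k) x\<bar> \<le> \<bar>u x\<bar> * (?C * wt \<alpha> x)"
        using Lam_le[OF \<alpha> gt, of k x] by (intro mult_left_mono) (auto simp: mult.assoc)
      then show "norm (u x * Lam \<alpha> (g k) x) \<le> ?C * \<bar>u x * wt \<alpha> x\<bar>"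
        using wt_nonneg[OF \<alpha>, of x] by (simp add: abs_mult mult_ac)
    qed
  qed
  then show ?thesis unfolding z by (simp add: LIMSEQ_const_iff)
qed

lemma pairing_Lam_heat_dt:
  assumes "r > 0"
  shows "(LBINT z. u z * Lam \<alpha> (heat_dt r) (z - x)) = 0"
proof -
  obtain M where M: "tame (wt \<alpha>) M (heat_dt r :: 'a \<Rightarrow> real)" using heat_dt_tame[OF \<alpha> assms] by blast
  show ?thesis
    using pairing_elementary_zero[OF heat_dt_elementary tame_translate[OF \<alpha> M, of x]] Lam_translate[OF \<alpha>, of "heat_dt r" x]
    by simp
qed

text \<open>
  Integrate \<open>pairing_Lam_heat_dt\<close> over all later times with weight \<open>\<rho>^(\<alpha>/2-1)\<close>. Fubini's theorem applies because the
  integrand is bounded by a product, and \<open>Lam_heat_dt_superposition\<close> evaluates the integral over the times.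
\<close>

lemma pairing_heat_dt:
  assumes t: "t > 0"
  shows "(LBINT z. u z * heat_dt t (z - x)) = 0"
proof -
  let ?p = "(real DIM('a) + \<alpha>) / 2"
  let ?q = "real DIM('a) + \<alpha>"
  \<comment> \<open>All times \<open>t + \<rho>\<close> are at least \<open>m\<close>, as \<open>wt_rescale\<close> requires.\<close>
  define m where "m = min 1 t"
  have m: "0 < m" "m \<le> 1" "m \<le> t" using t by (auto simp: m_def)
  obtain C where C: "C \<ge> 0" "\<And>m r x. 0 < m \<Longrightarrow> m \<le> 1 \<Longrightarrow> m \<le> r \<Longrightarrow> \<bar>Lam \<alpha> (heat_dt r) (x::'a)\<bar> \<le> C * m powr (- ?p) * (1 / r) * wt \<alpha> x"
    using Lam_heat_dt_le[OF \<alpha>, where 'a='a] by blast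
  define F where "F z \<rho> = u z * (indicator {0<..} \<rho> * (\<rho> powr (\<alpha> / 2 - 1) * Lam \<alpha> (heat_dt (t + \<rho>)) (z - x)))" for z \<rho>
  let ?B = "C * m powr (- ?p) * (1 / m) * (1 + norm x) powr ?q"
  have B: "\<bar>F z \<rho>\<bar> \<le> (?B * \<bar>u z * wt \<alpha> z\<bar>) * time_majorant (\<alpha> / 2) \<rho>" for z \<rho>
  proof (cases "\<rho> > 0")
    case True
    have 1: "1 / (t + \<rho>) \<le> (1 / m) * min 1 (1 / \<rho>)"
    proof -
      have "1 / (t + \<rho>) \<le> 1 / m" using True m by (intro divide_left_mono mult_pos_pos) auto
      moreover have "1 / (t + \<rho>) \<le> 1 / m * (1 / \<rho>)"
      proof -
        have "m * \<rho> \<le> 1 * \<rho>" using m True by (intro mult_right_mono) auto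
        then have "m * \<rho> \<le> t + \<rho>" using t by linarith
        then show ?thesis using m True t by (simp add: frac_le)
      qed
      ultimately show ?thesis by (simp add: min_def mult.commute)
    qed
    have "\<bar>Lam \<alpha> (heat_dt (t + \<rho>)) (z - x)\<bar> \<le> C * m powr (- ?p) * (1 / (t + \<rho>)) * wt \<alpha> (z - x)"
      using C(2)[OF m(1,2), of "t + \<rho>" "z - x"] m True by simp
    also have "\<dots> \<le> C * m powr (- ?p) * ((1 / m) * min 1 (1 / \<rho>)) * ((1 + norm x) powr ?q * wt \<alpha> z)"
      using C(1) True m by (intro mult_mono mult_left_mono 1 wt_translate[OF \<alpha>]) (auto simp: wt_nonneg[OF \<alpha>])
    finally have "\<bar>u z\<bar> * (\<rho> powr (\<alpha> / 2 - 1) * \<bar>Lam \<alpha> (heat_dt (t + \<rho>)) (z - x)\<bar>) \<le>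
       \<bar>u z\<bar> * (\<rho> powr (\<alpha> / 2 - 1) * (C * m powr (- ?p) * ((1 / m) * min 1 (1 / \<rho>)) * ((1 + norm x) powr ?q * wt \<alpha> z)))"
      by (intro mult_left_mono) auto
    also have "\<dots> = (?B * (\<bar>u z\<bar> * wt \<alpha> z)) * (\<rho> powr (\<alpha> / 2 - 1) * min 1 (1 / \<rho>))" by (simp only: mult_ac)
    also have "\<bar>u z\<bar> * wt \<alpha> z = \<bar>u z * wt \<alpha> z\<bar>" using wt_nonneg[OF \<alpha>, of z] by (simp add: abs_mult)
    finally show ?thesis using True by (simp add: F_def time_majorant_def abs_mult)
  next
    case False
    then show ?thesis by (simp add: F_def time_majorant_def)
  qed
  have Fm: "case_prod F \<in> borel_measurable (lborel \<Otimes>\<^sub>M lborel)"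
    unfolding F_def Lam_def by measurable
  have Fint: "integrable (lborel \<Otimes>\<^sub>M lborel) (case_prod F)"
    by (rule integrable_product_bound[OF Fm B])
      (use \<alpha> u_weighted in \<open>auto intro!: integrable_mult_right integrable_abs time_majorant_integrable\<close>)
  have "(LBINT \<rho>. LBINT z. F z \<rho>) = (LBINT \<rho>::real. 0)"
  proof (intro Bochner_Integration.integral_cong refl)
    fix \<rho> :: real
    show "(LBINT z. F z \<rho>) = 0"
    proof (cases "\<rho> > 0")
      case True
      have "(LBINT z. F z \<rho>) = (LBINT z. \<rho> powr (\<alpha> / 2 - 1) * (u z * Lam \<alpha> (heat_dt (t + \<rho>)) (z - x)))"
        using True by (intro Bochner_Integration.integral_cong refl) (simp add: F_def)
      then show ?thesis using pairing_Lam_heat_dt[of "t + \<rho>" x] t True by simp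
    qed (simp add: F_def)
  qed
  moreover have "(LBINT z. LBINT \<rho>. F z \<rho>) = (LBINT z. (symbol_const TYPE('a) \<alpha> * Gamma (\<alpha> / 2)) * (u z * heat_dt t (z - x)))"
  proof (intro Bochner_Integration.integral_cong refl)
    fix z
    have "(LBINT \<rho>. F z \<rho>) = u z * (symbol_const TYPE('a) \<alpha> * Gamma (\<alpha> / 2) * heat_dt t (z - x))"
      unfolding F_def Lam_heat_dt_superposition[OF \<alpha> t, symmetric] by (rule integral_mult_right_zero)
    then show "(LBINT \<rho>. F z \<rho>) = (symbol_const TYPE('a) \<alpha> * Gamma (\<alpha> / 2)) * (u z * heat_dt t (z - x))" by (simp only: mult_ac)
  qed
  moreover have "(LBINT \<rho>. LBINT z. F z \<rho>) = (LBINT z. LBINT \<rho>. F z \<rho>)" by (rule lborel_pair.Fubini_integral[OF Fint])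
  ultimately have "(symbol_const TYPE('a) \<alpha> * Gamma (\<alpha> / 2)) * (LBINT z. u z * heat_dt t (z - x)) = 0" by simp
  moreover have "symbol_const TYPE('a) \<alpha> > 0" by (rule symbol_const_pos[OF \<alpha>])
  moreover have "Gamma (\<alpha> / 2) > 0" using \<alpha> by (intro Gamma_real_pos) simp
  ultimately show ?thesis by simp
qed

lemma heat_bound:
  fixes x :: 'a
  assumes "t > 0"
  shows "\<exists>M\<ge>0. \<forall>z. \<bar>heat t (z - x)\<bar> \<le> M * wt \<alpha> z"
proof -
  obtain M where M: "M > 0" "tame (wt \<alpha>) M (heat t :: 'a \<Rightarrow> real)" using heat_tame[OF \<alpha> assms] by blast
  have "\<bar>heat t (z - x)\<bar> \<le> M * (1 + norm x) powr (real DIM('a) + \<alpha>) * wt \<alpha> z" for z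
    by (rule tame_bound[OF tame_translate[OF \<alpha> M(2)]])
  moreover have "M * (1 + norm x) powr (real DIM('a) + \<alpha>) \<ge> 0" using M(1) by simp
  ultimately show ?thesis by blast
qed

lemma pairing_heat_integrable: "t > 0 \<Longrightarrow> integrable lborel (\<lambda>z. u z * heat t (z - x))"
  using heat_bound[of t x] by (auto intro!: weighted_integrable)

text \<open>
  Integrate \<open>pairing_heat_dt\<close> over the times between \<open>s\<close> and \<open>t\<close>.
\<close>

lemma pairing_heat_const_ordered:
  assumes s: "0 < s" and st: "s \<le> t"
  shows "(LBINT z. u z * heat t (z - x)) = (LBINT z. u z * heat s (z - x))"
proof -
  obtain C where C: "C \<ge> 0" "\<And>r y. s \<le> r \<Longrightarrow> r \<le> t \<Longrightarrow> \<bar>heat_dt r (y::'a)\<bar> \<le> C * wt \<alpha> y"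
    using heat_dt_le[OF \<alpha> s, where 'a='a] by blast
  define F where "F z r = u z * (indicator {s..t} r *\<^sub>R heat_dt r (z - x))" for z r
  have Fm: "case_prod F \<in> borel_measurable (lborel \<Otimes>\<^sub>M lborel)"
    unfolding F_def by measurable
  let ?B = "C * (1 + norm x) powr (real DIM('a) + \<alpha>)"
  have B: "\<bar>F z r\<bar> \<le> (?B * \<bar>u z * wt \<alpha> z\<bar>) * indicator {s..t} r" for z r
  proof (cases "r \<in> {s..t}")
    case True
    then have "\<bar>heat_dt r (z - x)\<bar> \<le> C * wt \<alpha> (z - x)" by (intro C) auto
    also have "\<dots> \<le> C * ((1 + norm x) powr (real DIM('a) + \<alpha>) * wt \<alpha> z)" using C(1) by (intro mult_left_mono wt_translate[OF \<alpha>])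
    finally have "\<bar>u z\<bar> * \<bar>heat_dt r (z - x)\<bar> \<le> \<bar>u z\<bar> * (C * ((1 + norm x) powr (real DIM('a) + \<alpha>) * wt \<alpha> z))"
      by (intro mult_left_mono) auto
    then show ?thesis using True wt_nonneg[OF \<alpha>, of z] by (simp add: F_def abs_mult mult_ac)
  qed (simp add: F_def)
  have "integrable lborel (indicator {s..t} :: real \<Rightarrow> real)"
    by (intro integrable_real_indicator) (simp_all add: emeasure_lborel_Icc[OF st])
  then have Fint: "integrable (lborel \<Otimes>\<^sub>M lborel) (case_prod F)"
    using u_weighted by (intro integrable_product_bound[OF Fm B] integrable_mult_right integrable_abs)
  have FTC: "(LBINT r. indicator {s..t} r *\<^sub>R heat_dt r y) = heat t y - heat s y" for y :: 'a
  proof (rule integral_FTC_Icc[OF st])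
    fix r assume "s \<le> r" "r \<le> t"
    then have "r > 0" using s by linarith
    then have "((\<lambda>r. heat r y) has_field_derivative heat_dt r y) (at r within {s..t})"
      by (rule has_field_derivative_at_within[OF heat_has_derivative])
    then show "((\<lambda>r. heat r y) has_vector_derivative heat_dt r y) (at r within {s..t})"
      by (simp add: has_real_derivative_iff_has_vector_derivative)
  next
    show "continuous_on {s..t} (\<lambda>r. heat_dt r y)"
      unfolding heat_dt_def heat_def using s by (intro continuous_intros) auto
  qed
  have "(LBINT r. LBINT z. F z r) = (LBINT r::real. 0)"
  proof (intro Bochner_Integration.integral_cong refl)
    fix r :: real
    show "(LBINT z. F z r) = 0"
      using pairing_heat_dt[of r x] s by (cases "r \<in> {s..t}") (simp_all add: F_def)
  qed
  moreover have "(LBINT z. LBINT r. F z r) = (LBINT z. u z * heat t (z - x) - u z * heat s (z - x))"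
    by (intro Bochner_Integration.integral_cong refl) (simp only: F_def integral_mult_right_zero FTC right_diff_distrib)
  moreover have "(LBINT r. LBINT z. F z r) = (LBINT z. LBINT r. F z r)" by (rule lborel_pair.Fubini_integral[OF Fint])
  ultimately show ?thesis using pairing_heat_integrable s st by simp
qed

lemma pairing_heat_const:
  assumes "s > 0" "t > 0"
  shows "(LBINT z. u z * heat t (z - x)) = (LBINT z. u z * heat s (z - x))"
  using pairing_heat_const_ordered[of s t x] pairing_heat_const_ordered[of t s x] assms by (cases "s \<le> t") auto

text \<open>
  The second-order difference \<open>?S\<close> of the proof annihilates linear functions, so in \<open>?S\<close> of \<open>y \<mapsto> h\<^sub>T(z - y)\<close> only the
  Taylor remainders of the heat kernel at \<open>z\<close> survive. They are \<open>O(T^(-n/2-1) wt \<alpha> (z / \<surd>T))\<close> by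
  scaling, and by \<open>wt_rescale\<close> this is \<open>O(T^(\<alpha>/2-1) wt \<alpha> z)\<close>. As \<open>U\<close> is the same at all times, \<open>T\<close> may tend to infinity.
\<close>

lemma pairing_heat_affine: "\<exists>a b. \<forall>x. (LBINT z. u z * heat 1 (z - x)) = a \<bullet> x + b"
proof -
  define U where "U x = (LBINT z. u z * heat 1 (z - x))" for x
  obtain M where M: "M > 0" "tame (wt \<alpha>) M (heat 1 :: 'a \<Rightarrow> real)" using heat_tame[OF \<alpha>, of 1] by auto
  obtain D where D: "\<And>a y::'a. norm y \<le> 1 \<Longrightarrow> \<bar>heat 1 (a + y) - heat 1 a - D a \<bullet> y\<bar> \<le> M * (norm y)\<^sup>2 * wt \<alpha> a"
    using M(2) unfolding tame_def by blast
  let ?p = "(real DIM('a) + \<alpha>) / 2"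
  have rem: "\<bar>heat T (z - x) - heat T z + T powr (- real DIM('a) / 2) * (D (z /\<^sub>R sqrt T) \<bullet> (x /\<^sub>R sqrt T))\<bar> \<le> M * (norm x)\<^sup>2 * T powr (\<alpha> / 2 - 1) * wt \<alpha> z"
    if T: "T \<ge> 1" "(norm x)\<^sup>2 \<le> T" for T and x z :: 'a
  proof -
    let ?k = "T powr (- real DIM('a) / 2)"
    have T0: "T > 0" using T by simp
    have ny: "(norm (x /\<^sub>R sqrt T))\<^sup>2 = (norm x)\<^sup>2 / T" using T0 by (simp add: power_mult_distrib power_inverse divide_inverse mult.commute)
    then have "(norm (x /\<^sub>R sqrt T))\<^sup>2 \<le> 1" using T T0 by simp
    then have "norm (- (x /\<^sub>R sqrt T)) \<le> 1" by (simp only: abs_square_le_1 abs_norm_cancel norm_minus_cancel)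
    from D[OF this, of "z /\<^sub>R sqrt T"]
    have d: "\<bar>heat 1 (z /\<^sub>R sqrt T - x /\<^sub>R sqrt T) - heat 1 (z /\<^sub>R sqrt T) + D (z /\<^sub>R sqrt T) \<bullet> (x /\<^sub>R sqrt T)\<bar> \<le> M * ((norm x)\<^sup>2 / T) * wt \<alpha> (z /\<^sub>R sqrt T)"
      unfolding norm_minus_cancel ny by simp
    have w: "wt \<alpha> (z /\<^sub>R sqrt T) \<le> T powr ?p * wt \<alpha> z" using wt_rescale[OF \<alpha>, of 1 T z] T by simp
    have "heat T (z - x) - heat T z + ?k * (D (z /\<^sub>R sqrt T) \<bullet> (x /\<^sub>R sqrt T)) = ?k * (heat 1 (z /\<^sub>R sqrt T - x /\<^sub>R sqrt T) - heat 1 (z /\<^sub>R sqrt T) + D (z /\<^sub>R sqrt T) \<bullet> (x /\<^sub>R sqrt T))"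
      unfolding heat_scale[OF T0, of "z - x"] heat_scale[OF T0, of z] scaleR_diff_right by (simp add: algebra_simps)
    then have "\<bar>heat T (z - x) - heat T z + ?k * (D (z /\<^sub>R sqrt T) \<bullet> (x /\<^sub>R sqrt T))\<bar> = ?k * \<bar>heat 1 (z /\<^sub>R sqrt T - x /\<^sub>R sqrt T) - heat 1 (z /\<^sub>R sqrt T) + D (z /\<^sub>R sqrt T) \<bullet> (x /\<^sub>R sqrt T)\<bar>"
      by (simp only: abs_mult) simp
    also have "\<dots> \<le> ?k * (M * ((norm x)\<^sup>2 / T) * (T powr ?p * wt \<alpha> z))"
      using M(1) T0 by (intro mult_left_mono order_trans[OF d mult_left_mono[OF w]]) auto
    also have "\<dots> = M * (norm x)\<^sup>2 * (?k * T powr ?p * T powr (- 1)) * wt \<alpha> z"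
      using T0 by (simp add: powr_minus_divide)
    also have "?k * T powr ?p * T powr (- 1) = T powr (\<alpha> / 2 - 1)"
      unfolding powr_add[symmetric] by (rule arg_cong[where f="\<lambda>a. T powr a"]) (simp add: field_simps)
    finally show ?thesis .
  qed
  have aff: "U x = U 0 + (\<Sum>b\<in>Basis. (x \<bullet> b) * (U b - U 0))" for x
  proof -
    let ?S = "\<lambda>f. f x - f 0 - (\<Sum>b\<in>Basis. (x \<bullet> b) * (f b - f (0::'a)))"
    let ?K = "M * ((norm x)\<^sup>2 + (\<Sum>b\<in>Basis. \<bar>x \<bullet> b\<bar>))"
    let ?W = "LBINT z. \<bar>u z * wt \<alpha> z\<bar>"
    have bd: "\<bar>?S U\<bar> \<le> ?K * ?W * T powr (\<alpha> / 2 - 1)" if T: "T \<ge> 1" "(norm x)\<^sup>2 \<le> T" for T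
    proof -
      have T0: "T > 0" using T by simp
      have UT: "U y = (LBINT z. u z * heat T (z - y))" for y unfolding U_def using T0 by (intro pairing_heat_const) auto
      define E where "E z = ?S (\<lambda>y. heat T (z - y))" for z
      have i: "integrable lborel (\<lambda>z. u z * heat T (z - y))" for y by (rule pairing_heat_integrable[OF T0])
      have hb: "has_bochner_integral lborel (\<lambda>z. u z * heat T (z - y)) (U y)" for y
        using i UT by (simp add: has_bochner_integral_iff)
      have "has_bochner_integral lborel (\<lambda>z. u z * heat T (z - x) - u z * heat T (z - 0) - (\<Sum>b\<in>Basis. (x \<bullet> b) * (u z * heat T (z - b) - u z * heat T (z - 0)))) (?S U)"
        by (intro has_bochner_integral_diff has_bochner_integral_sum has_bochner_integral_mult_right hb)
      moreover have "u z * heat T (z - x) - u z * heat T (z - 0) - (\<Sum>b\<in>Basis. (x \<bullet> b) * (u z * heat T (z - b) - u z * heat T (z - 0))) = u z * E z" for z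
        by (simp add: E_def right_diff_distrib sum_distrib_left mult_ac)
      ultimately have SU: "has_bochner_integral lborel (\<lambda>z. u z * E z) (?S U)" by simp
      have Eb: "\<bar>E z\<bar> \<le> ?K * T powr (\<alpha> / 2 - 1) * wt \<alpha> z" for z
      proof -
        let ?k = "T powr (- real DIM('a) / 2)"
        \<comment> \<open>The first-order term at \<open>z\<close>, linear in \<open>y\<close>, and the remainder.\<close>
        define L where "L y = ?k * (D (z /\<^sub>R sqrt T) \<bullet> (y /\<^sub>R sqrt T))" for y
        define R where "R y = heat T (z - y) - heat T z + L y" for y
        have Lx: "L x = (\<Sum>b\<in>Basis. (x \<bullet> b) * L b)"
        proof -
          have "D (z /\<^sub>R sqrt T) \<bullet> x = (\<Sum>b\<in>Basis. (x \<bullet> b) * (D (z /\<^sub>R sqrt T) \<bullet> b))"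
            by (subst euclidean_inner) (simp add: mult.commute)
          then show ?thesis by (simp add: L_def sum_distrib_left mult_ac)
        qed
        have ER: "E z = R x - (\<Sum>b\<in>Basis. (x \<bullet> b) * R b)"
          by (simp add: E_def R_def Lx algebra_simps sum.distrib sum_subtractf)
        have e1: "\<bar>E z\<bar> \<le> \<bar>R x\<bar> + \<bar>\<Sum>b\<in>Basis. (x \<bullet> b) * R b\<bar>" unfolding ER by (rule abs_triangle_ineq4)
        have e2: "\<bar>\<Sum>b\<in>Basis. (x \<bullet> b) * R b\<bar> \<le> (\<Sum>b\<in>Basis. \<bar>x \<bullet> b\<bar> * \<bar>R b\<bar>)"
          by (rule order_trans[OF sum_abs]) (simp add: abs_mult)
        have "\<bar>R x\<bar> + (\<Sum>b\<in>Basis. \<bar>x \<bullet> b\<bar> * \<bar>R b\<bar>) \<le> M * (norm x)\<^sup>2 * T powr (\<alpha> / 2 - 1) * wt \<alpha> z + (\<Sum>b\<in>Basis. \<bar>x \<bullet> b\<bar> * (M * 1 * T powr (\<alpha> / 2 - 1) * wt \<alpha> z))"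
        proof (intro add_mono sum_mono mult_left_mono)
          show "\<bar>R x\<bar> \<le> M * (norm x)\<^sup>2 * T powr (\<alpha> / 2 - 1) * wt \<alpha> z" unfolding R_def L_def by (rule rem[OF T])
          fix b :: 'a assume "b \<in> Basis"
          then show "\<bar>R b\<bar> \<le> M * 1 * T powr (\<alpha> / 2 - 1) * wt \<alpha> z" unfolding R_def L_def using rem[OF T(1), of b z] T(1) by simp
        qed auto
        also have "\<dots> = ?K * T powr (\<alpha> / 2 - 1) * wt \<alpha> z" by (simp add: sum_distrib_right sum_distrib_left algebra_simps)
        finally show ?thesis using e1 e2 by linarith
      qed
      have "\<bar>?S U\<bar> = \<bar>LBINT z. u z * E z\<bar>" using SU by (simp only: has_bochner_integral_iff)
      also have "\<dots> \<le> (LBINT z. (?K * T powr (\<alpha> / 2 - 1)) * \<bar>u z * wt \<alpha> z\<bar>)"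
      proof (intro integral_abs_bound[THEN order_trans] integral_mono integrable_abs integrable_mult_right u_weighted)
        show "integrable lborel (\<lambda>z. u z * E z)" using SU by (simp only: has_bochner_integral_iff)
        fix z
        have "\<bar>u z\<bar> * \<bar>E z\<bar> \<le> \<bar>u z\<bar> * (?K * T powr (\<alpha> / 2 - 1) * wt \<alpha> z)" by (intro mult_left_mono Eb) auto
        also have "\<dots> = (?K * T powr (\<alpha> / 2 - 1)) * \<bar>u z * wt \<alpha> z\<bar>"
          using wt_nonneg[OF \<alpha>, of z] by (simp only: abs_mult abs_of_nonneg mult_ac)
        finally show "\<bar>u z * E z\<bar> \<le> (?K * T powr (\<alpha> / 2 - 1)) * \<bar>u z * wt \<alpha> z\<bar>" by (simp only: abs_mult)
      qed
      also have "\<dots> = ?K * ?W * T powr (\<alpha> / 2 - 1)" by simp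
      finally show ?thesis .
    qed
    have "((\<lambda>T. ?K * ?W * T powr (\<alpha> / 2 - 1)) \<longlongrightarrow> ?K * ?W * 0) at_top"
      using \<alpha> by (intro tendsto_mult tendsto_const tendsto_neg_powr filterlim_ident) auto
    moreover have "\<forall>\<^sub>F T in at_top. \<bar>?S U\<bar> \<le> ?K * ?W * T powr (\<alpha> / 2 - 1)"
      using eventually_ge_at_top[of 1] eventually_ge_at_top[of "(norm x)\<^sup>2"] by eventually_elim (rule bd)
    ultimately have "\<bar>?S U\<bar> \<le> ?K * ?W * 0"
      by (rule tendsto_lowerbound) simp
    then show ?thesis by simp
  qed
  have "U x = (\<Sum>b\<in>Basis. (U b - U 0) *\<^sub>R b) \<bullet> x + U 0" for x
    by (subst aff) (simp add: inner_sum_left inner_commute[of x] mult.commute)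
  then show ?thesis unfolding U_def by blast
qed

lemma wt_shift_down: "wt \<alpha> x * wt \<alpha> (z - x) \<le> wt \<alpha> (z::'a)"
proof -
  let ?q = "real DIM('a) + \<alpha>"
  have "wt \<alpha> (z - x) \<le> (1 + norm x) powr ?q * wt \<alpha> z" by (rule wt_translate[OF \<alpha>])
  then have "wt \<alpha> x * wt \<alpha> (z - x) \<le> wt \<alpha> x * ((1 + norm x) powr ?q * wt \<alpha> z)"
    using wt_nonneg[OF \<alpha>] by (intro mult_left_mono)
  also have "wt \<alpha> x * ((1 + norm x) powr ?q * wt \<alpha> z) = wt \<alpha> z"
  proof -
    have "1 + norm x \<noteq> 0" using norm_ge_zero[of x] by linarith
    then show ?thesis by (simp add: wt_def[of _ x])
  qed
  finally show ?thesis .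
qed

text \<open>
  After the substitution \<open>x = z - \<surd>t y\<close> the functions \<open>y \<mapsto> \<phi> (z - \<surd>t y)\<close> converge pointwise to \<open>\<phi> z\<close>. For \<open>t \<le> 1\<close> they are
  at most \<open>(1 + |y|)^(n+\<alpha>) wt \<alpha> z\<close>, and a polynomial factor is harmless against a Gaussian.
\<close>

lemma heat_convolution_tendsto:
  fixes \<phi> :: "'a \<Rightarrow> real"
  assumes c: "continuous_on UNIV \<phi>" and b: "\<And>x. \<bar>\<phi> x\<bar> \<le> wt \<alpha> x"
  shows "(\<lambda>k. LBINT z. u z * (LBINT x. \<phi> x * heat (inverse (real (Suc k))) (z - x))) \<longlonglongrightarrow> (LBINT z. u z * \<phi> z)"
proof -
  have [measurable]: "\<phi> \<in> borel_measurable borel" using c by (rule borel_measurable_continuous_onI)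
  let ?N = "DIM('a) + 2"
  define t where "t k = inverse (real (Suc k))" for k
  have t: "t k > 0" "t k \<le> 1" for k by (auto simp: t_def field_simps)
  let ?H = "\<lambda>y::'a. (1 + norm y) ^ ?N * heat 1 y"
  have Hi: "integrable lborel ?H"
  proof -
    have "integrable lborel (\<lambda>y::'a. (4 * pi) powr (- real DIM('a) / 2) * ((1 + norm y) ^ ?N * exp (- (1/4) * (norm y)\<^sup>2)))"
      by (intro integrable_mult_right poly_gauss_integrable) simp
    then show ?thesis by (simp add: heat_def mult_ac)
  qed
  have maj: "\<bar>\<phi> (z - sqrt (t k) *\<^sub>R y) * heat 1 y\<bar> \<le> wt \<alpha> z * ?H y" for k z y
  proof -
    have h: "0 < heat 1 y" by (simp add: heat_pos)
    have "wt \<alpha> (z - sqrt (t k) *\<^sub>R y) \<le> (1 + norm (sqrt (t k) *\<^sub>R y)) powr (real DIM('a) + \<alpha>) * wt \<alpha> z" by (rule wt_translate[OF \<alpha>])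
    also have "\<dots> \<le> (1 + norm y) ^ ?N * wt \<alpha> z"
    proof (intro mult_right_mono wt_nonneg[OF \<alpha>])
      have "sqrt (t k) * norm y \<le> 1 * norm y" using t by (intro mult_right_mono) auto
      then have "(1 + norm (sqrt (t k) *\<^sub>R y)) powr (real DIM('a) + \<alpha>) \<le> (1 + norm y) powr (real DIM('a) + \<alpha>)"
        using \<alpha> t(1)[of k] by (intro powr_mono2) auto
      also have "\<dots> \<le> (1 + norm y) powr (real ?N)" using \<alpha> by (intro powr_mono) auto
      also have "\<dots> = (1 + norm y) ^ ?N" using norm_ge_zero[of y] by (intro powr_realpow) linarith
      finally show "(1 + norm (sqrt (t k) *\<^sub>R y)) powr (real DIM('a) + \<alpha>) \<le> (1 + norm y) ^ ?N" .
    qed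
    finally have "\<bar>\<phi> (z - sqrt (t k) *\<^sub>R y)\<bar> \<le> (1 + norm y) ^ ?N * wt \<alpha> z" using b order_trans by blast
    then have "\<bar>\<phi> (z - sqrt (t k) *\<^sub>R y)\<bar> * heat 1 y \<le> ((1 + norm y) ^ ?N * wt \<alpha> z) * heat 1 y"
      using h by (intro mult_right_mono) auto
    then show ?thesis using h by (simp add: abs_mult mult_ac)
  qed
  define q where "q k z = (LBINT x. \<phi> x * heat (t k) (z - x))" for k z
  have q: "q k z = (LBINT y. \<phi> (z - sqrt (t k) *\<^sub>R y) * heat 1 y)" for k z
    unfolding q_def by (rule heat_convolution_rescale[OF t(1)])
  have qm [measurable]: "q k \<in> borel_measurable borel" for k unfolding q_def[abs_def] by measurable
  have qlim: "(\<lambda>k. q k z) \<longlonglongrightarrow> \<phi> z" for z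
  proof -
    have "(\<lambda>k. LBINT y. \<phi> (z - sqrt (t k) *\<^sub>R y) * heat 1 y) \<longlonglongrightarrow> (LBINT y::'a. \<phi> z * heat 1 y)"
    proof (rule integral_dominated_convergence)
      show "integrable lborel (\<lambda>y. wt \<alpha> z * ?H y)" using Hi by (intro integrable_mult_right)
      show "AE y in lborel. (\<lambda>k. \<phi> (z - sqrt (t k) *\<^sub>R y) * heat 1 y) \<longlonglongrightarrow> \<phi> z * heat 1 y"
      proof (intro AE_I2 tendsto_mult tendsto_const)
        fix y
        have "(\<lambda>k. sqrt (t k)) \<longlonglongrightarrow> sqrt 0" unfolding t_def by (intro tendsto_real_sqrt LIMSEQ_inverse_real_of_nat)
        then have "(\<lambda>k. z - sqrt (t k) *\<^sub>R y) \<longlonglongrightarrow> z - sqrt 0 *\<^sub>R y" by (intro tendsto_diff tendsto_const tendsto_scaleR)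
        moreover have "isCont \<phi> z" using c by (simp add: continuous_on_eq_continuous_at)
        ultimately show "(\<lambda>k. \<phi> (z - sqrt (t k) *\<^sub>R y)) \<longlonglongrightarrow> \<phi> z" by (intro isCont_tendsto_compose[of z \<phi>]) auto
      qed
      show "AE y in lborel. norm (\<phi> (z - sqrt (t k) *\<^sub>R y) * heat 1 y) \<le> wt \<alpha> z * ?H y" for k
        using maj by simp
    qed measurable
    then show ?thesis using heat_integral_1[where 'a='a] by (simp add: q has_bochner_integral_iff)
  qed
  have qb: "\<bar>q k z\<bar> \<le> (LBINT y. ?H y) * wt \<alpha> z" for k z
  proof -
    have "integrable lborel (\<lambda>y. \<phi> (z - sqrt (t k) *\<^sub>R y) * heat 1 y)"
    proof (rule Bochner_Integration.integrable_bound)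
      show "integrable lborel (\<lambda>y. wt \<alpha> z * ?H y)" using Hi by (intro integrable_mult_right)
      show "AE y in lborel. norm (\<phi> (z - sqrt (t k) *\<^sub>R y) * heat 1 y) \<le> norm (wt \<alpha> z * ?H y)"
        using maj by (intro AE_I2) (simp only: real_norm_def order_trans[OF _ abs_ge_self])
    qed measurable
    then have "\<bar>q k z\<bar> \<le> (LBINT y. wt \<alpha> z * ?H y)"
      unfolding q using Hi maj by (intro integral_abs_bound[THEN order_trans] integral_mono integrable_abs integrable_mult_right)
    also have "\<dots> = wt \<alpha> z * (LBINT y. ?H y)" by (rule integral_mult_right_zero)
    finally show ?thesis by (simp only: mult.commute)
  qed
  have "(\<lambda>k. LBINT z. u z * q k z) \<longlonglongrightarrow> (LBINT z. u z * \<phi> z)"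
  proof (rule integral_dominated_convergence)
    show "integrable lborel (\<lambda>z. (LBINT y. ?H y) * \<bar>u z * wt \<alpha> z\<bar>)" using u_weighted by (intro integrable_mult_right integrable_abs)
    show "AE z in lborel. (\<lambda>k. u z * q k z) \<longlonglongrightarrow> u z * \<phi> z" by (intro AE_I2 tendsto_mult tendsto_const qlim)
    show "AE z in lborel. norm (u z * q k z) \<le> (LBINT y. ?H y) * \<bar>u z * wt \<alpha> z\<bar>" for k
    proof (rule AE_I2)
      fix z
      have "\<bar>u z\<bar> * \<bar>q k z\<bar> \<le> \<bar>u z\<bar> * ((LBINT y. ?H y) * wt \<alpha> z)" by (intro mult_left_mono qb) auto
      also have "\<dots> = (LBINT y. ?H y) * \<bar>u z * wt \<alpha> z\<bar>"
        using wt_nonneg[OF \<alpha>, of z] by (simp only: abs_mult abs_of_nonneg mult_ac)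
      finally show "norm (u z * q k z) \<le> (LBINT y. ?H y) * \<bar>u z * wt \<alpha> z\<bar>" by (simp only: real_norm_def abs_mult)
    qed
  qed measurable
  then show ?thesis unfolding q_def t_def .
qed

text \<open>
  Test against \<open>\<phi>\<close> and let \<open>t\<close> tend to \<open>0\<close>. The test functions are bounded by the square of the weight: one factor
  absorbs the translation in \<open>h\<^sub>t(z - x)\<close> by \<open>wt_shift_down\<close>, the other one makes the integral over \<open>x\<close> converge.
\<close>

lemma AE_eq_pairing_heat: "AE x in lborel. u x = (LBINT z. u z * heat 1 (z - x))"
proof -
  define U where "U x = (LBINT z. u z * heat 1 (z - x))" for x
  have key: "has_bochner_integral lborel (\<lambda>x. \<phi> x * U x) (LBINT z. u z * \<phi> z)"
    if c: "continuous_on UNIV \<phi>" and b: "\<And>x. \<bar>\<phi> x\<bar> \<le> wt \<alpha> x * wt \<alpha> x" for \<phi>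
  proof -
    have [measurable]: "\<phi> \<in> borel_measurable borel" using c by (rule borel_measurable_continuous_onI)
    have eq: "integrable lborel (\<lambda>x. \<phi> x * U x) \<and> (LBINT x. \<phi> x * U x) = (LBINT z. u z * (LBINT x. \<phi> x * heat t (z - x)))" if t: "t > 0" for t
    proof -
      obtain M where M: "M > 0" "tame (wt \<alpha>) M (heat t :: 'a \<Rightarrow> real)" using heat_tame[OF \<alpha> t] by blast
      define F where "F z x = u z * (\<phi> x * heat t (z - x))" for z x
      have Fm: "case_prod F \<in> borel_measurable (lborel \<Otimes>\<^sub>M lborel)" unfolding F_def by measurable
      have B: "\<bar>F z x\<bar> \<le> (M * \<bar>u z * wt \<alpha> z\<bar>) * wt \<alpha> x" for z x
      proof -
        have "\<bar>\<phi> x\<bar> * \<bar>heat t (z - x)\<bar> \<le> (wt \<alpha> x * wt \<alpha> x) * (M * wt \<alpha> (z - x))"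
          using b tame_bound[OF M(2)] wt_nonneg[OF \<alpha>] less_imp_le[OF M(1)] by (intro mult_mono) (auto intro!: mult_nonneg_nonneg)
        also have "\<dots> = (M * wt \<alpha> x) * (wt \<alpha> x * wt \<alpha> (z - x))" by (simp only: mult_ac)
        also have "\<dots> \<le> (M * wt \<alpha> x) * wt \<alpha> z" by (intro mult_left_mono wt_shift_down mult_nonneg_nonneg wt_nonneg[OF \<alpha>] less_imp_le[OF M(1)])
        finally have "\<bar>u z\<bar> * (\<bar>\<phi> x\<bar> * \<bar>heat t (z - x)\<bar>) \<le> \<bar>u z\<bar> * ((M * wt \<alpha> x) * wt \<alpha> z)" by (intro mult_left_mono) auto
        then show ?thesis using wt_nonneg[OF \<alpha>, of z] by (simp add: F_def abs_mult mult_ac)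
      qed
      have Fint: "integrable (lborel \<Otimes>\<^sub>M lborel) (case_prod F)"
        by (rule integrable_product_bound[OF Fm B])
          (use u_weighted wt_integrable[OF \<alpha>] in \<open>auto intro!: integrable_mult_right integrable_abs\<close>)
      have "(LBINT z. F z x) = \<phi> x * U x" for x
      proof -
        have "U x = (LBINT z. u z * heat t (z - x))" unfolding U_def using t by (intro pairing_heat_const) auto
        then have "\<phi> x * U x = (LBINT z. \<phi> x * (u z * heat t (z - x)))" by simp
        then show ?thesis by (auto simp: F_def mult_ac)
      qed
      then show ?thesis
        using lborel_pair.Fubini_integral[OF Fint] lborel_pair.integrable_snd[OF Fint] by (simp add: F_def)
    qed
    have "\<bar>\<phi> x\<bar> \<le> wt \<alpha> x" for x
      using b[of x] mult_left_mono[OF wt_le_1[OF \<alpha>, of x] wt_nonneg[OF \<alpha>, of x]] by linarith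
    then have "(\<lambda>k. LBINT z. u z * (LBINT x. \<phi> x * heat (inverse (real (Suc k))) (z - x))) \<longlonglongrightarrow> (LBINT z. u z * \<phi> z)"
      by (intro heat_convolution_tendsto c)
    moreover have "(LBINT z. u z * (LBINT x. \<phi> x * heat (inverse (real (Suc k))) (z - x))) = (LBINT x. \<phi> x * U x)" for k
      using eq[of "inverse (real (Suc k))"] by simp
    ultimately have "(LBINT x. \<phi> x * U x) = (LBINT z. u z * \<phi> z)" by (simp add: LIMSEQ_const_iff)
    then show ?thesis using eq[of 1] by (simp add: has_bochner_integral_iff)
  qed
  let ?w = "\<lambda>x::'a. wt \<alpha> x * wt \<alpha> x"
  have w1: "\<bar>\<psi> x * ?w x\<bar> \<le> ?w x" if "0 \<le> \<psi> x \<and> \<psi> x \<le> 1" for \<psi> :: "'a \<Rightarrow> real" and x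
    using that wt_nonneg[OF \<alpha>, of x] by (simp add: abs_mult mult_left_le_one_le)
  have wc: "continuous_on UNIV ?w" by (intro continuous_intros wt_continuous)
  have iu: "integrable lborel (\<lambda>z. u z * (\<psi> z * ?w z))" if "continuous_on UNIV \<psi>" "\<And>x. 0 \<le> \<psi> x \<and> \<psi> x \<le> 1" for \<psi>
  proof (rule weighted_integrable[of _ 1])
    show "(\<lambda>z. \<psi> z * ?w z) \<in> borel_measurable borel" by (intro borel_measurable_continuous_onI continuous_on_mult that(1) wc)
    show "\<bar>\<psi> x * ?w x\<bar> \<le> 1 * wt \<alpha> x" for x
      using w1[of \<psi> x] that(2) mult_left_mono[OF wt_le_1[OF \<alpha>, of x] wt_nonneg[OF \<alpha>, of x]] by fastforce
  qed
  have diff: "has_bochner_integral lborel (\<lambda>x. \<psi> x * (?w x * (u x - U x))) 0" if "continuous_on UNIV \<psi>" "\<And>x. 0 \<le> \<psi> x \<and> \<psi> x \<le> 1" for \<psi>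
  proof -
    have "has_bochner_integral lborel (\<lambda>x. (\<psi> x * ?w x) * U x) (LBINT z. u z * (\<psi> z * ?w z))"
      by (intro key continuous_on_mult that wc w1)
    moreover have "has_bochner_integral lborel (\<lambda>x. u x * (\<psi> x * ?w x)) (LBINT z. u z * (\<psi> z * ?w z))"
      using iu[OF that] by (rule has_bochner_integral_integrable)
    ultimately have "has_bochner_integral lborel (\<lambda>x. u x * (\<psi> x * ?w x) - (\<psi> x * ?w x) * U x) ((LBINT z. u z * (\<psi> z * ?w z)) - (LBINT z. u z * (\<psi> z * ?w z)))"
      by (intro has_bochner_integral_diff)
    then show ?thesis by (simp add: algebra_simps)
  qed
  have "AE x in lborel. ?w x * (u x - U x) = 0"
  proof (rule AE_zero_of_continuous_tests)
    show "integrable lborel (\<lambda>x. ?w x * (u x - U x))"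
      using diff[of "\<lambda>_. 1"] by (simp add: has_bochner_integral_iff)
    show "(LBINT x. \<psi> x * (?w x * (u x - U x))) = 0" if "continuous_on UNIV \<psi>" "\<And>x. 0 \<le> \<psi> x \<and> \<psi> x \<le> 1" for \<psi>
      using diff[OF that] by (rule has_bochner_integral_integral_eq)
  qed
  then show ?thesis
  proof eventually_elim
    case (elim x)
    then show ?case using wt_pos[OF \<alpha>, of x] by (simp add: U_def)
  qed
qed

lemma harmonic_AE_affine: "\<exists>a b. AE x in lborel. u x = a \<bullet> x + b"
proof -
  obtain a b where "\<And>x. (LBINT z. u z * heat 1 (z - x)) = a \<bullet> x + b" using pairing_heat_affine by blast
  with AE_eq_pairing_heat show ?thesis by auto
qed

end

section \<open>Affine functions of slow growth\<close>

text \<open>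
  Reflection removes \<open>b\<close>. The integral of \<open>|a \<bullet> x| |x|^(-n-\<alpha>)\<close> over \<open>|x| \<ge> 2\<close> is \<open>2^(1-\<alpha>) \<ge> 1\<close> times the one over \<open>|x| \<ge> 1\<close>, by
  scaling. Both being finite, the integral over the shell in between is \<open>0\<close>, so \<open>a \<bullet> x\<close> vanishes there.
\<close>

lemma weighted_linear_integrable_imp_zero:
  fixes a :: "'a::euclidean_space"
  assumes \<alpha>: "0 < \<alpha>" "\<alpha> \<le> 1" and int: "integrable lborel (\<lambda>x. (a \<bullet> x + b) * wt \<alpha> x)"
  shows "a = 0"
proof (rule ccontr)
  assume a0: "a \<noteq> 0"
  have \<alpha>2: "\<alpha> < 2" using \<alpha> by simp
  let ?q = "real DIM('a) + \<alpha>"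
  have "integrable lborel (\<lambda>x. (a \<bullet> (0 - x) + b) * wt \<alpha> (0 - x))"
    using int lborel_integral_reflect(2)[of "\<lambda>x. (a \<bullet> x + b) * wt \<alpha> x" 0] by simp
  then have "integrable lborel (\<lambda>x. (- (a \<bullet> x) + b) * wt \<alpha> x)" by (simp add: wt_def)
  with int have "integrable lborel (\<lambda>x. (a \<bullet> x + b) * wt \<alpha> x - (- (a \<bullet> x) + b) * wt \<alpha> x)"
    by (rule Bochner_Integration.integrable_diff)
  then have lin: "integrable lborel (\<lambda>x. 2 * ((a \<bullet> x) * wt \<alpha> x))" by (simp add: algebra_simps)
  define g where "g R x = indicator {x. R \<le> norm x} x * (\<bar>a \<bullet> x\<bar> * rker \<alpha> x)" for R :: real and x
  have gm [measurable]: "g R \<in> borel_measurable borel" for R unfolding g_def by measurable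
  have g0: "0 \<le> g R x" for R x by (simp add: g_def)
  have gi: "integrable lborel (g R)" if R: "R \<ge> 1" for R
  proof (rule Bochner_Integration.integrable_bound)
    show "integrable lborel (\<lambda>x. 2 powr ?q * (2 * ((a \<bullet> x) * wt \<alpha> x)))" using lin by (rule integrable_mult_right)
    show "AE x in lborel. norm (g R x) \<le> norm (2 powr ?q * (2 * ((a \<bullet> x) * wt \<alpha> x)))"
    proof (rule AE_I2)
      fix x
      show "norm (g R x) \<le> norm (2 powr ?q * (2 * ((a \<bullet> x) * wt \<alpha> x)))"
      proof (cases "R \<le> norm x")
        case True
        then have x: "norm x \<ge> 1" using R by linarith
        have k: "rker \<alpha> x \<le> 2 powr ?q * wt \<alpha> x" using x by (intro rker_le_wt[OF \<alpha>(1) \<alpha>2]) simp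
        have w: "0 \<le> wt \<alpha> x" by (rule wt_nonneg[OF \<alpha>(1) \<alpha>2])
        have "\<bar>a \<bullet> x\<bar> * rker \<alpha> x \<le> \<bar>a \<bullet> x\<bar> * (2 powr ?q * wt \<alpha> x)" by (intro mult_left_mono k) auto
        also have "\<dots> \<le> 2 * (\<bar>a \<bullet> x\<bar> * (2 powr ?q * wt \<alpha> x))" using w by simp
        finally show ?thesis using True w by (simp add: g_def abs_mult mult_ac)
      qed (simp add: g_def)
    qed
  qed simp
  have sc: "g 2 (2 *\<^sub>R x) = 2 * 2 powr (- ?q) * g 1 x" for x
  proof -
    have "(2 * norm x) powr ?q = 2 powr ?q * norm x powr ?q" by (rule powr_mult)
    then show ?thesis unfolding powr_minus_divide by (simp add: g_def rker_def indicator_def abs_mult)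
  qed
  have "(LBINT x. g 2 x) = \<bar>2\<bar> ^ DIM('a) *\<^sub>R (LBINT x. g 2 (2 *\<^sub>R x))" by (rule lborel_integral_scale(1)) simp
  also have "\<dots> = (2 ^ DIM('a) * (2 * 2 powr (- ?q))) * (LBINT x. g 1 x)" by (simp add: sc)
  also have "2 ^ DIM('a) * (2 * 2 powr (- ?q)) = (2::real) powr (1 - \<alpha>)"
  proof -
    have "2 ^ DIM('a) * (2 * 2 powr (- ?q)) = (2::real) powr real DIM('a) * (2 powr 1 * 2 powr (- ?q))" by (simp add: powr_realpow)
    also have "\<dots> = 2 powr (1 - \<alpha>)" by (simp only: powr_add[symmetric]) simp
    finally show ?thesis .
  qed
  finally have e: "(LBINT x. g 2 x) = 2 powr (1 - \<alpha>) * (LBINT x. g 1 x)" .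
  have i1: "0 \<le> (LBINT x. g 1 x)" by (intro integral_nonneg_AE AE_I2 g0)
  have "(1::real) \<le> 2 powr (1 - \<alpha>)" using \<alpha> by (intro ge_one_powr_ge_zero) auto
  then have ge: "(LBINT x. g 1 x) \<le> (LBINT x. g 2 x)" unfolding e using i1 by (simp add: mult_le_cancel_right1)
  have d: "0 \<le> g 1 x - g 2 x" for x by (auto simp: g_def indicator_def)
  have di: "integrable lborel (\<lambda>x. g 1 x - g 2 x)" by (intro Bochner_Integration.integrable_diff gi) auto
  have "(LBINT x. g 1 x - g 2 x) = (LBINT x. g 1 x) - (LBINT x. g 2 x)" by (intro Bochner_Integration.integral_diff gi) auto
  moreover have "0 \<le> (LBINT x. g 1 x - g 2 x)" by (intro integral_nonneg_AE AE_I2 d)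
  ultimately have "(LBINT x. g 1 x - g 2 x) = 0" using ge by linarith
  then have ae: "AE x in lborel. g 1 x - g 2 x = 0" using integral_nonneg_eq_0_iff_AE[OF di] d by simp
  let ?S = "{x. 1 < norm x \<and> norm x < 2 \<and> 0 < a \<bullet> x}"
  have op: "open ?S" by (intro open_Collect_conj open_Collect_less continuous_intros)
  have "AE x in lborel. x \<notin> ?S"
    using ae
  proof eventually_elim
    case (elim x)
    show ?case
    proof
      assume x: "x \<in> ?S"
      then have "rker \<alpha> x > 0" by (auto simp: rker_def)
      then show False using elim x by (simp add: g_def)
    qed
  qed
  then have "?S \<in> null_sets lborel" using op by (subst AE_iff_null_sets) auto
  then have "negligible ?S" by (simp add: negligible_iff_null_sets null_sets_completionI)
  moreover have "(3 / 2 / norm a) *\<^sub>R a \<in> ?S" using a0 by (simp add: dot_square_norm)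
  ultimately show False using open_not_negligible[OF op] by blast
qed

section \<open>The Liouville theorem\<close>

theorem theorem1p3:
  fixes u :: "real ^ 'n \<Rightarrow> real" and \<alpha> :: real
  assumes "0 < \<alpha>" and "\<alpha> < 2"
    and "u \<in> L_weighted \<alpha>"
    and "frac_harmonic \<alpha> u"
  shows "(\<exists>(a :: real ^ 'n) (b :: real). AE x in lebesgue. u x = a \<bullet> x + b) \<and>
         (\<alpha> \<le> 1 \<longrightarrow> (\<exists>b :: real. AE x in lebesgue. u x = b))"
proof -
  note \<alpha> = assms(1,2)
  let ?q = "real DIM(real ^ 'n) + \<alpha>"
  have u: "u \<in> borel_measurable lebesgue" "integrable lebesgue (\<lambda>x. \<bar>u x\<bar> / (1 + norm x powr ?q))"
    using assms(3) by (simp_all add: L_weighted_def)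
  \<comment> \<open>Fubini's theorem for \<open>lborel\<close> needs a Borel representative.\<close>
  obtain v where v [measurable]: "v \<in> borel_measurable borel" and uv: "AE x in lborel. u x = v x"
    using completion_ex_borel_measurable_real[OF u(1)] by auto
  have uv': "AE x in lebesgue. u x = v x" using uv by (rule AE_completion)
  have vm: "v \<in> borel_measurable lebesgue" by (rule measurable_completion) simp
  have vi: "integrable lborel (\<lambda>x. v x * wt \<alpha> x)"
  proof (rule Bochner_Integration.integrable_bound)
    have "integrable lebesgue (\<lambda>x. \<bar>v x\<bar> / (1 + norm x powr ?q))"
    proof (rule integrable_cong_AE_imp[OF u(2)])
      show "(\<lambda>x. \<bar>v x\<bar> / (1 + norm x powr ?q)) \<in> borel_measurable lebesgue"
        by (rule measurable_completion) measurable
    qed (use uv' in eventually_elim, simp)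
    then have "integrable lborel (\<lambda>x. \<bar>v x\<bar> / (1 + norm x powr ?q))"
      by (subst (asm) integrable_completion) measurable
    then show "integrable lborel (\<lambda>x. 2 * (\<bar>v x\<bar> / (1 + norm x powr ?q)))" by (rule integrable_mult_right)
    \<comment> \<open>The weight \<open>wt \<alpha>\<close> and the weight in the definition of \<open>L\<^sub>\<alpha>\<close> are comparable.\<close>
    show "AE x in lborel. norm (v x * wt \<alpha> x) \<le> norm (2 * (\<bar>v x\<bar> / (1 + norm x powr ?q)))"
    proof (rule AE_I2)
      fix x :: "real ^ 'n"
      let ?A = "(1 + norm x) powr ?q"
      have "norm x powr ?q \<le> ?A" "1 \<le> ?A"
        using \<alpha> by (auto intro!: powr_mono2 ge_one_powr_ge_zero)
      then have "1 / ?A \<le> 2 / (1 + norm x powr ?q)"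
        by (simp add: divide_simps add_pos_nonneg)
      then have "\<bar>v x\<bar> * wt \<alpha> x \<le> \<bar>v x\<bar> * (2 / (1 + norm x powr ?q))" unfolding wt_def by (intro mult_left_mono) auto
      moreover have "0 < 1 + norm x powr ?q" by (simp add: add_pos_nonneg)
      ultimately show "norm (v x * wt \<alpha> x) \<le> norm (2 * (\<bar>v x\<bar> / (1 + norm x powr ?q)))"
        using wt_nonneg[OF \<alpha>, of x] by (simp add: abs_mult mult_ac)
    qed
  qed measurable
  have vh: "(LBINT x. v x * Lam \<alpha> \<phi> x) = 0" if \<phi>: "\<phi> \<in> test_functions" for \<phi>
  proof -
    obtain M where M: "tame (wt \<alpha>) M \<phi>" using schwartz_tame[OF _ \<alpha>] \<phi> test_functions_subset_schwartz by blast
    let ?c = "1 / symbol_const TYPE(real ^ 'n) \<alpha>"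
    have fl: "frac_laplacian \<alpha> \<phi> = (\<lambda>x. ?c * Lam \<alpha> \<phi> x)"
      unfolding frac_laplacian_def[abs_def] frac_laplacian_const_eq[OF \<alpha>] frac_laplacian_pv_eq_Lam[OF \<alpha> M] ..
    note Lam_measurable[OF \<alpha> tame_measurable[OF M], measurable]
    have Lm: "Lam \<alpha> \<phi> \<in> borel_measurable lebesgue" by (rule measurable_completion) simp
    have "0 = (LINT x|lebesgue. u x * frac_laplacian \<alpha> \<phi> x)" using assms(4) \<phi> by (simp add: frac_harmonic_def)
    also have "\<dots> = (LINT x|lebesgue. v x * (?c * Lam \<alpha> \<phi> x))"
    proof (rule integral_cong_AE)
      show "AE x in lebesgue. u x * frac_laplacian \<alpha> \<phi> x = v x * (?c * Lam \<alpha> \<phi> x)"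
        using uv' by eventually_elim (simp add: fl)
    qed (use u(1) vm Lm in \<open>auto simp: fl\<close>)
    also have "\<dots> = (LBINT x. v x * (?c * Lam \<alpha> \<phi> x))" by (rule integral_completion) measurable
    also have "\<dots> = (LBINT x. ?c * (v x * Lam \<alpha> \<phi> x))" by (simp only: mult.left_commute)
    also have "\<dots> = ?c * (LBINT x. v x * Lam \<alpha> \<phi> x)" by (rule integral_mult_right_zero)
    finally show ?thesis using symbol_const_pos[OF \<alpha>, where 'a="real ^ 'n"] by simp
  qed
  obtain a b where ab: "AE x in lborel. v x = a \<bullet> x + b"
    using harmonic_AE_affine[OF \<alpha> v vi vh] by blast
  then have uab: "AE x in lborel. u x = a \<bullet> x + b" using uv by eventually_elim simp
  have "a = 0" if "\<alpha> \<le> 1"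
  proof (rule weighted_linear_integrable_imp_zero[OF \<alpha>(1) that])
    show "integrable lborel (\<lambda>x. (a \<bullet> x + b) * wt \<alpha> x)"
      by (rule integrable_cong_AE_imp[OF vi]) (use ab in \<open>auto elim: eventually_mono\<close>)
  qed
  then show ?thesis using AE_completion[OF uab] by auto
qed

end
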